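(* For each $k\ge3$, the construction of the context with $A_1=A_2=0$ gives a family of special Lagrangian $3$-folds $N$ in $\mathbb C^3$ depending on $A_3,\ldots,A_k\in\mathbb C$ and $B_1,\ldots,B_k\in\mathbb C$, with generic member a closed, nonsingular, immersed $3$-submanifold diffeomorphic to $\mathcal S^1\times\mathbb R^2$.
   Context: Construction. Let $\mathbf q_1(t)=(e^{it},ie^{-it},0)$, $\mathbf q_2(t)=(0,0,1)$, and $\mathbf p_j=(a_j,b_j,c_j)$ for $j=0,\ldots,k$, where $a_j,b_j,c_j:\mathbb R\to\mathbb C$ are differentiable and satisfy $\dot a_0=ie^{it}\bar c_1$, $\dot b_0=e^{-it}\bar c_1$, $\dot c_0=-ie^{it}\bar a_1-e^{-it}\bar b_1$; for $1\le j\le k-1$: $\dot a_j=(j+1)ie^{it}\bar c_{j+1}+j\bar b_j$, $\dot b_j=(j+1)e^{-it}\bar c_{j+1}-j\bar a_j$, $\dot c_j=-(j+1)(ie^{it}\bar a_{j+1}+e^{-it}\bar b_{j+1})$; $\dot a_k=k\bar b_k$, $\dot b_k=-k\bar a_k$, $\dot c_k=0$; together with $\operatorname{Im}c_k=0$ and $j\operatorname{Im}(e^{-it}a_j-ie^{it}b_j)+(j-1)\operatorname{Im}c_{j-1}=0$ for $j=1,\ldots,k$. The parameters $A_1\in\mathbb R$, $A_2,\ldots,A_k,B_1,\ldots,B_k\in\mathbb C$ are the constants of integration: the solution with given parameters is the one in which, for $1\le j\le k$, the coefficients of $e^{ijt}$ and $e^{-ijt}$ in $a_j$ are $A_j$ and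 $B_j$ respectively, $c_j$ has no constant term, and $a_0,b_0,c_0$ have no constant terms. (All these functions are trigonometric polynomials in $t$ except for terms linear in $t$ in $a_0,b_0,c_0$, with coefficients multiples of $\bar A_2,A_2,A_1$ respectively.) Set $\Phi(x,y,t)=\mathbf p_0(t)+x\,\mathbf p_1(t)+\cdots+x^k\,\mathbf p_k(t)+y\,\mathbf q_1(t)+xy\,\mathbf q_2(t)$ and $N=\operatorname{Image}\Phi$. When $A_1=A_2=0$, $\Phi(x,y,t+\pi)=\Phi(-x,-y,t)$, so $\Phi$ descends to $\mathbb R^3/\mathbb Z$, where $n\in\mathbb Z$ acts by $(x,y,t)\mapsto((-1)^nx,(-1)^ny,t+n\pi)$, and $N$ is regarded as the image of $\mathbb R^3/\mathbb Z$. A special Lagrangian $3$-fold in $\mathbb C^3$ is a real $3$-submanifold, suitably oriented, on which $\omega=\frac i2\sum_j dz_j\wedge d\bar z_j$ and $\operatorname{Im}(dz_1\wedge dz_2\wedge dz_3)$ vanish (equivalently, calibrated by $\operatorname{Re}(dz_1\wedge dz_2\wedge dz_3)$); non-generic members may have singular points, and are special Lagrangian wherever they are nonsingular. "Generic" means outside a subset of positive real codimension in the space of parameters $(A_3,\ldots,A_k,B_1,\ldots,B_k)$. *)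

theory Defs
  imports "HOL-Analysis.Analysis"
begin

section \<open>Smooth functions and smooth structures\<close>

text \<open>\<open>Ck_on n U f\<close> is meant for open \<open>U\<close>: \<open>f\<close> is \<open>n\<close> times continuously differentiable on \<open>U\<close>.\<close>

primrec Ck_on :: "nat \<Rightarrow> 'a::euclidean_space set \<Rightarrow> ('a \<Rightarrow> 'b::real_normed_vector) \<Rightarrow> bool" where
  "Ck_on 0 U f \<longleftrightarrow> continuous_on U f"
| "Ck_on (Suc n) U f \<longleftrightarrow>
     (\<exists>f'. (\<forall>x\<in>U. (f has_derivative f' x) (at x)) \<and> (\<forall>v. Ck_on n U (\<lambda>x. f' x v)))"

definition smooth_on :: "'a::euclidean_space set \<Rightarrow> ('a \<Rightarrow> 'b::real_normed_vector) \<Rightarrow> bool" where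
  "smooth_on U f \<longleftrightarrow> (\<forall>n. Ck_on n U f)"

text \<open>
  An atlas is a set of pairs of a coordinate domain \<open>U\<close> and a chart \<open>\<phi>\<close>, injective on \<open>U\<close> and with open
  image in a Euclidean space. All atlases below are of the form \<open>cover_atlas \<pi>\<close>, where \<open>\<pi>\<close> is a
  covering map defined on a Euclidean space and the charts are the inverses of \<open>\<pi>\<close> on the open sets
  on which \<open>\<pi>\<close> is injective. These atlases are closed under restricting charts to smaller open
  sets, so their coordinate domains form a basis of the topology, and the definitions below rely on this.
\<close>

type_synonym ('a, 'e) atlas = "('a set \<times> ('a \<Rightarrow> 'e)) set"

definition cover_atlas :: "('e::euclidean_space \<Rightarrow> 'a) \<Rightarrow> ('a, 'e) atlas" where
  "cover_atlas \<pi> = {(\<pi> ` W, the_inv_into W \<pi>) | W. open W \<and> inj_on \<pi> W}"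

definition atlas_carrier :: "('a, 'e) atlas \<Rightarrow> 'a set" where
  "atlas_carrier C = (\<Union>(U, \<phi>)\<in>C. U)"

definition smooth_map ::
    "('a, 'e::euclidean_space) atlas \<Rightarrow> ('b, 'f::euclidean_space) atlas \<Rightarrow> ('a \<Rightarrow> 'b) \<Rightarrow> bool" where
  "smooth_map C D f \<longleftrightarrow>
     (\<forall>p\<in>atlas_carrier C. \<exists>(U, \<phi>)\<in>C. \<exists>(V, \<psi>)\<in>D.
        p \<in> U \<and> f ` U \<subseteq> V \<and> smooth_on (\<phi> ` U) (\<psi> \<circ> f \<circ> the_inv_into U \<phi>))"

definition diffeomorphic ::
    "('a, 'e::euclidean_space) atlas \<Rightarrow> ('b, 'f::euclidean_space) atlas \<Rightarrow> bool" where
  "diffeomorphic C D \<longleftrightarrow>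
     (\<exists>f. bij_betw f (atlas_carrier C) (atlas_carrier D) \<and>
          smooth_map C D f \<and> smooth_map D C (the_inv_into (atlas_carrier C) f))"

definition smooth_into ::
    "('a, 'e::euclidean_space) atlas \<Rightarrow> ('a \<Rightarrow> 'b::real_normed_vector) \<Rightarrow> bool" where
  "smooth_into C F \<longleftrightarrow> (\<forall>(U, \<phi>)\<in>C. smooth_on (\<phi> ` U) (F \<circ> the_inv_into U \<phi>))"

text \<open>\<open>D\<close> is the differential of \<open>F\<close> at \<open>p\<close>, read in some chart around \<open>p\<close>.\<close>

definition differential_at ::
    "('a, 'e::euclidean_space) atlas \<Rightarrow> ('a \<Rightarrow> 'b::real_normed_vector) \<Rightarrow> 'a \<Rightarrow> ('e \<Rightarrow> 'b) \<Rightarrow> bool" where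
  "differential_at C F p D \<longleftrightarrow>
     (\<exists>(U, \<phi>)\<in>C. p \<in> U \<and> ((F \<circ> the_inv_into U \<phi>) has_derivative D) (at (\<phi> p)))"

definition immersed_at ::
    "('a, 'e::euclidean_space) atlas \<Rightarrow> ('a \<Rightarrow> 'b::real_normed_vector) \<Rightarrow> 'a \<Rightarrow> bool" where
  "immersed_at C F p \<longleftrightarrow> (\<exists>D. differential_at C F p D \<and> inj D)"

definition immersion ::
    "('a, 'e::euclidean_space) atlas \<Rightarrow> ('a \<Rightarrow> 'b::real_normed_vector) \<Rightarrow> bool" where
  "immersion C F \<longleftrightarrow> smooth_into C F \<and> (\<forall>p\<in>atlas_carrier C. immersed_at C F p)"


section \<open>Special Lagrangian 3-folds\<close>

definition kaehler_form :: "complex ^ 3 \<Rightarrow> complex ^ 3 \<Rightarrow> complex" where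
  "kaehler_form u v = \<i> / 2 * (\<Sum>j\<in>UNIV. u $ j * cnj (v $ j) - cnj (u $ j) * v $ j)"

definition holomorphic_volume :: "complex ^ 3 \<Rightarrow> complex ^ 3 \<Rightarrow> complex ^ 3 \<Rightarrow> complex" where
  "holomorphic_volume u v w = det (vector [u, v, w] :: complex ^ 3 ^ 3)"

definition special_lagrangian_plane :: "(complex ^ 3) set \<Rightarrow> bool" where
  "special_lagrangian_plane T \<longleftrightarrow>
     subspace T \<and> dim T = 3 \<and>
     (\<forall>u\<in>T. \<forall>v\<in>T. kaehler_form u v = 0) \<and>
     (\<forall>u\<in>T. \<forall>v\<in>T. \<forall>w\<in>T. Im (holomorphic_volume u v w) = 0)"

text \<open>
  A parametrised special Lagrangian 3-fold which may be singular: \<open>F\<close> is allowed to fail to be an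
  immersion, but only off a dense set, and the tangent space is special Lagrangian wherever
  \<open>F\<close> is an immersion.
\<close>

definition special_lagrangian_3fold ::
    "('a, 'e::euclidean_space) atlas \<Rightarrow> ('a \<Rightarrow> complex ^ 3) \<Rightarrow> bool" where
  "special_lagrangian_3fold C F \<longleftrightarrow>
     smooth_into C F \<and>
     (\<forall>(U, \<phi>)\<in>C. U \<noteq> {} \<longrightarrow> (\<exists>p\<in>U. immersed_at C F p)) \<and>
     (\<forall>p D. differential_at C F p D \<and> inj D \<longrightarrow> special_lagrangian_plane (range D))"


section \<open>The construction\<close>

text \<open>
  \<open>trig_coeff f n z\<close>: \<open>f\<close> is a trigonometric polynomial plus a term linear in \<open>t\<close>, and the
  coefficient of \<open>exp (i n t)\<close> in \<open>f\<close> is \<open>z\<close>.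
\<close>

definition trig_coeff :: "(real \<Rightarrow> complex) \<Rightarrow> int \<Rightarrow> complex \<Rightarrow> bool" where
  "trig_coeff f n z \<longleftrightarrow>
     (\<exists>m \<alpha>. finite {l. \<alpha> l \<noteq> 0} \<and>
        (\<forall>t. f t = m * of_real t + (\<Sum>l | \<alpha> l \<noteq> 0. \<alpha> l * cis (of_int l * t))) \<and> \<alpha> n = z)"

text \<open>
  \<open>p j t\<close> has components \<open>a j t, b j t, c j t\<close>. The values for \<open>j > k\<close> play no role; they are
  set to \<open>0\<close> so that the solution is unique.
\<close>

definition is_solution ::
    "nat \<Rightarrow> (nat \<Rightarrow> complex) \<Rightarrow> (nat \<Rightarrow> complex) \<Rightarrow> (nat \<Rightarrow> real \<Rightarrow> complex ^ 3) \<Rightarrow> bool" where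
  "is_solution k A B p \<longleftrightarrow>
    (let a = (\<lambda>j t. p j t $ 1); b = (\<lambda>j t. p j t $ 2); c = (\<lambda>j t. p j t $ 3) in
     (\<forall>t.
        (a 0 has_vector_derivative \<i> * cis t * cnj (c 1 t)) (at t) \<and>
        (b 0 has_vector_derivative cis (- t) * cnj (c 1 t)) (at t) \<and>
        (c 0 has_vector_derivative - \<i> * cis t * cnj (a 1 t) - cis (- t) * cnj (b 1 t)) (at t)) \<and>
     (\<forall>j\<in>{1..k - 1}. \<forall>t.
        (a j has_vector_derivative
           of_nat (j + 1) * \<i> * cis t * cnj (c (j + 1) t) + of_nat j * cnj (b j t)) (at t) \<and>
        (b j has_vector_derivative
           of_nat (j + 1) * cis (- t) * cnj (c (j + 1) t) - of_nat j * cnj (a j t)) (at t) \<and>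
        (c j has_vector_derivative
           - of_nat (j + 1) * (\<i> * cis t * cnj (a (j + 1) t) + cis (- t) * cnj (b (j + 1) t))) (at t)) \<and>
     (\<forall>t.
        (a k has_vector_derivative of_nat k * cnj (b k t)) (at t) \<and>
        (b k has_vector_derivative - of_nat k * cnj (a k t)) (at t) \<and>
        (c k has_vector_derivative 0) (at t)) \<and>
     (\<forall>t. Im (c k t) = 0) \<and>
     (\<forall>j\<in>{1..k}. \<forall>t.
        real j * Im (cis (- t) * a j t - \<i> * cis t * b j t) + (real j - 1) * Im (c (j - 1) t) = 0) \<and>
     (\<forall>j\<in>{1..k}. trig_coeff (a j) (int j) (A j) \<and> trig_coeff (a j) (- int j) (B j) \<and>
        trig_coeff (c j) 0 0) \<and>
     trig_coeff (a 0) 0 0 \<and> trig_coeff (b 0) 0 0 \<and> trig_coeff (c 0) 0 0 \<and>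
     (\<forall>j>k. p j = (\<lambda>t. 0)))"

definition q1 :: "real \<Rightarrow> complex ^ 3" where
  "q1 t = vector [cis t, \<i> * cis (- t), 0]"

definition q2 :: "real \<Rightarrow> complex ^ 3" where
  "q2 t = vector [0, 0, 1]"

definition Phi :: "nat \<Rightarrow> (nat \<Rightarrow> real \<Rightarrow> complex ^ 3) \<Rightarrow> real \<times> real \<times> real \<Rightarrow> complex ^ 3" where
  "Phi k p = (\<lambda>(x, y, t).
     (\<Sum>j\<le>k. (x ^ j) *\<^sub>R p j t) + y *\<^sub>R q1 t + (x * y) *\<^sub>R q2 t)"


section \<open>The domain\<close>

definition deck :: "int \<Rightarrow> real \<times> real \<times> real \<Rightarrow> real \<times> real \<times> real" where
  "deck n = (\<lambda>(x, y, t). ((-1) powi n * x, (-1) powi n * y, t + of_int n * pi))"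

text \<open>The projection to the quotient of 3-space by the integers, whose points are the orbits.\<close>

definition proj :: "real \<times> real \<times> real \<Rightarrow> (real \<times> real \<times> real) set" where
  "proj z = range (\<lambda>n. deck n z)"

definition quotient_atlas :: "((real \<times> real \<times> real) set, real \<times> real \<times> real) atlas" where
  "quotient_atlas = cover_atlas proj"

text \<open>The product of the unit circle in the complex plane with the real plane.\<close>

definition circle_times_plane :: "(complex \<times> real \<times> real, real \<times> real \<times> real) atlas" where
  "circle_times_plane = cover_atlas (\<lambda>(s, u, v). (cis s, u, v))"


section \<open>Parameters and genericity\<close>

text \<open>
  Parameters \<open>A j\<close> with \<open>3 \<le> j \<le> k\<close> and \<open>B j\<close> with \<open>1 \<le> j \<le> k\<close>; in particular \<open>A 1 = A 2 = 0\<close>.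
  For \<open>k \<ge> 2\<close> this is a real vector space of dimension \<open>2 * ((k - 2) + k) = 4 * k - 4\<close>.
\<close>

definition parameters :: "nat \<Rightarrow> ((nat \<Rightarrow> complex) \<times> (nat \<Rightarrow> complex)) set" where
  "parameters k = {(A, B). (\<forall>j. j \<notin> {3..k} \<longrightarrow> A j = 0) \<and> (\<forall>j. j \<notin> {1..k} \<longrightarrow> B j = 0)}"

text \<open>
  Continuous differentiability on an open subset of \<open>Euclidean_space d\<close>, whose points are functions
  on \<open>nat\<close>, in terms of partial derivatives.
\<close>

primrec Ck_coords :: "nat \<Rightarrow> (nat \<Rightarrow> real) set \<Rightarrow> nat \<Rightarrow> ((nat \<Rightarrow> real) \<Rightarrow> complex) \<Rightarrow> bool" where
  "Ck_coords d U 0 f \<longleftrightarrow> continuous_map (subtopology (Euclidean_space d) U) euclidean f"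
| "Ck_coords d U (Suc n) f \<longleftrightarrow>
     continuous_map (subtopology (Euclidean_space d) U) euclidean f \<and>
     (\<exists>g. \<forall>i<d.
        (\<forall>v\<in>U. ((\<lambda>s. f (v(i := s))) has_vector_derivative g i v) (at (v i))) \<and>
        Ck_coords d U n (g i))"

definition smooth_coords :: "nat \<Rightarrow> (nat \<Rightarrow> real) set \<Rightarrow> ((nat \<Rightarrow> real) \<Rightarrow> complex) \<Rightarrow> bool" where
  "smooth_coords d U f \<longleftrightarrow> (\<forall>n. Ck_coords d U n f)"

text \<open>
  A set has dimension at most \<open>d\<close> if it is contained in the image of a smooth map from a manifold of
  dimension \<open>d\<close>, that is, in a countable union of smooth images of open subsets of \<open>d\<close>-space.
  It has positive codimension if its dimension is at most that of the whole space minus one.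
\<close>

definition dimension_at_most ::
    "nat \<Rightarrow> ((nat \<Rightarrow> complex) \<times> (nat \<Rightarrow> complex)) set \<Rightarrow> bool" where
  "dimension_at_most d S \<longleftrightarrow>
     (\<exists>U g. (\<forall>n::nat. openin (Euclidean_space d) (U n) \<and>
               (\<forall>j. smooth_coords d (U n) (\<lambda>v. fst (g n v) j) \<and>
                    smooth_coords d (U n) (\<lambda>v. snd (g n v) j))) \<and>
            S \<subseteq> (\<Union>n. g n ` U n))"

definition positive_codimension ::
    "nat \<Rightarrow> ((nat \<Rightarrow> complex) \<times> (nat \<Rightarrow> complex)) set \<Rightarrow> bool" where
  "positive_codimension k S \<longleftrightarrow> S \<subseteq> parameters k \<and> dimension_at_most ((4 * k - 4) - 1) S"

end

theory Submission
  imports Defs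
begin

text \<open>
  The proof rests on three observations.

  \<^bold>\<open>Solving the equations.\<close> In terms of \<open>s = exp (- i t) a + i exp (i t) b\<close> and
  \<open>d = exp (- i t) a - i exp (i t) b\<close> the evolution equations have constant coefficients:
  \<open>s' = - i d - i j cnj d + 2 i (j + 1) cnj C\<close>, \<open>d' = - i s + i j cnj s\<close> and
  \<open>c' = - i (j + 1) cnj S\<close>, where \<open>S\<close> and \<open>C\<close> belong to the index \<open>j + 1\<close>. Their real and
  imaginary parts decouple: \<open>(Re s, Im d, Im c)\<close> is a chain of oscillators of frequency
  \<open>j - 1\<close> and \<open>(Im s, Re d, Re c)\<close> one of frequency \<open>j + 1\<close>, each forced by the index \<open>j + 2\<close>. So the
  solution is a finite sum of modes, of frequency \<open>l - 1\<close> with amplitude \<open>A l\<close> and of frequency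
  \<open>l + 1\<close> with amplitude \<open>B l\<close> up to a multiple of \<open>cnj (A (l + 2))\<close>. The weights of a mode
  in the different \<open>p j\<close> obey a two-term recursion (\<open>coef\<close>, \<open>mode_derivative\<close>). As \<open>A 1 = A 2 = 0\<close> there is no
  resonance, hence no term linear in \<open>t\<close>. Uniqueness holds since the homogeneous solutions are
  detected by the prescribed Fourier coefficients (\<open>evolves_normalised_zero\<close>).

  \<^bold>\<open>Special Lagrangian tangent planes.\<close> The equations say precisely that the derivative of \<open>Phi\<close> in \<open>t\<close>
  is the complex conjugate of the cross product of the derivatives in \<open>x\<close> and \<open>y\<close> (\<open>Phi_t_eq\<close>). It is
  therefore Hermitian orthogonal to both, and the holomorphic volume of the three vectors is
  the squared norm of the cross product, a real number. The vanishing of the Kaehler form on the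
  other two vectors is the constraint on the imaginary parts (\<open>Phi_isotropic\<close>). Moreover \<open>Phi\<close> is
  immersed wherever the cross product is nonzero, and for given \<open>x\<close> and \<open>t\<close> it vanishes
  for at most one \<open>y\<close>.

  \<^bold>\<open>Genericity.\<close> If the cross product vanishes at \<open>(x, y, t)\<close>, the parameters satisfy three
  real linear equations with coefficients depending on \<open>x\<close> and \<open>t\<close>; for \<open>x = 0\<close> one of
  them is void (\<open>singular_equations\<close>). There are thus always more equations than the unknowns among \<open>x\<close>
  and \<open>t\<close>, and solving them for \<open>A 3\<close> and one real component of the shifted \<open>B 1\<close> parametrises these
  parameters by one dimension less than all parameters have. The image is closed because
  \<open>Phi\<close> is proper modulo the deck transformations unless the leading coefficient of \<open>s\<close> as a polynomial
  in \<open>x\<close> has a zero \<open>t\<close>, which is again two real equations with one unknown. Finally, the deck transformations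
  turn the \<open>(x, y)\<close>-plane by half a turn while \<open>t\<close> grows by \<open>pi\<close>, so that in a frame rotating along
  with \<open>t\<close> the quotient becomes a product.
\<close>

section \<open>Trigonometric coefficients\<close>

lemma trig_coeff_finite_sum:
  assumes "finite I" and "\<And>t. f t = m * of_real t + (\<Sum>l\<in>I. \<alpha> l * cis (of_int l * t))"
    and "n \<notin> I \<Longrightarrow> z = 0" and "n \<in> I \<Longrightarrow> z = \<alpha> n"
  shows "trig_coeff f n z"
proof -
  define \<beta> where "\<beta> = (\<lambda>l. if l \<in> I then \<alpha> l else 0)"
  have sub: "{l. \<beta> l \<noteq> 0} \<subseteq> I" by (auto simp: \<beta>_def split: if_splits)
  have "(\<Sum>l\<in>I. \<alpha> l * cis (of_int l * t)) = (\<Sum>l | \<beta> l \<noteq> 0. \<beta> l * cis (of_int l * t))" for t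
    by (rule sum.mono_neutral_cong_right[OF assms(1) sub]) (auto simp: \<beta>_def)
  moreover have "\<beta> n = z" using assms(3,4) by (auto simp: \<beta>_def)
  ultimately show ?thesis
    unfolding trig_coeff_def using assms(2) finite_subset[OF sub assms(1)]
    by (intro exI[of _ m] exI[of _ \<beta>] conjI allI) simp_all
qed

text \<open>
  Two representations with different supports can be added once both are written over a common
  finite set of frequencies.
\<close>

lemma trig_coeff_expand:
  assumes "trig_coeff f n z"
  shows "\<exists>I \<alpha> m. finite I \<and> n \<in> I \<and> \<alpha> n = z \<and>
    (\<forall>J t. finite J \<and> I \<subseteq> J \<longrightarrow> f t = m * of_real t + (\<Sum>l\<in>J. \<alpha> l * cis (of_int l * t)))"
proof -
  obtain m \<alpha> where fin: "finite {l. \<alpha> l \<noteq> 0}"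
    and f: "\<And>t. f t = m * of_real t + (\<Sum>l | \<alpha> l \<noteq> 0. \<alpha> l * cis (of_int l * t))" and n: "\<alpha> n = z"
    using assms unfolding trig_coeff_def by blast
  have "f t = m * of_real t + (\<Sum>l\<in>J. \<alpha> l * cis (of_int l * t))"
    if "finite J" "insert n {l. \<alpha> l \<noteq> 0} \<subseteq> J" for J t
    unfolding f using that by (intro arg_cong2[where f="(+)"] refl sum.mono_neutral_left) auto
  then show ?thesis using fin n
    by (intro exI[of _ "insert n {l. \<alpha> l \<noteq> 0}"] exI[of _ \<alpha>] exI[of _ m]) simp
qed

lemma trig_coeff_add:
  assumes "trig_coeff f n z" "trig_coeff g n w"
  shows "trig_coeff (\<lambda>t. f t + g t) n (z + w)"
proof -
  obtain I \<alpha> m where 1: "finite I" "n \<in> I" "\<alpha> n = z"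
    "\<forall>J t. finite J \<and> I \<subseteq> J \<longrightarrow> f t = m * of_real t + (\<Sum>l\<in>J. \<alpha> l * cis (of_int l * t))"
    using trig_coeff_expand[OF assms(1)] by blast
  obtain I' \<alpha>' m' where 2: "finite I'" "n \<in> I'" "\<alpha>' n = w"
    "\<forall>J t. finite J \<and> I' \<subseteq> J \<longrightarrow> g t = m' * of_real t + (\<Sum>l\<in>J. \<alpha>' l * cis (of_int l * t))"
    using trig_coeff_expand[OF assms(2)] by blast
  show ?thesis
  proof (rule trig_coeff_finite_sum[of "I \<union> I'" _ "m + m'" "\<lambda>l. \<alpha> l + \<alpha>' l"])
    show "f t + g t = (m + m') * of_real t + (\<Sum>l\<in>I \<union> I'. (\<alpha> l + \<alpha>' l) * cis (of_int l * t))" for t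
      using 1(1) 2(1) by (subst 1(4)[rule_format, of "I \<union> I'"], simp, subst 2(4)[rule_format, of "I \<union> I'"])
        (simp_all add: distrib_right sum.distrib)
  qed (use 1 2 in simp_all)
qed

lemma trig_coeff_minus:
  assumes "trig_coeff f n z"
  shows "trig_coeff (\<lambda>t. - f t) n (- z)"
proof -
  obtain I \<alpha> m where 1: "finite I" "n \<in> I" "\<alpha> n = z"
    "\<forall>J t. finite J \<and> I \<subseteq> J \<longrightarrow> f t = m * of_real t + (\<Sum>l\<in>J. \<alpha> l * cis (of_int l * t))"
    using trig_coeff_expand[OF assms(1)] by blast
  show ?thesis
  proof (rule trig_coeff_finite_sum[of I _ "- m" "\<lambda>l. - \<alpha> l"])
    show "- f t = - m * of_real t + (\<Sum>l\<in>I. - \<alpha> l * cis (of_int l * t))" for t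
      using 1(1) by (subst 1(4)[rule_format, of I]) (simp_all add: sum_negf)
  qed (use 1 in simp_all)
qed

lemma trig_coeff_diff:
  "trig_coeff f n z \<Longrightarrow> trig_coeff g n w \<Longrightarrow> trig_coeff (\<lambda>t. f t - g t) n (z - w)"
  using trig_coeff_add[OF _ trig_coeff_minus, of f n z g w] by simp

lemma trig_coeff_cis: "trig_coeff (\<lambda>t. z * cis (of_int m * t)) n (if m = n then z else 0)"
  by (rule trig_coeff_finite_sum[of "{m}" _ 0 "\<lambda>_. z"]) auto

lemma trig_coeff_const: "trig_coeff (\<lambda>t. z) 0 z"
  using trig_coeff_cis[of z 0 0] by simp

lemma trig_coeff_sum:
  assumes "\<And>i. i \<in> I \<Longrightarrow> trig_coeff (f i) n (z i)"
  shows "trig_coeff (\<lambda>t. \<Sum>i\<in>I. f i t) n (\<Sum>i\<in>I. z i)"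
  using assms
proof (induction I rule: infinite_finite_induct)
  case (insert i I)
  then show ?case using trig_coeff_add[of "f i" n "z i" "\<lambda>t. \<Sum>i\<in>I. f i t"] by simp
qed (use trig_coeff_cis[of 0 0 n] in auto)

lemma has_vector_derivative_cis_scaled:
  "((\<lambda>t. cis (r * t)) has_vector_derivative \<i> * of_real r * cis (r * t)) (at t within S)"
proof -
  have "((\<lambda>z. exp (\<i> * of_real r * z)) has_field_derivative
      \<i> * of_real r * exp (\<i> * of_real r * of_real t)) (at (of_real t))"
    by (auto intro!: derivative_eq_intros)
  from has_vector_derivative_real_field[OF this, of S] show ?thesis
    by (simp add: cis_conv_exp mult_ac o_def)
qed

lemma has_integral_cis:
  "((\<lambda>t. cis (of_int l * t)) has_integral (if l = 0 then 2 * pi else 0)) {0..2 * pi}"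
proof (cases "l = 0")
  case True
  then show ?thesis using has_integral_const_real[of "1::complex" 0 "2 * pi"]
    by (simp add: scaleR_conv_of_real)
next
  case False
  have "((\<lambda>t. cis (of_int l * t)) has_integral
      (cis (of_int l * (2 * pi)) / (\<i> * of_int l) - cis (of_int l * 0) / (\<i> * of_int l))) {0..2 * pi}"
  proof (rule fundamental_theorem_of_calculus)
    show "((\<lambda>t. cis (of_int l * t) / (\<i> * of_int l)) has_vector_derivative cis (of_int l * t))
        (at t within {0..2 * pi})" for t
      using has_vector_derivative_divide[OF has_vector_derivative_cis_scaled[of "of_int l"], where a = "\<i> * of_int l"] False
      by simp
  qed simp
  moreover have "cis (of_int l * (2 * pi)) = 1"
    using cis_multiple_2pi[of "of_int l"] by (simp add: mult_ac)
  ultimately show ?thesis using False by simp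
qed

text \<open>
  The linear term is detected by the increment over a period, and the coefficients by
  orthogonality of the exponentials.
\<close>

lemma trig_coeff_zero:
  assumes "trig_coeff (\<lambda>t. 0) n z"
  shows "z = 0"
proof -
  obtain I \<alpha> m where 1: "finite I" "n \<in> I" "\<alpha> n = z"
    "\<forall>J t. finite J \<and> I \<subseteq> J \<longrightarrow> 0 = m * of_real t + (\<Sum>l\<in>J. \<alpha> l * cis (of_int l * t))"
    using trig_coeff_expand[OF assms] by blast
  have per: "cis (of_int l * (2 * pi)) = 1" for l
    using cis_multiple_2pi[of "of_int l"] by (simp add: mult_ac)
  have "m = 0" using 1(4)[rule_format, OF conjI, OF 1(1) order_refl, of 0] 1(4)[rule_format, OF conjI, OF 1(1) order_refl, of "2 * pi"] by (simp add: per)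
  have "((\<lambda>t. \<Sum>l\<in>I. \<alpha> l * cis (of_int (l - n) * t)) has_integral
      (\<Sum>l\<in>I. \<alpha> l * (if l - n = 0 then 2 * pi else 0))) {0..2 * pi}"
    by (intro has_integral_sum 1 has_integral_mult_right has_integral_cis)
  moreover have "(\<Sum>l\<in>I. \<alpha> l * cis (of_int (l - n) * t)) = 0" for t
  proof -
    have "(\<Sum>l\<in>I. \<alpha> l * cis (of_int (l - n) * t)) =
        (\<Sum>l\<in>I. \<alpha> l * cis (of_int l * t)) * cis (- of_int n * t)"
      unfolding sum_distrib_right by (intro sum.cong) (auto simp: cis_mult algebra_simps)
    then show ?thesis using 1(4)[rule_format, OF conjI, OF 1(1) order_refl, of t] \<open>m = 0\<close> by simp
  qed
  ultimately have "((\<lambda>t. 0) has_integral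
      (\<Sum>l\<in>I. \<alpha> l * (if l - n = 0 then 2 * pi else 0))) {0..2 * pi}" by simp
  then have "(\<Sum>l\<in>I. \<alpha> l * (if l - n = 0 then 2 * pi else 0)) = 0"
    by (rule has_integral_unique) simp
  moreover have "(\<Sum>l\<in>I. \<alpha> l * (if l - n = 0 then 2 * pi else 0)) = \<alpha> n * (2 * pi)"
    using 1(1,2) by (simp add: if_distrib[of "\<lambda>x. _ * x"] if_distrib[of complex_of_real] sum.delta' cong: if_cong)
  ultimately show ?thesis using 1(3) by simp
qed

lemma trig_coeff_unique: "trig_coeff f n z \<Longrightarrow> trig_coeff f n w \<Longrightarrow> z = w"
  using trig_coeff_zero[of n "z - w"] trig_coeff_diff[of f n z f w] by simp

section \<open>Smoothness of trigonometric polynomials\<close>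

lemma Ck_on_cong:
  assumes "open U" "\<And>x. x \<in> U \<Longrightarrow> f x = g x" "Ck_on n U f"
  shows "Ck_on n U g"
proof (cases n)
  case 0
  then show ?thesis using assms by (simp cong: continuous_on_cong)
next
  case (Suc m)
  then show ?thesis using assms
    by (auto intro: has_derivative_transform_within_open)
qed

lemma Ck_on_subset: "Ck_on n V f \<Longrightarrow> U \<subseteq> V \<Longrightarrow> Ck_on n U f"
proof (induction n arbitrary: f)
  case (Suc n)
  then show ?case by (metis Ck_on.simps(2) subsetD)
qed (auto intro: continuous_on_subset)

lemma Ck_on_add: "Ck_on n U f \<Longrightarrow> Ck_on n U g \<Longrightarrow> Ck_on n U (\<lambda>x. f x + g x)"
proof (induction n arbitrary: f g)
  case (Suc n)
  obtain f' where "\<And>x. x \<in> U \<Longrightarrow> (f has_derivative f' x) (at x)" "\<And>v. Ck_on n U (\<lambda>x. f' x v)"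
    using Suc.prems(1) by auto
  moreover obtain g' where "\<And>x. x \<in> U \<Longrightarrow> (g has_derivative g' x) (at x)" "\<And>v. Ck_on n U (\<lambda>x. g' x v)"
    using Suc.prems(2) by auto
  ultimately show ?case using Suc.IH
    by (auto intro!: exI[of _ "\<lambda>x v. f' x v + g' x v"] has_derivative_add)
qed (auto intro: continuous_on_add)

lemma Ck_on_bounded_linear:
  assumes "bounded_linear h" "Ck_on n U f"
  shows "Ck_on n U (\<lambda>x. h (f x))"
  using assms(2)
proof (induction n arbitrary: f)
  case 0
  then show ?case using assms(1) by (auto intro: bounded_linear.continuous_on)
next
  case (Suc n)
  obtain f' where "\<And>x. x \<in> U \<Longrightarrow> (f has_derivative f' x) (at x)" "\<And>v. Ck_on n U (\<lambda>x. f' x v)"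
    using Suc.prems by auto
  then show ?case using Suc.IH
    by (auto intro!: exI[of _ "\<lambda>x v. h (f' x v)"] bounded_linear.has_derivative[OF assms(1)])
qed

lemma Ck_on_Pair:
  assumes "Ck_on n U f" "Ck_on n U g"
  shows "Ck_on n U (\<lambda>x. (f x, g x))"
proof -
  have "bounded_linear (\<lambda>x. (x, 0))" "bounded_linear (\<lambda>x. (0, x))"
    by (auto intro: bounded_linear_Pair bounded_linear_ident bounded_linear_zero)
  from Ck_on_add[OF Ck_on_bounded_linear[OF this(1) assms(1)] Ck_on_bounded_linear[OF this(2) assms(2)]]
  show ?thesis by simp
qed

lemma bounded_linear_axis: "bounded_linear (\<lambda>z :: complex. axis i z :: complex ^ 3)"
  by (rule linear_conv_bounded_linear[THEN iffD1], rule linearI) (auto simp: axis_def vec_eq_iff)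

lemma axis_decomposition:
  fixes v :: "complex ^ 3"
  shows "axis 1 (v $ 1) + axis 2 (v $ 2) + axis 3 (v $ 3) = v"
  by (simp add: vec_eq_iff forall_3 axis_def)

lemma Ck_on_vec3:
  fixes f :: "'a::euclidean_space \<Rightarrow> complex ^ 3"
  assumes "\<And>i. Ck_on n U (\<lambda>x. f x $ i)"
  shows "Ck_on n U f"
proof -
  have "Ck_on n U (\<lambda>x. axis 1 (f x $ 1) + axis 2 (f x $ 2) + axis 3 (f x $ 3) :: complex ^ 3)"
    by (intro Ck_on_add Ck_on_bounded_linear[OF bounded_linear_axis] assms)
  then show ?thesis by (simp only: axis_decomposition)
qed

text \<open>
  All functions of the construction are polynomials in coordinates \<open>\<xi>\<close>, in exponentials \<open>cis (r * \<xi>)\<close> and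
  in the conjugates of these. This class contains the directional derivatives of its members, so existence of
  first derivatives gives smoothness of all orders. The set \<open>X\<close> of coordinates is a parameter because
  the class is used both on Euclidean spaces and on the space of parameters, whose points are functions
  on the natural numbers.
\<close>

inductive trig_poly :: "('a \<Rightarrow> real) set \<Rightarrow> ('a \<Rightarrow> complex) \<Rightarrow> bool" for X where
  const: "trig_poly X (\<lambda>v. c)"
| coord: "\<xi> \<in> X \<Longrightarrow> trig_poly X (\<lambda>v. of_real (\<xi> v))"
| cis: "\<xi> \<in> X \<Longrightarrow> trig_poly X (\<lambda>v. cis (r * \<xi> v))"
| cnj: "trig_poly X f \<Longrightarrow> trig_poly X (\<lambda>v. cnj (f v))"
| add: "trig_poly X f \<Longrightarrow> trig_poly X g \<Longrightarrow> trig_poly X (\<lambda>v. f v + g v)"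
| mult: "trig_poly X f \<Longrightarrow> trig_poly X g \<Longrightarrow> trig_poly X (\<lambda>v. f v * g v)"

lemma trig_poly_uminus: "trig_poly X f \<Longrightarrow> trig_poly X (\<lambda>v. - f v)"
  using trig_poly.mult[OF trig_poly.const[of X "-1"], of f] by simp

lemma trig_poly_diff: "trig_poly X f \<Longrightarrow> trig_poly X g \<Longrightarrow> trig_poly X (\<lambda>v. f v - g v)"
  using trig_poly.add[of X f "\<lambda>v. - g v"] trig_poly_uminus[of X g] by simp

lemma trig_poly_power: "trig_poly X f \<Longrightarrow> trig_poly X (\<lambda>v. f v ^ n)"
  by (induction n) (auto intro: trig_poly.intros)

lemma trig_poly_sum: "(\<And>i. i \<in> I \<Longrightarrow> trig_poly X (f i)) \<Longrightarrow> trig_poly X (\<lambda>v. \<Sum>i\<in>I. f i v)"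
  by (induction I rule: infinite_finite_induct) (auto intro: trig_poly.intros)

lemma trig_poly_Re: "trig_poly X f \<Longrightarrow> trig_poly X (\<lambda>v. of_real (Re (f v)))"
proof -
  assume "trig_poly X f"
  then have "trig_poly X (\<lambda>v. 1/2 * (f v + cnj (f v)))" by (intro trig_poly.intros)
  then show ?thesis by (simp add: complex_add_cnj)
qed

lemma trig_poly_Im: "trig_poly X f \<Longrightarrow> trig_poly X (\<lambda>v. of_real (Im (f v)))"
proof -
  assume "trig_poly X f"
  then have "trig_poly X (\<lambda>v. of_real (Re ((- \<i>) * f v)))"
    by (intro trig_poly_Re trig_poly.mult trig_poly.const)
  then show ?thesis by simp
qed

lemma trig_poly_Complex:
  "trig_poly X (\<lambda>v. of_real (f v)) \<Longrightarrow> trig_poly X (\<lambda>v. of_real (g v)) \<Longrightarrow> trig_poly X (\<lambda>v. Complex (f v) (g v))"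
  unfolding Complex_eq by (intro trig_poly.add trig_poly.mult trig_poly.const)

lemma has_derivative_cis_comp:
  assumes "(\<xi> has_derivative \<xi>') (at x)"
  shows "((\<lambda>v. cis (r * \<xi> v)) has_derivative (\<lambda>v. \<i> * of_real r * of_real (\<xi>' v) * cis (r * \<xi> x))) (at x)"
proof -
  have "((\<lambda>u. cis (r * u)) has_derivative (\<lambda>h. h *\<^sub>R (\<i> * of_real r * cis (r * \<xi> x)))) (at (\<xi> x))"
    using has_vector_derivative_cis_scaled[of r "\<xi> x" UNIV] by (simp add: has_vector_derivative_def)
  from has_derivative_compose[OF assms this] show ?thesis
    by (simp add: scaleR_conv_of_real mult_ac)
qed

lemma trig_poly_has_derivative:
  assumes "trig_poly {L. bounded_linear L} f"
  shows "\<exists>f'. (\<forall>x. (f has_derivative f' x) (at x)) \<and> (\<forall>v. trig_poly {L. bounded_linear L} (\<lambda>x. f' x v))"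
  using assms
proof induction
  case (const c)
  then show ?case by (auto intro!: exI[of _ "\<lambda>x v. 0"] trig_poly.intros)
next
  case (coord \<xi>)
  then show ?case
    by (auto intro!: exI[of _ "\<lambda>x v. of_real (\<xi> v)"] trig_poly.intros
        bounded_linear_imp_has_derivative bounded_linear_compose[OF bounded_linear_of_real])
next
  case (cis \<xi> r)
  then show ?case
    by (auto intro!: exI[of _ "\<lambda>x v. \<i> * of_real r * of_real (\<xi> v) * cis (r * \<xi> x)"]
        trig_poly.intros has_derivative_cis_comp bounded_linear_imp_has_derivative)
next
  case (cnj f)
  then obtain f' where "\<And>x. (f has_derivative f' x) (at x)"
    "\<And>v. trig_poly {L. bounded_linear L} (\<lambda>x. f' x v)" by auto
  then show ?case
    by (auto intro!: exI[of _ "\<lambda>x v. cnj (f' x v)"] trig_poly.intros has_derivative_cnj)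
next
  case (add f g)
  then obtain f' g' where "\<And>x. (f has_derivative f' x) (at x)"
    "\<And>v. trig_poly {L. bounded_linear L} (\<lambda>x. f' x v)" "\<And>x. (g has_derivative g' x) (at x)"
    "\<And>v. trig_poly {L. bounded_linear L} (\<lambda>x. g' x v)" by auto
  then show ?case
    by (auto intro!: exI[of _ "\<lambda>x v. f' x v + g' x v"] trig_poly.intros has_derivative_add)
next
  case (mult f g)
  then obtain f' g' where "\<And>x. (f has_derivative f' x) (at x)"
    "\<And>v. trig_poly {L. bounded_linear L} (\<lambda>x. f' x v)" "\<And>x. (g has_derivative g' x) (at x)"
    "\<And>v. trig_poly {L. bounded_linear L} (\<lambda>x. g' x v)" by auto
  then show ?case using mult.hyps
    by (auto intro!: exI[of _ "\<lambda>x v. f x * g' x v + f' x v * g x"] trig_poly.intros has_derivative_mult)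
qed

lemma trig_poly_Ck_on: "trig_poly {L. bounded_linear L} f \<Longrightarrow> Ck_on n U f"
proof (induction n arbitrary: f)
  case 0
  then obtain f' where "\<And>x. (f has_derivative f' x) (at x)"
    using trig_poly_has_derivative by blast
  then show ?case
    by (auto intro!: continuous_at_imp_continuous_on has_derivative_continuous)
next
  case (Suc n)
  then show ?case using trig_poly_has_derivative[OF Suc.prems] by (auto intro: Suc.IH)
qed

definition coords :: "nat \<Rightarrow> ((nat \<Rightarrow> real) \<Rightarrow> real) set" where
  "coords d = {\<lambda>v. v i | i. i < d}"

lemma trig_poly_continuous_map:
  assumes "trig_poly (coords d) f"
  shows "continuous_map (Euclidean_space d) euclidean f"
proof -
  have co: "continuous_map (Euclidean_space d) euclidean \<xi>" if "\<xi> \<in> coords d" for \<xi> :: "_ \<Rightarrow> real"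
    using that unfolding coords_def Euclidean_space_def
    by (auto intro!: continuous_map_from_subtopology continuous_map_product_projection)
  show ?thesis using assms
  proof induction
    case (coord \<xi>)
    then have "continuous_map (Euclidean_space d) euclidean (complex_of_real \<circ> \<xi>)"
      by (intro continuous_map_compose[OF co]) (auto intro!: continuous_intros)
    then show ?case by (simp add: o_def)
  next
    case (cis \<xi> r)
    then have "continuous_map (Euclidean_space d) euclidean ((\<lambda>u. cis (r * u)) \<circ> \<xi>)"
      by (intro continuous_map_compose[OF co]) (auto intro!: continuous_intros)
    then show ?case by (simp add: o_def)
  next
    case (cnj f)
    then have "continuous_map (Euclidean_space d) euclidean (cnj \<circ> f)"
      by (intro continuous_map_compose[of _ euclidean]) (auto intro!: continuous_intros)
    then show ?case by (simp add: o_def)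
  next
    case (mult f g)
    have "continuous_map (Euclidean_space d) (prod_topology euclidean euclidean) (\<lambda>x. (f x, g x))"
      using mult.IH by (rule continuous_map_pairedI)
    moreover have "continuous_map (prod_topology euclidean euclidean) euclidean (\<lambda>(a, b). a * b :: complex)"
      by (auto simp: case_prod_unfold euclidean_product_topology[symmetric] intro!: continuous_intros)
    ultimately have "continuous_map (Euclidean_space d) euclidean ((\<lambda>(a, b). a * b) \<circ> (\<lambda>x. (f x, g x)))"
      by (rule continuous_map_compose)
    then show ?case by (simp add: o_def)
  qed (auto intro: continuous_map_add)
qed

lemma trig_poly_partial_derivative:
  assumes "trig_poly (coords d) f"
  shows "\<exists>g. (\<forall>v. ((\<lambda>s. f (v(i := s))) has_vector_derivative g v) (at (v i))) \<and> trig_poly (coords d) g"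
  using assms
proof induction
  case (const c)
  then show ?case by (auto intro!: exI[of _ "\<lambda>x. 0"] trig_poly.intros)
next
  case (coord \<xi>)
  then obtain j where \<xi>: "\<xi> = (\<lambda>v. v j)" by (auto simp: coords_def)
  show ?case
    by (cases "i = j"; intro exI[of _ "\<lambda>x. if i = j then 1 else 0"])
       (auto simp: \<xi> intro!: trig_poly.intros derivative_eq_intros)
next
  case (cis \<xi> r)
  then obtain j where \<xi>: "\<xi> = (\<lambda>v. v j)" by (auto simp: coords_def)
  show ?case
    using cis.hyps trig_poly.cis[of \<xi> "coords d" r]
    by (cases "i = j"; intro exI[of _ "\<lambda>x. if i = j then \<i> * of_real r * cis (r * \<xi> x) else 0"])
       (auto simp: \<xi> intro!: trig_poly.mult trig_poly.const has_vector_derivative_cis_scaled)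
next
  case (cnj f)
  then obtain f' where "\<And>v. ((\<lambda>s. f (v(i := s))) has_vector_derivative f' v) (at (v i))"
    "trig_poly (coords d) f'" by blast
  then show ?case
    by (intro exI[of _ "\<lambda>x. cnj (f' x)"] conjI allI trig_poly.intros has_vector_derivative_cnj)
next
  case (add f g)
  then obtain f' g' where "\<And>v. ((\<lambda>s. f (v(i := s))) has_vector_derivative f' v) (at (v i))"
    "trig_poly (coords d) f'" "\<And>v. ((\<lambda>s. g (v(i := s))) has_vector_derivative g' v) (at (v i))"
    "trig_poly (coords d) g'" by blast
  then show ?case
    by (intro exI[of _ "\<lambda>x. f' x + g' x"] conjI allI trig_poly.intros has_vector_derivative_add)
next
  case (mult f g)
  then obtain f' g' where *: "\<And>v. ((\<lambda>s. f (v(i := s))) has_vector_derivative f' v) (at (v i))"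
    "trig_poly (coords d) f'" "\<And>v. ((\<lambda>s. g (v(i := s))) has_vector_derivative g' v) (at (v i))"
    "trig_poly (coords d) g'" by blast
  have "((\<lambda>s. f (v(i := s)) * g (v(i := s))) has_vector_derivative f v * g' v + f' v * g v) (at (v i))" for v
    using has_vector_derivative_mult[OF *(1)[of v] *(3)[of v]] by simp
  then show ?case using mult.hyps *(2,4)
    by (intro exI[of _ "\<lambda>v. f v * g' v + f' v * g v"] conjI allI trig_poly.intros)
qed

lemma trig_poly_smooth_coords:
  assumes "trig_poly (coords d) f"
  shows "smooth_coords d U f"
proof -
  have "Ck_coords d U n f" for n
    using assms
  proof (induction n arbitrary: f)
    case 0
    then show ?case
      by (auto intro: continuous_map_from_subtopology trig_poly_continuous_map)
  next
    case (Suc n)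
    obtain g where "\<And>i v. ((\<lambda>s. f (v(i := s))) has_vector_derivative g i v) (at (v i))"
      "\<And>i. trig_poly (coords d) (g i)"
      using trig_poly_partial_derivative[OF Suc.prems] by metis
    then show ?case using Suc
      by (auto intro!: exI[of _ g] intro: continuous_map_from_subtopology trig_poly_continuous_map)
  qed
  then show ?thesis by (simp add: smooth_coords_def)
qed

section \<open>Solutions of the evolution equations\<close>

text \<open>
  One equation covers the three cases \<open>j = 0\<close>, \<open>0 < j < k\<close> and \<open>j = k\<close>, since \<open>p j\<close> vanishes for
  \<open>j > k\<close>.
\<close>

definition evolves :: "(nat \<Rightarrow> real \<Rightarrow> complex ^ 3) \<Rightarrow> bool" where
  "evolves p \<longleftrightarrow> (\<forall>j t.
     ((\<lambda>t. p j t $ 1) has_vector_derivative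
        of_nat (j + 1) * \<i> * cis t * cnj (p (j + 1) t $ 3) + of_nat j * cnj (p j t $ 2)) (at t) \<and>
     ((\<lambda>t. p j t $ 2) has_vector_derivative
        of_nat (j + 1) * cis (- t) * cnj (p (j + 1) t $ 3) - of_nat j * cnj (p j t $ 1)) (at t) \<and>
     ((\<lambda>t. p j t $ 3) has_vector_derivative
        - of_nat (j + 1) * (\<i> * cis t * cnj (p (j + 1) t $ 1) + cis (- t) * cnj (p (j + 1) t $ 2))) (at t))"

definition isotropic :: "nat \<Rightarrow> (nat \<Rightarrow> real \<Rightarrow> complex ^ 3) \<Rightarrow> bool" where
  "isotropic k p \<longleftrightarrow> (\<forall>t. Im (p k t $ 3) = 0) \<and>
     (\<forall>j\<in>{1..k}. \<forall>t. real j * Im (cis (- t) * p j t $ 1 - \<i> * cis t * p j t $ 2) +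
        (real j - 1) * Im (p (j - 1) t $ 3) = 0)"

definition normalised :: "nat \<Rightarrow> (nat \<Rightarrow> complex) \<Rightarrow> (nat \<Rightarrow> complex) \<Rightarrow> (nat \<Rightarrow> real \<Rightarrow> complex ^ 3) \<Rightarrow> bool" where
  "normalised k A B p \<longleftrightarrow>
     (\<forall>j\<in>{1..k}. trig_coeff (\<lambda>t. p j t $ 1) (int j) (A j) \<and>
        trig_coeff (\<lambda>t. p j t $ 1) (- int j) (B j) \<and> trig_coeff (\<lambda>t. p j t $ 3) 0 0) \<and>
     trig_coeff (\<lambda>t. p 0 t $ 1) 0 0 \<and> trig_coeff (\<lambda>t. p 0 t $ 2) 0 0 \<and> trig_coeff (\<lambda>t. p 0 t $ 3) 0 0"

lemma is_solution_iff:
  assumes "k \<ge> 1"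
  shows "is_solution k A B p \<longleftrightarrow>
    evolves p \<and> isotropic k p \<and> normalised k A B p \<and> (\<forall>j>k. p j = (\<lambda>t. 0))"
proof
  assume sol: "is_solution k A B p"
  then have 0: "p j = (\<lambda>t. 0)" if "j > k" for j
    using that unfolding is_solution_def Let_def by blast
  have "evolves p"
    unfolding evolves_def
  proof (intro allI)
    fix j t
    consider "j = 0" | "j \<in> {1..k - 1}" | "j = k" | "j > k" using assms by force
    then show "((\<lambda>t. p j t $ 1) has_vector_derivative
        of_nat (j + 1) * \<i> * cis t * cnj (p (j + 1) t $ 3) + of_nat j * cnj (p j t $ 2)) (at t) \<and>
     ((\<lambda>t. p j t $ 2) has_vector_derivative
        of_nat (j + 1) * cis (- t) * cnj (p (j + 1) t $ 3) - of_nat j * cnj (p j t $ 1)) (at t) \<and>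
     ((\<lambda>t. p j t $ 3) has_vector_derivative
        - of_nat (j + 1) * (\<i> * cis t * cnj (p (j + 1) t $ 1) + cis (- t) * cnj (p (j + 1) t $ 2))) (at t)"
    proof cases
      case 1
      then show ?thesis using sol unfolding is_solution_def Let_def by (simp add: algebra_simps)
    next
      case 2
      have "\<forall>j\<in>{1..k - 1}. \<forall>t.
        ((\<lambda>t. p j t $ 1) has_vector_derivative
          of_nat (j + 1) * \<i> * cis t * cnj (p (j + 1) t $ 3) + of_nat j * cnj (p j t $ 2)) (at t) \<and>
        ((\<lambda>t. p j t $ 2) has_vector_derivative
          of_nat (j + 1) * cis (- t) * cnj (p (j + 1) t $ 3) - of_nat j * cnj (p j t $ 1)) (at t) \<and>
        ((\<lambda>t. p j t $ 3) has_vector_derivative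
          - of_nat (j + 1) * (\<i> * cis t * cnj (p (j + 1) t $ 1) + cis (- t) * cnj (p (j + 1) t $ 2))) (at t)"
        using sol unfolding is_solution_def Let_def by (elim conjE)
      then show ?thesis using 2 by blast
    next
      case 3
      then show ?thesis using sol 0[of "k + 1"] unfolding is_solution_def Let_def by simp
    next
      case 4
      then show ?thesis using 0[of j] 0[of "j + 1"] by simp
    qed
  qed
  then show "evolves p \<and> isotropic k p \<and> normalised k A B p \<and> (\<forall>j>k. p j = (\<lambda>t. 0))"
    using sol unfolding is_solution_def Let_def isotropic_def normalised_def by blast
next
  assume r: "evolves p \<and> isotropic k p \<and> normalised k A B p \<and> (\<forall>j>k. p j = (\<lambda>t. 0))"
  then have 0: "p (k + 1) = (\<lambda>t. 0)" by simp
  have e: "((\<lambda>t. p j t $ 1) has_vector_derivative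
        of_nat (j + 1) * \<i> * cis t * cnj (p (j + 1) t $ 3) + of_nat j * cnj (p j t $ 2)) (at t)"
     "((\<lambda>t. p j t $ 2) has_vector_derivative
        of_nat (j + 1) * cis (- t) * cnj (p (j + 1) t $ 3) - of_nat j * cnj (p j t $ 1)) (at t)"
     "((\<lambda>t. p j t $ 3) has_vector_derivative
        - of_nat (j + 1) * (\<i> * cis t * cnj (p (j + 1) t $ 1) + cis (- t) * cnj (p (j + 1) t $ 2))) (at t)"
    for j t using r unfolding evolves_def by blast+
  show "is_solution k A B p"
    unfolding is_solution_def Let_def
    using r e e[of 0] e[of k] 0
    by (intro conjI) (simp_all add: isotropic_def normalised_def algebra_simps)
qed

lemma has_vector_derivative_vec3_diff:
  fixes p q :: "real \<Rightarrow> complex ^ 3"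
  shows "((\<lambda>t. p t $ i) has_vector_derivative x) F \<Longrightarrow> ((\<lambda>t. q t $ i) has_vector_derivative y) F
    \<Longrightarrow> ((\<lambda>t. (p t - q t) $ i) has_vector_derivative x - y) F"
  by (simp add: has_vector_derivative_diff)

lemma evolves_diff:
  assumes "evolves p" "evolves q"
  shows "evolves (\<lambda>j t. p j t - q j t)"
  unfolding evolves_def
proof (intro allI conjI)
  fix j t
  note P = assms(1)[unfolded evolves_def, rule_format, of j t]
  note Q = assms(2)[unfolded evolves_def, rule_format, of j t]
  show "((\<lambda>t. (p j t - q j t) $ 1) has_vector_derivative
      of_nat (j + 1) * \<i> * cis t * cnj ((p (j + 1) t - q (j + 1) t) $ 3) +
      of_nat j * cnj ((p j t - q j t) $ 2)) (at t)"
    by (rule has_vector_derivative_eq_rhs[OF has_vector_derivative_vec3_diff])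
      (use P Q in \<open>blast, blast, simp add: algebra_simps\<close>)
  show "((\<lambda>t. (p j t - q j t) $ 2) has_vector_derivative
      of_nat (j + 1) * cis (- t) * cnj ((p (j + 1) t - q (j + 1) t) $ 3) -
      of_nat j * cnj ((p j t - q j t) $ 1)) (at t)"
    by (rule has_vector_derivative_eq_rhs[OF has_vector_derivative_vec3_diff])
      (use P Q in \<open>blast, blast, simp add: algebra_simps\<close>)
  show "((\<lambda>t. (p j t - q j t) $ 3) has_vector_derivative
      - of_nat (j + 1) * (\<i> * cis t * cnj ((p (j + 1) t - q (j + 1) t) $ 1) +
        cis (- t) * cnj ((p (j + 1) t - q (j + 1) t) $ 2))) (at t)"
    by (rule has_vector_derivative_eq_rhs[OF has_vector_derivative_vec3_diff])
      (use P Q in \<open>blast, blast, simp add: algebra_simps\<close>)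
qed

lemma normalised_diff:
  assumes "normalised k A B p" "normalised k A B q"
  shows "normalised k (\<lambda>_. 0) (\<lambda>_. 0) (\<lambda>j t. p j t - q j t)"
proof -
  have d: "trig_coeff (\<lambda>t. (p j t - q j t) $ i) n 0"
    if "trig_coeff (\<lambda>t. p j t $ i) n z" "trig_coeff (\<lambda>t. q j t $ i) n z" for j i n z
    using trig_coeff_diff[OF that] by simp
  show ?thesis using assms unfolding normalised_def by (blast intro: d)
qed

lemma constant_of_derivative_zero:
  fixes f :: "real \<Rightarrow> complex"
  assumes "\<And>t. (f has_vector_derivative 0) (at t)"
  shows "f = (\<lambda>t. f 0)"
  using has_vector_derivative_zero_constant[of UNIV f] assms by (metis UNIV_I convex_UNIV)

lemma exponential_solution:
  fixes f :: "real \<Rightarrow> complex"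
  assumes "\<And>t. (f has_vector_derivative \<i> * of_real r * f t) (at t)"
  shows "f t = f 0 * cis (r * t)"
proof -
  have "((\<lambda>t. f t * cis (- r * t)) has_vector_derivative 0) (at t)" for t
    by (rule has_vector_derivative_eq_rhs[OF has_vector_derivative_mult[OF assms has_vector_derivative_cis_scaled]])
       simp
  from constant_of_derivative_zero[OF this] have "f t * cis (- r * t) = f 0"
    by (metis cis_zero mult.right_neutral mult_zero_right)
  then have "f t * (cis (- r * t) * cis (r * t)) = f 0 * cis (r * t)" by (metis mult.assoc)
  then show ?thesis by (simp add: cis_mult)
qed

text \<open>
  Descending induction on \<open>j\<close>: the equations for \<open>p j\<close> are forced by \<open>p (j + 1)\<close> only. Without forcing,
  \<open>c\<close> is constant, and \<open>a\<close> and \<open>b\<close> are combinations of the two exponentials of frequency \<open>j\<close> and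
  \<open>- j\<close>, or constants for \<open>j = 0\<close>: all of them are seen by the normalisation.
\<close>

lemma evolves_normalised_zero:
  assumes "evolves p" "normalised k (\<lambda>_. 0) (\<lambda>_. 0) p" "\<And>j. j > k \<Longrightarrow> p j = (\<lambda>t. 0)"
  shows "p j = (\<lambda>t. 0)"
proof (cases "j \<le> k")
  case True
  have "p (k + 1) = (\<lambda>t. 0)" using assms(3) by simp
  moreover have "p j = (\<lambda>t. 0)" if "p (Suc j) = (\<lambda>t. 0)" "j < k + 1" for j
  proof -
    note e = assms(1)[unfolded evolves_def, rule_format, of j] 
    have a': "((\<lambda>t. p j t $ 1) has_vector_derivative of_nat j * cnj (p j t $ 2)) (at t)"
      and b': "((\<lambda>t. p j t $ 2) has_vector_derivative - of_nat j * cnj (p j t $ 1)) (at t)"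
      and c': "((\<lambda>t. p j t $ 3) has_vector_derivative 0) (at t)" for t
      using e[of t] that by simp_all
    have n: "trig_coeff (\<lambda>t. p j t $ 3) 0 0"
      using assms(2) that(2) unfolding normalised_def
      by (cases "j = 0") auto
    have c: "p j t $ 3 = 0" for t
      using constant_of_derivative_zero[OF c'] n trig_coeff_unique[OF n, of "p j 0 $ 3"]
        trig_coeff_const[of "p j 0 $ 3"] by metis
    have "p j t $ 1 = 0 \<and> p j t $ 2 = 0" for t
    proof (cases "j = 0")
      case True
      have n: "trig_coeff (\<lambda>t. p j t $ 1) 0 0" "trig_coeff (\<lambda>t. p j t $ 2) 0 0"
        using assms(2) True unfolding normalised_def by auto
      have "(\<lambda>t. p j t $ 1) = (\<lambda>t. p j 0 $ 1)" "(\<lambda>t. p j t $ 2) = (\<lambda>t. p j 0 $ 2)"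
        using a' b' True by (auto intro!: constant_of_derivative_zero)
      with n trig_coeff_const trig_coeff_unique show ?thesis by metis
    next
      case False
      \<comment> \<open>These combinations diagonalise the unforced equations for \<open>a\<close> and the conjugate of \<open>b\<close>.\<close>
      define f where "f = (\<lambda>t. p j t $ 1 + \<i> * cnj (p j t $ 2))"
      define g where "g = (\<lambda>t. p j t $ 1 - \<i> * cnj (p j t $ 2))"
      have "(f has_vector_derivative \<i> * of_real (- real j) * f t) (at t)" for t
        unfolding f_def
        by (rule has_vector_derivative_eq_rhs[OF has_vector_derivative_add[OF a'
              has_vector_derivative_mult_right[OF has_vector_derivative_cnj[OF b']]]])
           (simp add: algebra_simps)
      from exponential_solution[OF this] have f: "f t = f 0 * cis (of_int (- int j) * t)" for t
        by (metis of_int_minus of_int_of_nat_eq)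
      have "(g has_vector_derivative \<i> * of_real (real j) * g t) (at t)" for t
        unfolding g_def
        by (rule has_vector_derivative_eq_rhs[OF has_vector_derivative_diff[OF a'
              has_vector_derivative_mult_right[OF has_vector_derivative_cnj[OF b']]]])
           (simp add: algebra_simps)
      from exponential_solution[OF this] have g: "g t = g 0 * cis (of_int (int j) * t)" for t
        by (metis of_int_of_nat_eq)
      have "p j t $ 1 = f t / 2 + g t / 2" for t by (simp add: f_def g_def field_simps)
      then have "(\<lambda>t. p j t $ 1) = (\<lambda>t. f 0 / 2 * cis (of_int (- int j) * t) + g 0 / 2 * cis (of_int (int j) * t))"
        by (subst (asm) f, subst (asm) g) (simp add: fun_eq_iff)
      then have "trig_coeff (\<lambda>t. p j t $ 1) n
          ((if - int j = n then f 0 / 2 else 0) + (if int j = n then g 0 / 2 else 0))" for n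
        by (simp only: trig_coeff_add[OF trig_coeff_cis trig_coeff_cis])
      from this[of "int j"] this[of "- int j"]
      have "trig_coeff (\<lambda>t. p j t $ 1) (int j) (g 0 / 2)" "trig_coeff (\<lambda>t. p j t $ 1) (- int j) (f 0 / 2)"
        using False by simp_all
      moreover have "trig_coeff (\<lambda>t. p j t $ 1) (int j) 0" "trig_coeff (\<lambda>t. p j t $ 1) (- int j) 0"
        using assms(2) that(2) False unfolding normalised_def by auto
      ultimately have "f 0 = 0" "g 0 = 0"
        by (auto dest: trig_coeff_unique)
      then have "f t = 0" "g t = 0" using f[of t] g[of t] by auto
      then show ?thesis by (simp add: f_def g_def)
    qed
    with c show ?thesis by (simp add: fun_eq_iff vec_eq_iff forall_3)
  qed
  ultimately show ?thesis using True
    by (intro inc_induct[of j "k + 1" "\<lambda>j. p j = (\<lambda>t. 0)"]) auto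
qed (use assms(3) in simp)

lemma is_solution_unique:
  assumes "k \<ge> 1" "is_solution k A B p" "is_solution k A B q"
  shows "p = q"
proof -
  note r = assms(2,3)[unfolded is_solution_iff[OF assms(1)]]
  have "(\<lambda>t. p j t - q j t) = (\<lambda>t. 0)" for j
    by (rule evolves_normalised_zero[of "\<lambda>j t. p j t - q j t" k])
       (use r in \<open>auto intro!: evolves_diff normalised_diff[of k A B]\<close>)
  then show ?thesis by (simp add: fun_eq_iff)
qed

section \<open>The explicit solution\<close>

text \<open>
  The weight of mode \<open>l\<close> in \<open>p j\<close>. A component of \<open>p j\<close> is an oscillator of frequency \<open>j + e\<close>, with
  \<open>e = - 1\<close> or \<open>e = 1\<close>, driven by \<open>p (j + 2)\<close> with frequency \<open>l + e\<close>: the denominator is the usual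
  difference of squared frequencies. With the value \<open>2\<close> on the diagonal, mode \<open>j\<close> contributes
  its amplitudes themselves to the Fourier coefficients of \<open>a j\<close>.
\<close>

function coef :: "real \<Rightarrow> nat \<Rightarrow> nat \<Rightarrow> real" where
  "coef e j l = (if l < j then 0 else if l = j then 2
     else 2 * (real j + 1) * (real j + 2) / ((real l + e)\<^sup>2 - (real j + e)\<^sup>2) * coef e (j + 2) l)"
  by pat_completeness auto
termination by (relation "Wellfounded.measure (\<lambda>(e, j, l). l - j)") auto

declare coef.simps [simp del]

lemma coef_less: "l < j \<Longrightarrow> coef e j l = 0"
  by (subst coef.simps) simp

lemma coef_diag: "coef e j j = 2"
  by (subst coef.simps) simp

text \<open>
  In the excluded case \<open>l + e = - (j + e)\<close> the driving frequency is resonant.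
\<close>

lemma coef_rec:
  assumes "real l + real j + 2 * e \<noteq> 0"
  shows "((real l + e)\<^sup>2 - (real j + e)\<^sup>2) * coef e j l = 2 * (real j + 1) * (real j + 2) * coef e (j + 2) l"
proof (cases "j < l")
  case True
  have "(real l + e)\<^sup>2 - (real j + e)\<^sup>2 = (real l - real j) * (real l + real j + 2 * e)"
    by (simp add: power2_eq_square algebra_simps)
  then have "(real l + e)\<^sup>2 - (real j + e)\<^sup>2 \<noteq> 0" using assms True by simp
  then show ?thesis using True by (subst coef.simps) simp
next
  case False
  then show ?thesis by (cases "l = j") (auto simp: coef_less coef_diag)
qed

lemma coef_parity: "odd (l - j) \<Longrightarrow> coef e j l = 0"
proof (induction e j l rule: coef.induct)
  case (1 e j l)
  show ?case
  proof (cases "j < l")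
    case True
    then have "odd (l - (j + 2)) \<or> l < j + 2" using 1(2) by presburger
    then have "coef e (j + 2) l = 0" using 1(1) True coef_less by auto
    then show ?thesis using True by (subst coef.simps) simp
  qed (use 1(2) in auto)
qed

text \<open>
  The angular frequency is \<open>l - 1\<close> for \<open>e = - 1\<close> and \<open>- (l + 1)\<close> for \<open>e = 1\<close>.
\<close>

definition wave :: "real \<Rightarrow> complex \<Rightarrow> nat \<Rightarrow> real \<Rightarrow> complex" where
  "wave e z l t = z * cis (- e * (real l + e) * t)"

text \<open>
  The contributions of a single pair of amplitudes to \<open>s = exp (- i t) a + i exp (i t) b\<close>,
  \<open>d = exp (- i t) a - i exp (i t) b\<close> and \<open>c\<close>. For \<open>l = 1\<close> the quotients by \<open>real l - 1\<close> are zero by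
  convention; this is harmless as the amplitude \<open>A\<close> is then zero.
\<close>

definition mode_s :: "complex \<Rightarrow> complex \<Rightarrow> nat \<Rightarrow> nat \<Rightarrow> real \<Rightarrow> complex" where
  "mode_s A B l j t = Complex (coef (- 1) j l * Re (wave (- 1) A l t)) (coef 1 j l * Im (wave 1 B l t))"

definition mode_d :: "complex \<Rightarrow> complex \<Rightarrow> nat \<Rightarrow> nat \<Rightarrow> real \<Rightarrow> complex" where
  "mode_d A B l j t = Complex
     (coef 1 j l * (real j + 1) / (real l + 1) * Re (wave 1 B l t))
     (coef (- 1) j l * (real j - 1) / (real l - 1) * Im (wave (- 1) A l t))"

definition mode_c :: "complex \<Rightarrow> complex \<Rightarrow> nat \<Rightarrow> nat \<Rightarrow> real \<Rightarrow> complex" where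
  "mode_c A B l j t = Complex
     (- (real j + 1) * coef 1 (j + 1) l / (real l + 1) * Re (wave 1 B l t))
     (- (real j + 1) * coef (- 1) (j + 1) l / (real l - 1) * Im (wave (- 1) A l t))"

definition mode :: "complex \<Rightarrow> complex \<Rightarrow> nat \<Rightarrow> nat \<Rightarrow> real \<Rightarrow> complex ^ 3" where
  "mode A B l j t = vector
     [cis t * (mode_s A B l j t + mode_d A B l j t) / 2,
      - \<i> * cis (- t) * (mode_s A B l j t - mode_d A B l j t) / 2,
      mode_c A B l j t]"

lemma wave_derivative:
  "((\<lambda>t. Re (wave e z l t)) has_vector_derivative e * (real l + e) * Im (wave e z l t)) (at t)"
  "((\<lambda>t. Im (wave e z l t)) has_vector_derivative - e * (real l + e) * Re (wave e z l t)) (at t)"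
proof -
  have "(wave e z l has_vector_derivative z * (\<i> * of_real (- e * (real l + e)) * cis (- e * (real l + e) * t))) (at t)"
    unfolding wave_def by (intro has_vector_derivative_mult_right has_vector_derivative_cis_scaled)
  then have w: "(wave e z l has_vector_derivative \<i> * of_real (- e * (real l + e)) * wave e z l t) (at t)"
    by (simp add: wave_def mult_ac)
  show "((\<lambda>t. Re (wave e z l t)) has_vector_derivative e * (real l + e) * Im (wave e z l t)) (at t)"
    by (rule has_vector_derivative_eq_rhs[OF bounded_linear.has_vector_derivative[OF bounded_linear_Re w]]) simp
  show "((\<lambda>t. Im (wave e z l t)) has_vector_derivative - e * (real l + e) * Re (wave e z l t)) (at t)"
    by (rule has_vector_derivative_eq_rhs[OF bounded_linear.has_vector_derivative[OF bounded_linear_Im w]]) simp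
qed

lemma has_vector_derivative_Complex:
  assumes "(f has_vector_derivative f') F" "(g has_vector_derivative g') F"
  shows "((\<lambda>t. Complex (f t) (g t)) has_vector_derivative Complex f' g') F"
proof -
  have "((\<lambda>t. of_real (f t) + \<i> * of_real (g t)) has_vector_derivative of_real f' + \<i> * of_real g') F"
    by (intro has_vector_derivative_add has_vector_derivative_mult_right has_vector_derivative_of_real
        assms[folded has_real_derivative_iff_has_vector_derivative])
  then show ?thesis by (simp add: Complex_eq)
qed

text \<open>
  The recursion for \<open>coef\<close>, brought into the form in which it enters the equation for \<open>s\<close>:
  \<open>D\<close> is the frequency of the mode, \<open>J\<close> that of the oscillator, and \<open>P\<close> a value of the wave.
\<close>

lemma frequency_relation:
  fixes D J P a b m n :: real
  assumes "D \<noteq> 0 \<or> P = 0" and "(D\<^sup>2 - J\<^sup>2) * a * P = 2 * m * n * b * P"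
  shows "- (J * (a * J / D * P)) + 2 * m * (- n * b / D * P) = a * (- 1 * D * P)"
proof (cases "P = 0")
  case False
  have "(D\<^sup>2 * a - (J\<^sup>2 * a + 2 * m * n * b)) * P = 0" using assms(2) by (simp add: algebra_simps)
  with False assms(1) have "D \<noteq> 0" and "D\<^sup>2 * a = J\<^sup>2 * a + 2 * m * n * b" by auto
  then have "D * a = (J\<^sup>2 * a + 2 * m * n * b) / D" by (simp add: field_simps power2_eq_square)
  then have "a * (- 1 * D * P) = - ((J\<^sup>2 * a + 2 * m * n * b) / D) * P"
    by (simp only: mult_minus_left mult_1 mult_minus_right flip: mult.assoc) (simp add: mult_ac)
  also have "\<dots> = - (J * (a * J / D * P)) + 2 * m * (- n * b / D * P)"
    by (simp add: add_divide_distrib diff_divide_distrib algebra_simps power2_eq_square)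
  finally show ?thesis ..
qed simp

text \<open>
  Each mode solves the equations for \<open>s\<close>, \<open>d\<close> and \<open>c\<close>. The hypothesis on \<open>A\<close> excludes the zero frequency
  \<open>l = 1\<close> and the resonance of the mode \<open>l = 2\<close> with the oscillator of frequency \<open>- 1\<close> at \<open>j = 0\<close>, which are
  the sources of terms linear in \<open>t\<close>.
\<close>

lemma mode_derivative:
  assumes "l \<ge> 1" and A: "l \<le> 2 \<Longrightarrow> A = 0"
  shows "(mode_s A B l j has_vector_derivative - \<i> * mode_d A B l j t - \<i> * of_nat j * cnj (mode_d A B l j t)
          + 2 * \<i> * of_nat (j + 1) * cnj (mode_c A B l (j + 1) t)) (at t)"
    and "(mode_d A B l j has_vector_derivative
          - \<i> * mode_s A B l j t + \<i> * of_nat j * cnj (mode_s A B l j t)) (at t)"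
    and "(mode_c A B l j has_vector_derivative
          - \<i> * of_nat (j + 1) * cnj (mode_s A B l (j + 1) t)) (at t)"
proof -
  define P Q where "P = wave (- 1) A l t" and "Q = wave 1 B l t"
  have P0: "P = 0 \<or> real l - 1 \<noteq> 0 \<and> real l + real j - 2 \<noteq> 0"
    using A by (cases "l \<le> 2") (auto simp: P_def wave_def)
  have l1: "real l + 1 \<noteq> 0" by linarith
  have s: "(mode_s A B l j has_vector_derivative Complex
      (coef (- 1) j l * (- 1 * (real l + - 1) * Im P)) (coef 1 j l * (- 1 * (real l + 1) * Re Q))) (at t)"
    unfolding mode_s_def P_def Q_def
    by (intro has_vector_derivative_Complex has_vector_derivative_mult_right wave_derivative)
  have d: "(mode_d A B l j has_vector_derivative Complex
      (coef 1 j l * (real j + 1) / (real l + 1) * (1 * (real l + 1) * Im Q))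
      (coef (- 1) j l * (real j - 1) / (real l - 1) * (- (- 1) * (real l + - 1) * Re P))) (at t)"
    unfolding mode_d_def P_def Q_def
    by (intro has_vector_derivative_Complex has_vector_derivative_mult_right wave_derivative)
  have c: "(mode_c A B l j has_vector_derivative Complex
      (- (real j + 1) * coef 1 (j + 1) l / (real l + 1) * (1 * (real l + 1) * Im Q))
      (- (real j + 1) * coef (- 1) (j + 1) l / (real l - 1) * (- (- 1) * (real l + - 1) * Re P))) (at t)"
    unfolding mode_c_def P_def Q_def
    by (intro has_vector_derivative_Complex has_vector_derivative_mult_right wave_derivative)
  have recB: "((real l + 1)\<^sup>2 - (real j + 1)\<^sup>2) * coef 1 j l = 2 * (real j + 1) * (real j + 2) * coef 1 (j + 2) l"
    by (rule coef_rec) (use assms in simp)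
  have recA: "((real l - 1)\<^sup>2 - (real j - 1)\<^sup>2) * coef (- 1) j l * Im P =
      2 * (real j + 1) * (real j + 2) * coef (- 1) (j + 2) l * Im P"
    using P0 coef_rec[of l j "-1"] by auto
  have 1: "coef (- 1) j l * (- 1 * (real l + - 1) * Im P) =
    - ((real j - 1) * (coef (- 1) j l * (real j - 1) / (real l - 1) * Im P)) +
    2 * (real j + 1) * (- (real j + 2) * coef (- 1) (j + 2) l / (real l - 1) * Im P)"
    using P0 recA by (subst frequency_relation[of "real l - 1" "Im P" "real j - 1"]) auto
  have 2: "coef 1 j l * (- 1 * (real l + 1) * Re Q) =
    - ((real j + 1) * (coef 1 j l * (real j + 1) / (real l + 1) * Re Q)) +
    2 * (real j + 1) * (- (real j + 2) * coef 1 (j + 2) l / (real l + 1) * Re Q)"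
    using l1 recB by (subst frequency_relation[of "real l + 1" "Re Q" "real j + 1"]) auto
  show "(mode_s A B l j has_vector_derivative - \<i> * mode_d A B l j t - \<i> * of_nat j * cnj (mode_d A B l j t)
          + 2 * \<i> * of_nat (j + 1) * cnj (mode_c A B l (j + 1) t)) (at t)"
    by (rule has_vector_derivative_eq_rhs[OF s])
       (unfold 1 2, simp add: complex_eq_iff mode_d_def mode_c_def flip: P_def Q_def, simp add: algebra_simps add_divide_distrib diff_divide_distrib)
  have cancel: "x / (real l + 1) * (1 * (real l + 1) * y) = x * y" for x y using l1 by simp
  have cancel': "x / (real l - 1) * (- (- 1) * (real l + - 1) * Re P) = x * Re P" for x
    using P0 by auto
  show "(mode_d A B l j has_vector_derivative
          - \<i> * mode_s A B l j t + \<i> * of_nat j * cnj (mode_s A B l j t)) (at t)"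
    by (rule has_vector_derivative_eq_rhs[OF d], unfold cancel cancel')
       (simp add: complex_eq_iff mode_s_def algebra_simps flip: P_def Q_def)
  show "(mode_c A B l j has_vector_derivative
          - \<i> * of_nat (j + 1) * cnj (mode_s A B l (j + 1) t)) (at t)"
    by (rule has_vector_derivative_eq_rhs[OF c], unfold cancel cancel')
       (simp add: complex_eq_iff mode_s_def algebra_simps flip: P_def Q_def)
qed

lemma cis_cancel: "cis t * (cis (- t) * z) = z" "cis (- t) * (cis t * z) = z"
  by (simp_all add: cis_mult flip: mult.assoc)

lemma mode_evolves:
  assumes "l \<ge> 1" and "l \<le> 2 \<Longrightarrow> A = 0"
  shows "evolves (mode A B l)"
  unfolding evolves_def
proof (intro allI conjI)
  fix j t
  note m = mode_derivative[OF assms, of B j t]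
  have e: "(cis has_vector_derivative \<i> * cis t) (at t)"
    using has_vector_derivative_cis_scaled[of 1 t UNIV] by simp
  have e': "((\<lambda>t. cis (- t)) has_vector_derivative - \<i> * cis (- t)) (at t)"
    using has_vector_derivative_cis_scaled[of "-1" t UNIV] by simp
  show "((\<lambda>t. mode A B l j t $ 1) has_vector_derivative
        of_nat (j + 1) * \<i> * cis t * cnj (mode A B l (j + 1) t $ 3) + of_nat j * cnj (mode A B l j t $ 2)) (at t)"
    unfolding mode_def vector_3
    by (rule has_vector_derivative_eq_rhs[OF has_vector_derivative_divide[OF
          has_vector_derivative_mult[OF e has_vector_derivative_add[OF m(1,2)]]]])
       (simp_all add: cis_cnj, simp_all add: field_simps)
  show "((\<lambda>t. mode A B l j t $ 2) has_vector_derivative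
        of_nat (j + 1) * cis (- t) * cnj (mode A B l (j + 1) t $ 3) - of_nat j * cnj (mode A B l j t $ 1)) (at t)"
    unfolding mode_def vector_3
    by (rule has_vector_derivative_eq_rhs[OF has_vector_derivative_divide[OF
          has_vector_derivative_mult[OF
            has_vector_derivative_mult_right[OF e'] has_vector_derivative_diff[OF m(1,2)]]]])
       (simp_all add: cis_cnj, simp_all add: field_simps)
  show "((\<lambda>t. mode A B l j t $ 3) has_vector_derivative
        - of_nat (j + 1) * (\<i> * cis t * cnj (mode A B l (j + 1) t $ 1) + cis (- t) * cnj (mode A B l (j + 1) t $ 2))) (at t)"
    unfolding mode_def vector_3
    by (rule has_vector_derivative_eq_rhs[OF m(3)])
       (simp_all add: cis_cnj, simp_all add: field_simps cis_cancel)
qed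

lemma mode_isotropic:
  "real j * Im (cis (- t) * mode A B l j t $ 1 - \<i> * cis t * mode A B l j t $ 2) +
     (real j - 1) * Im (mode A B l (j - 1) t $ 3) = 0" if "j \<ge> 1"
proof -
  have "cis (- t) * mode A B l j t $ 1 - \<i> * cis t * mode A B l j t $ 2 = mode_d A B l j t"
    by (simp add: mode_def field_simps cis_cancel)
  moreover have "real (j - Suc 0) = real j - 1" using that by simp
  ultimately show ?thesis using that
    by (simp add: mode_def mode_d_def mode_c_def algebra_simps)
qed

lemma mode_eq_0: "l < j \<Longrightarrow> mode A B l j t = 0"
  by (simp add: mode_def mode_s_def mode_d_def mode_c_def coef_less Complex_eq_0 vec_eq_iff forall_3)

lemma mode_3_eq_0: "l \<le> j \<Longrightarrow> mode A B l j t $ 3 = 0"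
  by (simp add: mode_def mode_c_def coef_less Complex_eq_0)

lemma trig_coeff_cis4:
  "trig_coeff (\<lambda>t. z1 * cis (of_int m1 * t) + z2 * cis (of_int m2 * t) + z3 * cis (of_int m3 * t) + z4 * cis (of_int m4 * t)) n
     ((if m1 = n then z1 else 0) + (if m2 = n then z2 else 0) + (if m3 = n then z3 else 0) + (if m4 = n then z4 else 0))"
  by (intro trig_coeff_add trig_coeff_cis)

lemma mode_expand:
  fixes A B :: complex and j l :: nat
  defines "\<alpha> \<equiv> coef (- 1) j l" and "\<beta> \<equiv> coef 1 j l"
    and "u \<equiv> (real j - 1) / (real l - 1)" and "w \<equiv> (real j + 1) / (real l + 1)"
    and "g \<equiv> - (real j + 1) * coef 1 (j + 1) l / (real l + 1)"
    and "h \<equiv> - (real j + 1) * coef (- 1) (j + 1) l / (real l - 1)"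
  shows "mode A B l j t $ 1 =
      of_real (\<alpha> * (1 + u) / 4) * A * cis (of_int (int l) * t) +
      of_real (\<alpha> * (1 - u) / 4) * cnj A * cis (of_int (2 - int l) * t) +
      of_real (\<beta> * (w + 1) / 4) * B * cis (of_int (- int l) * t) +
      of_real (\<beta> * (w - 1) / 4) * cnj B * cis (of_int (int l + 2) * t)"
    and "mode A B l j t $ 2 =
      - \<i> * of_real (\<alpha> * (1 - u) / 4) * A * cis (of_int (int l - 2) * t) +
      - \<i> * of_real (\<alpha> * (1 + u) / 4) * cnj A * cis (of_int (- int l) * t) +
      - \<i> * of_real (\<beta> * (1 - w) / 4) * B * cis (of_int (- int l - 2) * t) +
      \<i> * of_real (\<beta> * (1 + w) / 4) * cnj B * cis (of_int (int l) * t)"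
    and "mode A B l j t $ 3 =
      of_real (h / 2) * A * cis (of_int (int l - 1) * t) + of_real (- h / 2) * cnj A * cis (of_int (1 - int l) * t) +
      of_real (g / 2) * B * cis (of_int (- int l - 1) * t) + of_real (g / 2) * cnj B * cis (of_int (int l + 1) * t)"
proof -
  define p q where "p = cis ((real l - 1) * t)" and "q = cis (- (real l + 1) * t)"
  have Re: "complex_of_real (Re z) = (z + cnj z) / 2" for z by (simp add: complex_add_cnj)
  have Im: "\<i> * complex_of_real (Im z) = (z - cnj z) / 2" for z by (simp add: complex_diff_cnj)
  have w: "wave (- 1) A l t = A * p" "wave 1 B l t = B * q"
    by (simp_all add: wave_def p_def q_def)
  have S: "mode_s A B l j t = of_real \<alpha> * ((A * p + cnj (A * p)) / 2) + of_real \<beta> * ((B * q - cnj (B * q)) / 2)"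
    unfolding mode_s_def Complex_eq Re[symmetric] Im[symmetric] w \<alpha>_def \<beta>_def by (simp add: mult_ac)
  have D: "mode_d A B l j t = of_real (\<beta> * w) * ((B * q + cnj (B * q)) / 2) + of_real (\<alpha> * u) * ((A * p - cnj (A * p)) / 2)"
    unfolding mode_d_def Complex_eq Re[symmetric] Im[symmetric] w \<alpha>_def \<beta>_def u_def w_def by (simp add: mult_ac)
  have C: "mode_c A B l j t = of_real g * ((B * q + cnj (B * q)) / 2) + of_real h * ((A * p - cnj (A * p)) / 2)"
    unfolding mode_c_def Complex_eq Re[symmetric] Im[symmetric] w g_def h_def by (simp add: mult_ac)
  have 1: "cis (of_int (int l) * t) = cis t * p" "cis (of_int (2 - int l) * t) = cis t * cnj p"
    "cis (of_int (- int l) * t) = cis t * q" "cis (of_int (int l + 2) * t) = cis t * cnj q"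
    unfolding p_def q_def cis_cnj cis_mult by (rule arg_cong[of _ _ cis], simp add: algebra_simps)+
  have 2: "cis (of_int (int l - 2) * t) = cis (- t) * p" "cis (of_int (- int l) * t) = cis (- t) * cnj p"
    "cis (of_int (- int l - 2) * t) = cis (- t) * q" "cis (of_int (int l) * t) = cis (- t) * cnj q"
    unfolding p_def q_def cis_cnj cis_mult by (rule arg_cong[of _ _ cis], simp add: algebra_simps)+
  have 3: "cis (of_int (int l - 1) * t) = p" "cis (of_int (1 - int l) * t) = cnj p"
    "cis (of_int (- int l - 1) * t) = q" "cis (of_int (int l + 1) * t) = cnj q"
    unfolding p_def q_def cis_cnj cis_mult by (rule arg_cong[of _ _ cis], simp add: algebra_simps)+
  show "mode A B l j t $ 1 =
      of_real (\<alpha> * (1 + u) / 4) * A * cis (of_int (int l) * t) +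
      of_real (\<alpha> * (1 - u) / 4) * cnj A * cis (of_int (2 - int l) * t) +
      of_real (\<beta> * (w + 1) / 4) * B * cis (of_int (- int l) * t) +
      of_real (\<beta> * (w - 1) / 4) * cnj B * cis (of_int (int l + 2) * t)"
    unfolding 1 mode_def vector_3 S D by (simp add: field_simps)
  show "mode A B l j t $ 2 =
      - \<i> * of_real (\<alpha> * (1 - u) / 4) * A * cis (of_int (int l - 2) * t) +
      - \<i> * of_real (\<alpha> * (1 + u) / 4) * cnj A * cis (of_int (- int l) * t) +
      - \<i> * of_real (\<beta> * (1 - w) / 4) * B * cis (of_int (- int l - 2) * t) +
      \<i> * of_real (\<beta> * (1 + w) / 4) * cnj B * cis (of_int (int l) * t)"
    unfolding 2 mode_def vector_3 S D by (simp add: field_simps)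
  show "mode A B l j t $ 3 =
      of_real (h / 2) * A * cis (of_int (int l - 1) * t) + of_real (- h / 2) * cnj A * cis (of_int (1 - int l) * t) +
      of_real (g / 2) * B * cis (of_int (- int l - 1) * t) + of_real (g / 2) * cnj B * cis (of_int (int l + 1) * t)"
    unfolding 3 mode_def vector_3 C by (simp add: field_simps)
qed

text \<open>
  A mode \<open>l\<close> has frequencies \<open>l\<close>, \<open>2 - l\<close>, \<open>- l\<close> and \<open>l + 2\<close> in \<open>a\<close>. For \<open>l > j\<close> only \<open>2 - l\<close> can hit
  \<open>- j\<close>, namely for \<open>l = j + 2\<close>. This is why the Fourier coefficient \<open>B j\<close> differs from the amplitude of the
  mode by a multiple of \<open>cnj (A (j + 2))\<close>.
\<close>

lemma mode_coefficients:
  assumes "l \<ge> 1" and A: "l \<le> 2 \<Longrightarrow> A = 0"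
  shows "j \<ge> 1 \<Longrightarrow> trig_coeff (\<lambda>t. mode A B l j t $ 1) (int j) (if l = j then A else 0)"
    and "j \<ge> 1 \<Longrightarrow> trig_coeff (\<lambda>t. mode A B l j t $ 1) (- int j)
           ((if l = j then B else 0) + (if l = j + 2 then of_real ((real j + 2) / (2 * real j)) * cnj A else 0))"
    and "trig_coeff (\<lambda>t. mode A B l j t $ 3) 0 0"
    and "trig_coeff (\<lambda>t. mode A B l 0 t $ 1) 0 0"
    and "trig_coeff (\<lambda>t. mode A B l 0 t $ 2) 0 0"
proof -
  have subst: "trig_coeff f n z \<Longrightarrow> z = w \<Longrightarrow> trig_coeff f n w" for f n z w by simp
  show "trig_coeff (\<lambda>t. mode A B l j t $ 1) (int j) (if l = j then A else 0)" if "j \<ge> 1"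
    unfolding mode_expand
    by (rule subst[OF trig_coeff_cis4]) (use that A in \<open>auto simp: coef_diag coef_less\<close>)
  show "trig_coeff (\<lambda>t. mode A B l j t $ 1) (- int j)
           ((if l = j then B else 0) + (if l = j + 2 then of_real ((real j + 2) / (2 * real j)) * cnj A else 0))"
    if "j \<ge> 1"
  proof -
    have val: "(if int l = - int j then z1 else 0) + (if 2 - int l = - int j then z2 else 0) +
        (if - int l = - int j then z3 else 0) + (if int l + 2 = - int j then z4 else 0) =
        (if l = j then z3 else 0) + (if l = j + 2 then z2 else 0)" for z1 z2 z3 z4 :: complex
      using that by auto
    have "((real (j + 2) - 1)\<^sup>2 - (real j - 1)\<^sup>2) * coef (- 1) j (j + 2) = 4 * (real j + 1) * (real j + 2)"
      using coef_rec[of "j + 2" j "-1"] coef_diag[of "-1" "j + 2"] that by simp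
    then have "real j * coef (- 1) j (j + 2) = (real j + 1) * (real j + 2)"
      by (simp add: algebra_simps power2_eq_square)
    then have "coef (- 1) j (j + 2) = (real j + 1) * (real j + 2) / real j"
      using that by (simp add: field_simps)
    moreover have "1 - (real j - 1) / (real (j + 2) - 1) = 2 / (real j + 1)"
      using that by (simp add: field_simps)
    ultimately have d: "coef (- 1) j (j + 2) * (1 - (real j - 1) / (real (j + 2) - 1)) / 4 = (real j + 2) / (2 * real j)"
      using that by (simp add: divide_simps)
    define Z1 Z2 Z3 Z4 where
      "Z1 = of_real (coef (- 1) j l * (1 + (real j - 1) / (real l - 1)) / 4) * A" and
      "Z2 = of_real (coef (- 1) j l * (1 - (real j - 1) / (real l - 1)) / 4) * cnj A" and
      "Z3 = of_real (coef 1 j l * ((real j + 1) / (real l + 1) + 1) / 4) * B" and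
      "Z4 = of_real (coef 1 j l * ((real j + 1) / (real l + 1) - 1) / 4) * cnj B"
    have "trig_coeff (\<lambda>t. mode A B l j t $ 1) (- int j)
        ((if l = j then Z3 else 0) + (if l = j + 2 then Z2 else 0))"
      unfolding mode_expand val[of Z1 Z2 Z3 Z4, symmetric]
      unfolding Z1_def[symmetric] Z2_def[symmetric] Z3_def[symmetric] Z4_def[symmetric]
      by (rule trig_coeff_cis4)
    moreover have "Z3 = B" if l: "l = j"
    proof -
      have "(real j + 1) / (real j + 1) = 1" using divide_self[of "real j + 1"] by linarith
      then show ?thesis unfolding Z3_def l coef_diag by simp
    qed
    moreover have "Z2 = of_real ((real j + 2) / (2 * real j)) * cnj A" if l: "l = j + 2"
      unfolding Z2_def l d ..
    ultimately show ?thesis by (cases "l = j"; cases "l = j + 2") simp_all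
  qed
  show "trig_coeff (\<lambda>t. mode A B l j t $ 3) 0 0"
    unfolding mode_expand
    by (rule subst[OF trig_coeff_cis4]) (use assms(1) A in auto)
  show "trig_coeff (\<lambda>t. mode A B l 0 t $ 1) 0 0"
    unfolding mode_expand
    by (rule subst[OF trig_coeff_cis4]) (use assms(1) A in auto)
  show "trig_coeff (\<lambda>t. mode A B l 0 t $ 2) 0 0"
    unfolding mode_expand
    by (rule subst[OF trig_coeff_cis4]) (use assms(1) A in auto)
qed

text \<open>
  The amplitude of the mode of frequency \<open>l + 1\<close>: the Fourier coefficient \<open>B l\<close> without the part caused by
  the mode \<open>l + 2\<close>.
\<close>

definition reduced :: "(nat \<Rightarrow> complex) \<Rightarrow> (nat \<Rightarrow> complex) \<Rightarrow> nat \<Rightarrow> complex" where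
  "reduced A B l = B l - of_real ((real l + 2) / (2 * real l)) * cnj (A (l + 2))"

definition solution :: "nat \<Rightarrow> (nat \<Rightarrow> complex) \<Rightarrow> (nat \<Rightarrow> complex) \<Rightarrow> nat \<Rightarrow> real \<Rightarrow> complex ^ 3" where
  "solution k A B j t = (\<Sum>l = 1..k. mode (A l) (reduced A B l) l j t)"

lemma evolves_sum:
  assumes "\<And>l. l \<in> L \<Longrightarrow> evolves (p l)"
  shows "evolves (\<lambda>j t. \<Sum>l\<in>L. p l j t)"
  using assms
proof (induction L rule: infinite_finite_induct)
  case (insert l L)
  have "evolves (\<lambda>j t. 0 - (\<Sum>l\<in>L. p l j t))"
    by (rule evolves_diff) (use insert in \<open>auto simp: evolves_def\<close>)
  from evolves_diff[OF insert.prems[of l] this] show ?case using insert.hyps by simp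
qed (auto simp: evolves_def)

lemma parameters_cases:
  assumes "(A, B) \<in> parameters k"
  shows "l \<le> 2 \<Longrightarrow> A l = 0" "l > k \<Longrightarrow> A l = 0" "l = 0 \<or> l > k \<Longrightarrow> B l = 0"
  using assms unfolding parameters_def by auto

lemma solution_is_solution:
  assumes "k \<ge> 1" and par: "(A, B) \<in> parameters k"
  shows "is_solution k A B (solution k A B)"
proof -
  have "evolves (solution k A B)"
    unfolding solution_def by (intro evolves_sum mode_evolves) (use parameters_cases[OF par] in auto)
  moreover have "isotropic k (solution k A B)"
    unfolding isotropic_def
  proof (intro conjI ballI allI)
    show "Im (solution k A B k t $ 3) = 0" for t
      by (simp add: solution_def mode_3_eq_0)
    fix j t assume j: "j \<in> {1..k}"
    have lin: "real j * Im (x * (\<Sum>l\<in>L. f l) - y * (\<Sum>l\<in>L. g l)) + (real j - 1) * Im (\<Sum>l\<in>L. h l) =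
        (\<Sum>l\<in>L. real j * Im (x * f l - y * g l) + (real j - 1) * Im (h l))" for x y f g h and L :: "nat set"
      by (induction L rule: infinite_finite_induct) (simp_all add: algebra_simps)
    have "real j * Im (cis (- t) * solution k A B j t $ 1 - \<i> * cis t * solution k A B j t $ 2) +
        (real j - 1) * Im (solution k A B (j - 1) t $ 3) =
      (\<Sum>l = 1..k. real j * Im (cis (- t) * mode (A l) (reduced A B l) l j t $ 1
          - \<i> * cis t * mode (A l) (reduced A B l) l j t $ 2) +
        (real j - 1) * Im (mode (A l) (reduced A B l) l (j - 1) t $ 3))"
      unfolding solution_def sum_component by (rule lin)
    also have "\<dots> = 0"
      using j by (intro sum.neutral ballI mode_isotropic) simp
    finally show "real j * Im (cis (- t) * solution k A B j t $ 1 - \<i> * cis t * solution k A B j t $ 2) +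
        (real j - 1) * Im (solution k A B (j - 1) t $ 3) = 0" .
  qed
  moreover have "normalised k A B (solution k A B)"
  proof -
    have "trig_coeff (\<lambda>t. solution k A B j t $ 1) (int j) (A j)" if "j \<in> {1..k}" for j
    proof -
      have "trig_coeff (\<lambda>t. \<Sum>l = 1..k. mode (A l) (reduced A B l) l j t $ 1) (int j)
          (\<Sum>l = 1..k. if l = j then A l else 0)"
        by (intro trig_coeff_sum mode_coefficients(1)) (use that parameters_cases[OF par] in auto)
      then show ?thesis using that by (simp add: solution_def)
    qed
    moreover have "trig_coeff (\<lambda>t. solution k A B j t $ 1) (- int j) (B j)" if "j \<in> {1..k}" for j
    proof -
      have "trig_coeff (\<lambda>t. \<Sum>l = 1..k. mode (A l) (reduced A B l) l j t $ 1) (- int j)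
          (\<Sum>l = 1..k. (if l = j then reduced A B l else 0) +
             (if l = j + 2 then of_real ((real j + 2) / (2 * real j)) * cnj (A l) else 0))"
        by (intro trig_coeff_sum mode_coefficients(2)) (use that parameters_cases[OF par] in auto)
      moreover have "(\<Sum>l = 1..k. (if l = j then reduced A B l else 0) +
             (if l = j + 2 then of_real ((real j + 2) / (2 * real j)) * cnj (A l) else 0)) = B j"
        using that parameters_cases(2)[OF par, of "j + 2"] by (simp add: sum.distrib reduced_def)
      ultimately show ?thesis by (simp add: solution_def)
    qed
    moreover have "trig_coeff (\<lambda>t. solution k A B j t $ 3) 0 0" for j
    proof -
      have "trig_coeff (\<lambda>t. \<Sum>l = 1..k. mode (A l) (reduced A B l) l j t $ 3) 0 (\<Sum>l = 1..k. 0)"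
        by (intro trig_coeff_sum mode_coefficients(3)) (use parameters_cases[OF par] in auto)
      then show ?thesis by (simp add: solution_def)
    qed
    moreover have "trig_coeff (\<lambda>t. solution k A B 0 t $ 1) 0 0"
    proof -
      have "trig_coeff (\<lambda>t. \<Sum>l = 1..k. mode (A l) (reduced A B l) l 0 t $ 1) 0 (\<Sum>l = 1..k. 0)"
        by (intro trig_coeff_sum mode_coefficients(4)) (use parameters_cases[OF par] in auto)
      then show ?thesis by (simp add: solution_def)
    qed
    moreover have "trig_coeff (\<lambda>t. solution k A B 0 t $ 2) 0 0"
    proof -
      have "trig_coeff (\<lambda>t. \<Sum>l = 1..k. mode (A l) (reduced A B l) l 0 t $ 2) 0 (\<Sum>l = 1..k. 0)"
        by (intro trig_coeff_sum mode_coefficients(5)) (use parameters_cases[OF par] in auto)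
      then show ?thesis by (simp add: solution_def)
    qed
    ultimately show ?thesis unfolding normalised_def by blast
  qed
  moreover have "\<forall>j>k. solution k A B j = (\<lambda>t. 0)"
    by (auto simp: solution_def fun_eq_iff mode_eq_0)
  ultimately show ?thesis unfolding is_solution_iff[OF assms(1)] by blast
qed

lemma is_solution_eq:
  assumes "k \<ge> 1" "(A, B) \<in> parameters k" "is_solution k A B p"
  shows "p = solution k A B"
  using is_solution_unique solution_is_solution assms by blast

lemma cis_add_of_int_pi: "cis (x + of_int n * pi) = (if even n then 1 else - 1) * cis x"
  by (auto simp: complex_eq_iff mult.commute[of _ pi] cos_add sin_add)

lemma wave_shift: "wave e z l (t + pi) = (if odd l then wave e z l t else - wave e z l t)"
  if "e = 1 \<or> e = - 1"
proof -
  from that obtain n :: int where n: "- e * (real l + e) = of_int n" and "even n \<longleftrightarrow> odd l"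
    by (elim disjE) (auto intro: that[of "- (int l + 1)"] that[of "int l - 1"])
  then show ?thesis
    unfolding wave_def n by (simp add: distrib_left cis_add_of_int_pi)
qed

text \<open>
  Mode \<open>l\<close> only occurs in those \<open>s\<close> and \<open>d\<close> with \<open>l - j\<close> even and in those \<open>c\<close> with \<open>l - j\<close> odd. The
  factors \<open>exp (i t)\<close> that lead back to \<open>a\<close> and \<open>b\<close> contribute one more sign.
\<close>

lemma mode_shift: "mode A B l j (t + pi) = (- 1) ^ j *\<^sub>R mode A B l j t"
proof (cases "l < j")
  case True
  then show ?thesis by (simp add: mode_eq_0)
next
  case False
  have c: "cis (t + pi) = - cis t" "cis (- (t + pi)) = - cis (- t)"
    using cis_add_of_int_pi[of t 1] cis_add_of_int_pi[of "- t" "-1"] by simp_all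
  have 1: "coef e j l = 0" if "even l \<noteq> even j" for e
    using that False by (intro coef_parity) auto
  have 2: "coef e (j + 1) l = 0" if "even l = even j" for e
    using that False by (cases "l = j") (auto intro!: coef_parity simp: coef_less)
  have "mode_s A B l j (t + pi) = (if even j then - mode_s A B l j t else mode_s A B l j t)"
    "mode_d A B l j (t + pi) = (if even j then - mode_d A B l j t else mode_d A B l j t)"
    using 1 by (cases "even l = even j"; force simp: mode_s_def mode_d_def wave_shift complex_eq_iff)+
  moreover have "mode_c A B l j (t + pi) = (if even j then mode_c A B l j t else - mode_c A B l j t)"
    using 2 by (cases "even l = even j"; force simp: mode_c_def wave_shift complex_eq_iff)
  ultimately show ?thesis
    unfolding mode_def c by (simp add: vec_eq_iff forall_3 algebra_simps diff_divide_distrib add_divide_distrib)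
qed

lemma trig_poly_wave: "\<xi> \<in> X \<Longrightarrow> trig_poly X f \<Longrightarrow> trig_poly X (\<lambda>v. wave e (f v) l (\<xi> v))"
  unfolding wave_def by (intro trig_poly.mult trig_poly.cis)

lemma trig_poly_mode:
  assumes "\<xi> \<in> X"
  shows "trig_poly X (\<lambda>v. mode A B l j (\<xi> v) $ i)"
proof -
  have c: "trig_poly X (\<lambda>v. cis (\<xi> v))" "trig_poly X (\<lambda>v. cis (- \<xi> v))"
    using trig_poly.cis[OF assms, of 1] trig_poly.cis[OF assms, of "-1"] by simp_all
  have m: "trig_poly X (\<lambda>v. mode_s A B l j (\<xi> v))" "trig_poly X (\<lambda>v. mode_d A B l j (\<xi> v))"
    "trig_poly X (\<lambda>v. mode_c A B l j (\<xi> v))"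
    unfolding mode_s_def mode_d_def mode_c_def of_real_mult
    by (intro trig_poly_Complex; unfold of_real_mult;
        intro trig_poly.mult trig_poly.const trig_poly_Re trig_poly_Im trig_poly_wave assms)+
  have "trig_poly X (\<lambda>v. cis (\<xi> v) * (mode_s A B l j (\<xi> v) + mode_d A B l j (\<xi> v)) * inverse 2)"
    by (intro trig_poly.mult trig_poly.add trig_poly.const c m)
  moreover have "trig_poly X (\<lambda>v. - \<i> * cis (- \<xi> v) * (mode_s A B l j (\<xi> v) - mode_d A B l j (\<xi> v)) * inverse 2)"
    by (intro trig_poly.mult trig_poly_diff trig_poly.const c m)
  ultimately show ?thesis
    using exhaust_3[of i] m(3) unfolding mode_def divide_complex_def by (elim disjE) simp_all
qed

section \<open>The family of 3-folds swept out by a solution\<close>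

text \<open>
  Conjugation makes the product Hermitian orthogonal to its factors: a special Lagrangian plane is spanned
  by any two independent vectors \<open>u\<close>, \<open>v\<close> in it together with \<open>conj_cross u v\<close>.
\<close>

definition conj_cross :: "complex ^ 3 \<Rightarrow> complex ^ 3 \<Rightarrow> complex ^ 3" where
  "conj_cross u v = vector
     [cnj (u $ 2 * v $ 3 - u $ 3 * v $ 2), cnj (u $ 3 * v $ 1 - u $ 1 * v $ 3), cnj (u $ 1 * v $ 2 - u $ 2 * v $ 1)]"

definition velocity :: "(nat \<Rightarrow> real \<Rightarrow> complex ^ 3) \<Rightarrow> nat \<Rightarrow> real \<Rightarrow> complex ^ 3" where
  "velocity p j t = vector
     [of_nat (j + 1) * \<i> * cis t * cnj (p (j + 1) t $ 3) + of_nat j * cnj (p j t $ 2),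
      of_nat (j + 1) * cis (- t) * cnj (p (j + 1) t $ 3) - of_nat j * cnj (p j t $ 1),
      - of_nat (j + 1) * (\<i> * cis t * cnj (p (j + 1) t $ 1) + cis (- t) * cnj (p (j + 1) t $ 2))]"

definition Phi_x :: "nat \<Rightarrow> (nat \<Rightarrow> real \<Rightarrow> complex ^ 3) \<Rightarrow> real \<times> real \<times> real \<Rightarrow> complex ^ 3" where
  "Phi_x k p = (\<lambda>(x, y, t). (\<Sum>j\<le>k. (real j * x ^ (j - 1)) *\<^sub>R p j t) + y *\<^sub>R q2 t)"

definition Phi_y :: "real \<times> real \<times> real \<Rightarrow> complex ^ 3" where
  "Phi_y = (\<lambda>(x, y, t). q1 t + x *\<^sub>R q2 t)"

lemma scaleR_complex: "r *\<^sub>R (z :: complex) = of_real r * z"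
  by (rule scaleR_conv_of_real)

lemma has_vector_derivative_vec3:
  fixes f :: "real \<Rightarrow> complex ^ 3"
  assumes "\<And>i. ((\<lambda>t. f t $ i) has_vector_derivative f' $ i) F"
  shows "(f has_vector_derivative f') F"
proof -
  have "((\<lambda>t. axis 1 (f t $ 1) + axis 2 (f t $ 2) + axis 3 (f t $ 3)) has_vector_derivative
      (axis 1 (f' $ 1) + axis 2 (f' $ 2) + axis 3 (f' $ 3) :: complex ^ 3)) F"
    by (intro has_vector_derivative_add bounded_linear.has_vector_derivative[OF bounded_linear_axis] assms)
  then show ?thesis by (simp only: axis_decomposition)
qed

lemma evolves_iff: "evolves p \<longleftrightarrow> (\<forall>j t. (p j has_vector_derivative velocity p j t) (at t))"
proof
  assume e: "evolves p"
  show "\<forall>j t. (p j has_vector_derivative velocity p j t) (at t)"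
  proof (intro allI has_vector_derivative_vec3)
    fix j t and i :: 3
    show "((\<lambda>t. p j t $ i) has_vector_derivative velocity p j t $ i) (at t)"
      using e[unfolded evolves_def, rule_format, of j t] exhaust_3[of i] unfolding velocity_def
      by (elim disjE) (simp_all only: vector_3 simp_thms)
  qed
next
  assume e: "\<forall>j t. (p j has_vector_derivative velocity p j t) (at t)"
  then have c: "((\<lambda>t. p j t $ i) has_vector_derivative velocity p j t $ i) (at t)" for i j t
    by (intro bounded_linear.has_vector_derivative[OF bounded_linear_vec_nth]) blast
  show "evolves p"
    unfolding evolves_def using c[of _ 1] c[of _ 2] c[of _ 3]
    unfolding velocity_def vector_3 by blast
qed

lemma q1_derivative: "(q1 has_vector_derivative vector [\<i> * cis t, cis (- t), 0]) (at t)"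
proof (rule has_vector_derivative_vec3)
  fix i :: 3
  have "(cis has_vector_derivative \<i> * cis t) (at t)"
    using has_vector_derivative_cis_scaled[of 1 t UNIV] by simp
  moreover have "((\<lambda>t. \<i> * cis (- t)) has_vector_derivative \<i> * (- \<i> * cis (- t))) (at t)"
    using has_vector_derivative_cis_scaled[of "-1" t UNIV] by (intro has_vector_derivative_mult_right) simp
  ultimately show "((\<lambda>t. q1 t $ i) has_vector_derivative vector [\<i> * cis t, cis (- t), 0] $ i) (at t)"
    using exhaust_3[of i] by (elim disjE) (simp_all add: q1_def)
qed

lemma sum_shift_derivative:
  fixes f :: "nat \<Rightarrow> complex"
  assumes "f (k + 1) = 0"
  shows "(\<Sum>j\<le>k. of_real (x ^ j) * (of_nat (j + 1) * f (j + 1))) = (\<Sum>j\<le>k. of_real (real j * x ^ (j - 1)) * f j)"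
proof -
  have "(\<Sum>j\<le>Suc k. of_real (real j * x ^ (j - 1)) * f j) = (\<Sum>j\<le>k. of_real (x ^ j) * (of_nat (j + 1) * f (j + 1)))"
    by (subst sum.atMost_Suc_shift) (simp add: mult_ac)
  then show ?thesis using assms by simp
qed

lemma sum_power_derivative:
  fixes f :: "nat \<Rightarrow> complex"
  shows "(\<Sum>j\<le>k. of_real (x ^ j) * (of_nat j * f j)) = of_real x * (\<Sum>j\<le>k. of_real (real j * x ^ (j - 1)) * f j)"
  unfolding sum_distrib_left
proof (intro sum.cong refl)
  show "of_real (x ^ j) * (of_nat j * f j) = of_real x * (of_real (real j * x ^ (j - 1)) * f j)" for j
    by (cases j) (simp_all add: mult_ac)
qed

text \<open>
  The evolution equations say that the velocity in \<open>t\<close> is the conjugate of the complex cross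
  product of the two other tangent vectors. All geometric properties of \<open>Phi\<close> follow from this identity.
\<close>

lemma Phi_t_eq:
  assumes "p (k + 1) t = 0"
  shows "(\<Sum>j\<le>k. x ^ j *\<^sub>R velocity p j t) + y *\<^sub>R vector [\<i> * cis t, cis (- t), 0]
    = conj_cross (Phi_x k p (x, y, t)) (Phi_y (x, y, t))"
proof -
  define S where "S = (\<lambda>i. \<Sum>j\<le>k. of_real (real j * x ^ (j - 1)) * p j t $ i)"
  have X: "Phi_x k p (x, y, t) $ 1 = S 1" "Phi_x k p (x, y, t) $ 2 = S 2" "Phi_x k p (x, y, t) $ 3 = S 3 + of_real y"
    unfolding Phi_x_def S_def by (simp_all add: q2_def scaleR_complex)
  have Y: "Phi_y (x, y, t) $ 1 = cis t" "Phi_y (x, y, t) $ 2 = \<i> * cis (- t)" "Phi_y (x, y, t) $ 3 = of_real x"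
    unfolding Phi_y_def by (simp_all add: q1_def q2_def scaleR_complex)
  have shift: "(\<Sum>j\<le>k. of_real (x ^ j) * (of_nat (j + 1) * cnj (p (j + 1) t $ i))) = cnj (S i)" for i
    using sum_shift_derivative[of "\<lambda>j. cnj (p j t $ i)" k x] assms by (simp add: S_def cnj_sum)
  have power: "(\<Sum>j\<le>k. of_real (x ^ j) * (of_nat j * cnj (p j t $ i))) = of_real x * cnj (S i)" for i
    using sum_power_derivative[of x "\<lambda>j. cnj (p j t $ i)" k] by (simp add: S_def cnj_sum)
  have 1: "(\<Sum>j\<le>k. x ^ j *\<^sub>R velocity p j t $ 1) = \<i> * cis t * cnj (S 3) + of_real x * cnj (S 2)"
    unfolding shift[of 3, symmetric] power[of 2, symmetric] velocity_def vector_3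
    by (simp add: sum_distrib_left sum.distrib[symmetric] scaleR_complex algebra_simps)
  have 2: "(\<Sum>j\<le>k. x ^ j *\<^sub>R velocity p j t $ 2) = cis (- t) * cnj (S 3) - of_real x * cnj (S 1)"
    unfolding shift[of 3, symmetric] power[of 1, symmetric] velocity_def vector_3
    by (simp add: sum_distrib_left sum_subtractf[symmetric] scaleR_complex algebra_simps)
  have 3: "(\<Sum>j\<le>k. x ^ j *\<^sub>R velocity p j t $ 3) = - (\<i> * cis t * cnj (S 1)) - cis (- t) * cnj (S 2)"
    unfolding shift[of 1, symmetric] shift[of 2, symmetric] velocity_def vector_3
    by (simp add: sum_distrib_left sum_subtractf[symmetric] sum_negf[symmetric] scaleR_complex algebra_simps)
  show ?thesis
    unfolding vec_eq_iff forall_3 vector_add_component sum_component vector_scaleR_component 1 2 3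
      conj_cross_def vector_3 X Y
    by (simp add: cis_cnj scaleR_complex algebra_simps)
qed

lemma Phi_has_derivative:
  assumes "evolves p" "\<And>t. p (k + 1) t = 0"
  shows "(Phi k p has_derivative (\<lambda>(u, v, w). u *\<^sub>R Phi_x k p z + v *\<^sub>R Phi_y z + w *\<^sub>R conj_cross (Phi_x k p z) (Phi_y z))) (at z)"
proof -
  obtain x y t where z: "z = (x, y, t)" by (cases z)
  have p': "((\<lambda>z. p j (snd (snd z))) has_derivative (\<lambda>h. snd (snd h) *\<^sub>R velocity p j t)) (at z)" for j
    using assms(1) unfolding evolves_iff has_vector_derivative_def z
    by (intro has_derivative_compose[of "\<lambda>z. snd (snd z)" "\<lambda>h. snd (snd h)" _ UNIV "p j"] derivative_intros) auto
  have q1': "((\<lambda>z. q1 (snd (snd z))) has_derivative (\<lambda>h. snd (snd h) *\<^sub>R vector [\<i> * cis t, cis (- t), 0])) (at z)"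
    using q1_derivative[of t] unfolding has_vector_derivative_def z
    by (intro has_derivative_compose[of "\<lambda>z. snd (snd z)" "\<lambda>h. snd (snd h)" _ UNIV q1] derivative_intros) auto
  define e where "e = (q2 0)"
  have q2: "q2 s = e" for s by (simp add: e_def q2_def)
  have "((\<lambda>z. (\<Sum>j\<le>k. (fst z ^ j) *\<^sub>R p j (snd (snd z))) + fst (snd z) *\<^sub>R q1 (snd (snd z)) + (fst z * fst (snd z)) *\<^sub>R e)
      has_derivative (\<lambda>h. (\<Sum>j\<le>k. x ^ j *\<^sub>R (snd (snd h) *\<^sub>R velocity p j t) + (real j * (fst h * x ^ (j - 1))) *\<^sub>R p j t)
        + (y *\<^sub>R (snd (snd h) *\<^sub>R vector [\<i> * cis t, cis (- t), 0]) + fst (snd h) *\<^sub>R q1 t)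
        + (x * fst (snd h) + fst h * y) *\<^sub>R e)) (at z)"
    unfolding z
    by (rule has_derivative_eq_rhs, (rule derivative_intros p'[unfolded z] q1'[unfolded z])+)
       (auto simp: fun_eq_iff mult_ac)
  moreover have "Phi k p = (\<lambda>z. (\<Sum>j\<le>k. (fst z ^ j) *\<^sub>R p j (snd (snd z))) + fst (snd z) *\<^sub>R q1 (snd (snd z)) + (fst z * fst (snd z)) *\<^sub>R e)"
    by (simp add: Phi_def fun_eq_iff q2)
  moreover have "(\<lambda>h. (\<Sum>j\<le>k. x ^ j *\<^sub>R (snd (snd h) *\<^sub>R velocity p j t) + (real j * (fst h * x ^ (j - 1))) *\<^sub>R p j t)
        + (y *\<^sub>R (snd (snd h) *\<^sub>R vector [\<i> * cis t, cis (- t), 0]) + fst (snd h) *\<^sub>R q1 t)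
        + (x * fst (snd h) + fst h * y) *\<^sub>R e) =
      (\<lambda>(u, v, w). u *\<^sub>R Phi_x k p z + v *\<^sub>R Phi_y z + w *\<^sub>R conj_cross (Phi_x k p z) (Phi_y z))"
  proof (intro ext, clarify)
    fix u v w :: real
    have "(\<Sum>j\<le>k. x ^ j *\<^sub>R (w *\<^sub>R velocity p j t) + (real j * (u * x ^ (j - 1))) *\<^sub>R p j t) =
      w *\<^sub>R (\<Sum>j\<le>k. x ^ j *\<^sub>R velocity p j t) + u *\<^sub>R (\<Sum>j\<le>k. (real j * x ^ (j - 1)) *\<^sub>R p j t)"
      by (simp add: sum.distrib scaleR_right.sum mult_ac)
    then show "(\<Sum>j\<le>k. x ^ j *\<^sub>R (snd (snd (u, v, w)) *\<^sub>R velocity p j t) + (real j * (fst (u, v, w) * x ^ (j - 1))) *\<^sub>R p j t)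
        + (y *\<^sub>R (snd (snd (u, v, w)) *\<^sub>R vector [\<i> * cis t, cis (- t), 0]) + fst (snd (u, v, w)) *\<^sub>R q1 t)
        + (x * fst (snd (u, v, w)) + fst (u, v, w) * y) *\<^sub>R e =
      u *\<^sub>R Phi_x k p z + v *\<^sub>R Phi_y z + w *\<^sub>R conj_cross (Phi_x k p z) (Phi_y z)"
      unfolding z Phi_t_eq[where p = p and k = k and t = t, OF assms(2), symmetric]
      by (simp add: Phi_x_def Phi_y_def q2 algebra_simps)
  qed
  ultimately show ?thesis by simp
qed

definition hermitian :: "complex ^ 3 \<Rightarrow> complex ^ 3 \<Rightarrow> complex" where
  "hermitian u v = u $ 1 * cnj (v $ 1) + u $ 2 * cnj (v $ 2) + u $ 3 * cnj (v $ 3)"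

lemma kaehler_form_hermitian: "kaehler_form u v = - of_real (Im (hermitian u v))"
  by (simp add: kaehler_form_def hermitian_def sum_3 complex_eq_iff)

lemma hermitian_conj_cross: "hermitian u (conj_cross u v) = 0" "hermitian v (conj_cross u v) = 0"
  by (simp_all add: hermitian_def conj_cross_def algebra_simps)

lemma kaehler_form_span:
  assumes "Im (hermitian X Y) = 0" and T: "T = conj_cross X Y"
  shows "kaehler_form (u *\<^sub>R X + v *\<^sub>R Y + w *\<^sub>R T) (u' *\<^sub>R X + v' *\<^sub>R Y + w' *\<^sub>R T) = 0"
proof -
  have add: "hermitian (a + b) c = hermitian a c + hermitian b c" "hermitian c (a + b) = hermitian c a + hermitian c b"
    "hermitian (r *\<^sub>R a) b = r *\<^sub>R hermitian a b" "hermitian a (r *\<^sub>R b) = r *\<^sub>R hermitian a b" for a b c r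
    by (simp_all add: hermitian_def scaleR_complex algebra_simps)
  have sym: "hermitian b a = cnj (hermitian a b)" for a b by (simp add: hermitian_def mult_ac)
  have "Im (hermitian a a) = 0" for a by (simp add: hermitian_def algebra_simps)
  moreover have "Im (hermitian Y X) = 0" using assms(1) sym[of X Y] by simp
  moreover have "hermitian X T = 0" "hermitian Y T = 0" "hermitian T X = 0" "hermitian T Y = 0"
    using hermitian_conj_cross sym[of X T] sym[of Y T] by (simp_all add: T)
  ultimately show ?thesis using assms(1) by (simp add: kaehler_form_hermitian add)
qed

lemma holomorphic_volume_expand:
  "holomorphic_volume u v w = u $ 1 * (v $ 2 * w $ 3 - v $ 3 * w $ 2) + u $ 2 * (v $ 3 * w $ 1 - v $ 1 * w $ 3)
     + u $ 3 * (v $ 1 * w $ 2 - v $ 2 * w $ 1)"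
  by (simp add: holomorphic_volume_def det_3 algebra_simps)

text \<open>
  The determinant of \<open>X\<close>, \<open>Y\<close> and a third vector is the bilinear pairing of the cross product with that vector, here
  its own conjugate.
\<close>

lemma holomorphic_volume_conj_cross:
  "holomorphic_volume X Y (conj_cross X Y) = of_real ((norm (conj_cross X Y $ 1))\<^sup>2 + (norm (conj_cross X Y $ 2))\<^sup>2 + (norm (conj_cross X Y $ 3))\<^sup>2)"
  unfolding of_real_add complex_norm_square
  by (simp add: holomorphic_volume_expand conj_cross_def algebra_simps)

lemma holomorphic_volume_span:
  "holomorphic_volume (u1 *\<^sub>R X + v1 *\<^sub>R Y + w1 *\<^sub>R T) (u2 *\<^sub>R X + v2 *\<^sub>R Y + w2 *\<^sub>R T) (u3 *\<^sub>R X + v3 *\<^sub>R Y + w3 *\<^sub>R T) =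
    of_real (u1 * (v2 * w3 - w2 * v3) + v1 * (w2 * u3 - u2 * w3) + w1 * (u2 * v3 - v2 * u3)) * holomorphic_volume X Y T"
  by (simp add: holomorphic_volume_expand scaleR_complex) algebra

text \<open>
  Both forms are determined by their values on the three spanning vectors, where the third is orthogonal
  to the others and the volume is real.
\<close>

lemma special_lagrangian_plane_span:
  assumes "Im (hermitian X Y) = 0" and T: "T = conj_cross X Y"
    and D: "D = (\<lambda>(u, v, w). u *\<^sub>R X + v *\<^sub>R Y + w *\<^sub>R T :: complex ^ 3)" and "inj (D :: real \<times> real \<times> real \<Rightarrow> _)"
  shows "special_lagrangian_plane (range D)"
proof -
  have lin: "linear D"
    unfolding D by (rule linearI) (auto simp: algebra_simps)
  have "dim (range D) = dim (UNIV :: (real \<times> real \<times> real) set)"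
    using lin assms(4) by (intro dim_image_eq) (auto simp: span_UNIV)
  then have "dim (range D) = 3" by simp
  moreover have "subspace (range D)"
    using linear_subspace_image[OF lin subspace_UNIV] .
  moreover have "kaehler_form a b = 0" if "a \<in> range D" "b \<in> range D" for a b
    using that kaehler_form_span[OF assms(1) T] by (auto simp: D)
  moreover have "Im (holomorphic_volume a b c) = 0" if "a \<in> range D" "b \<in> range D" "c \<in> range D" for a b c
    using that by (auto simp: D holomorphic_volume_span T holomorphic_volume_conj_cross)
  ultimately show ?thesis unfolding special_lagrangian_plane_def by blast
qed

text \<open>
  The holomorphic volume of the three vectors is nonzero, so they are even linearly independent
  over the complex numbers.
\<close>

lemma inj_span_conj_cross:
  assumes "conj_cross X Y \<noteq> 0"
  shows "inj (\<lambda>(u, v, w). u *\<^sub>R X + v *\<^sub>R Y + w *\<^sub>R conj_cross X Y)"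
proof -
  define T where "T = conj_cross X Y"
  have "u = 0 \<and> v = 0 \<and> w = 0" if 0: "u *\<^sub>R X + v *\<^sub>R Y + w *\<^sub>R T = 0" for u v w
  proof -
    have n: "holomorphic_volume X Y T \<noteq> 0"
    proof
      assume "holomorphic_volume X Y T = 0"
      then have "(norm (T $ 1))\<^sup>2 + (norm (T $ 2))\<^sup>2 + (norm (T $ 3))\<^sup>2 = 0"
        unfolding T_def holomorphic_volume_conj_cross of_real_eq_0_iff .
      then have "T = 0"
        by (simp add: vec_eq_iff forall_3 add_nonneg_eq_0_iff)
      with assms show False by (simp add: T_def)
    qed
    have z: "holomorphic_volume 0 a b = 0" for a b by (simp add: holomorphic_volume_expand)
    have "of_real w * holomorphic_volume X Y T = 0"
      using holomorphic_volume_span[of u X v Y w T 1 0 0 0 1 0] 0 z by simp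
    moreover have "of_real u * holomorphic_volume X Y T = 0"
      using holomorphic_volume_span[of u X v Y w T 0 1 0 0 0 1] 0 z by simp
    moreover have "of_real v * holomorphic_volume X Y T = 0"
      using holomorphic_volume_span[of u X v Y w T 0 0 1 1 0 0] 0 z by simp
    ultimately show ?thesis using n by simp
  qed
  moreover have "linear (\<lambda>(u, v, w). u *\<^sub>R X + v *\<^sub>R Y + w *\<^sub>R T)"
    by (rule linearI) (auto simp: algebra_simps)
  ultimately have "inj (\<lambda>(u, v, w). u *\<^sub>R X + v *\<^sub>R Y + w *\<^sub>R T)"
    by (subst linear_inj_iff_eq_0) (auto simp: zero_prod_def)
  then show ?thesis by (simp add: T_def)
qed

section \<open>Maps defined through a covering\<close>

definition locally_injective :: "('e::euclidean_space \<Rightarrow> 'a) \<Rightarrow> bool" where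
  "locally_injective \<pi> \<longleftrightarrow> (\<forall>z. \<exists>W. open W \<and> z \<in> W \<and> inj_on \<pi> W)"

lemma cover_chart:
  assumes "inj_on \<pi> W"
  shows "the_inv_into W \<pi> ` \<pi> ` W = W"
    and "w \<in> W \<Longrightarrow> the_inv_into W \<pi> (\<pi> w) = w"
    and "w \<in> W \<Longrightarrow> the_inv_into (\<pi> ` W) (the_inv_into W \<pi>) w = \<pi> w"
proof -
  show "the_inv_into W \<pi> ` \<pi> ` W = W" using assms by (rule the_inv_into_onto)
  show 1: "the_inv_into W \<pi> (\<pi> w) = w" if "w \<in> W" for w using assms that by (rule the_inv_into_f_f)
  have "inj_on (the_inv_into W \<pi>) (\<pi> ` W)" using assms by (rule inj_on_the_inv_into)
  from the_inv_into_f_f[OF this, of "\<pi> w"] show "the_inv_into (\<pi> ` W) (the_inv_into W \<pi>) w = \<pi> w" if "w \<in> W"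
    using that 1 by simp
qed

lemma atlas_carrier_cover:
  assumes "locally_injective \<pi>"
  shows "atlas_carrier (cover_atlas \<pi>) = range \<pi>"
  using assms unfolding atlas_carrier_def cover_atlas_def locally_injective_def by (auto 4 4)

lemma smooth_into_cover:
  assumes "smooth_on UNIV \<Phi>" and F: "\<And>z. F (\<pi> z) = \<Phi> z"
  shows "smooth_into (cover_atlas \<pi>) F"
  unfolding smooth_into_def cover_atlas_def
proof clarify
  fix W assume W: "open W" "inj_on \<pi> W"
  show "smooth_on (the_inv_into W \<pi> ` \<pi> ` W) (F \<circ> the_inv_into (\<pi> ` W) (the_inv_into W \<pi>))"
    unfolding smooth_on_def cover_chart(1)[OF W(2)]
  proof
    fix n
    show "Ck_on n W (F \<circ> the_inv_into (\<pi> ` W) (the_inv_into W \<pi>))"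
      by (rule Ck_on_cong[of _ \<Phi>])
         (use assms W in \<open>auto simp: cover_chart(3) smooth_on_def intro: Ck_on_subset\<close>)
  qed
qed

text \<open>
  The charts are local inverses of the covering, so in every chart \<open>F\<close> is read as its lift \<open>\<Phi>\<close>.
\<close>

lemma differential_at_cover:
  assumes F: "\<And>z. F (\<pi> z) = \<Phi> z"
  shows "differential_at (cover_atlas \<pi>) F p D \<longleftrightarrow>
    (\<exists>z W. p = \<pi> z \<and> open W \<and> z \<in> W \<and> inj_on \<pi> W \<and> (\<Phi> has_derivative D) (at z))"
proof -
  have eq: "((F \<circ> the_inv_into (\<pi> ` W) (the_inv_into W \<pi>)) has_derivative D) (at w) \<longleftrightarrow> (\<Phi> has_derivative D) (at w)"
    if "open W" "inj_on \<pi> W" "w \<in> W" for W w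
    using that by (intro iffI; elim has_derivative_transform_within_open[of _ D w UNIV W])
      (auto simp: cover_chart(3) F)
  show ?thesis
  proof
    assume "differential_at (cover_atlas \<pi>) F p D"
    then obtain W where W: "open W" "inj_on \<pi> W" "p \<in> \<pi> ` W"
      and D: "((F \<circ> the_inv_into (\<pi> ` W) (the_inv_into W \<pi>)) has_derivative D) (at (the_inv_into W \<pi> p))"
      unfolding differential_at_def cover_atlas_def by auto
    from W(3) obtain z where "z \<in> W" "p = \<pi> z" by blast
    then show "\<exists>z W. p = \<pi> z \<and> open W \<and> z \<in> W \<and> inj_on \<pi> W \<and> (\<Phi> has_derivative D) (at z)"
      using W D eq[of W z] by (auto simp: cover_chart(2))
  next
    assume "\<exists>z W. p = \<pi> z \<and> open W \<and> z \<in> W \<and> inj_on \<pi> W \<and> (\<Phi> has_derivative D) (at z)"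
    then obtain z W where "p = \<pi> z" "open W" "z \<in> W" "inj_on \<pi> W" "(\<Phi> has_derivative D) (at z)" by blast
    then show "differential_at (cover_atlas \<pi>) F p D"
      unfolding differential_at_def cover_atlas_def
      by (intro bexI[of _ "(\<pi> ` W, the_inv_into W \<pi>)"]) (auto simp: cover_chart(2) eq)
  qed
qed

text \<open>
  Around \<open>\<pi> z\<close> the chart of the source is shrunk until its image under \<open>\<Psi>\<close> lies in a chart of the target.
\<close>

lemma smooth_map_cover:
  assumes \<pi>: "locally_injective \<pi>" "locally_injective \<rho>"
    and \<Psi>: "smooth_on UNIV \<Psi>" and f: "\<And>z. f (\<pi> z) = \<rho> (\<Psi> z)"
  shows "smooth_map (cover_atlas \<pi>) (cover_atlas \<rho>) f"
  unfolding smooth_map_def atlas_carrier_cover[OF \<pi>(1)]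
proof
  fix p assume "p \<in> range \<pi>"
  then obtain z where p: "p = \<pi> z" by blast
  obtain V where V: "open V" "z \<in> V" "inj_on \<pi> V" using \<pi>(1) unfolding locally_injective_def by blast
  obtain W where W: "open W" "\<Psi> z \<in> W" "inj_on \<rho> W" using \<pi>(2) unfolding locally_injective_def by blast
  have "continuous_on UNIV \<Psi>" using \<Psi> unfolding smooth_on_def by (metis Ck_on.simps(1))
  then have "open (\<Psi> -` W)" using W(1) by (simp add: continuous_on_open_vimage)
  define V' where "V' = V \<inter> \<Psi> -` W"
  have V': "open V'" "z \<in> V'" "inj_on \<pi> V'"
    using V W \<open>open (\<Psi> -` W)\<close> by (auto simp: V'_def intro: inj_on_subset)
  have "smooth_on V' (the_inv_into W \<rho> \<circ> f \<circ> the_inv_into (\<pi> ` V') (the_inv_into V' \<pi>))"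
    unfolding smooth_on_def
  proof
    fix n
    show "Ck_on n V' (the_inv_into W \<rho> \<circ> f \<circ> the_inv_into (\<pi> ` V') (the_inv_into V' \<pi>))"
    proof (rule Ck_on_cong[OF V'(1)])
      show "Ck_on n V' \<Psi>" using \<Psi> by (auto simp: smooth_on_def intro: Ck_on_subset)
      show "\<Psi> x = (the_inv_into W \<rho> \<circ> f \<circ> the_inv_into (\<pi> ` V') (the_inv_into V' \<pi>)) x" if "x \<in> V'" for x
        using that cover_chart(3)[OF V'(3) that] cover_chart(2)[OF W(3), of "\<Psi> x"] f by (auto simp: V'_def)
    qed
  qed
  then show "\<exists>(U, \<phi>)\<in>cover_atlas \<pi>. \<exists>(V, \<psi>)\<in>cover_atlas \<rho>.
      p \<in> U \<and> f ` U \<subseteq> V \<and> smooth_on (\<phi> ` U) (\<psi> \<circ> f \<circ> the_inv_into U \<phi>)"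
    unfolding cover_atlas_def
    using V' W(1,3) f
    by (intro bexI[of _ "(\<pi> ` V', the_inv_into V' \<pi>)"] bexI[of _ "(\<rho> ` W, the_inv_into W \<rho>)"])
       (auto simp: p cover_chart(1)[OF V'(3)] V'_def)
qed

lemma diffeomorphic_cover:
  assumes \<pi>: "locally_injective \<pi>" "locally_injective \<rho>"
    and \<Psi>: "smooth_on UNIV \<Psi>" "smooth_on UNIV \<Theta>" "\<And>z. \<Theta> (\<Psi> z) = z" "\<And>w. \<Psi> (\<Theta> w) = w"
    and fibre: "\<And>z z'. \<pi> z = \<pi> z' \<longleftrightarrow> \<rho> (\<Psi> z) = \<rho> (\<Psi> z')"
  shows "diffeomorphic (cover_atlas \<pi>) (cover_atlas \<rho>)"
proof -
  define f where "f = (\<lambda>c. \<rho> (\<Psi> (SOME z. \<pi> z = c)))"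
  have f: "f (\<pi> z) = \<rho> (\<Psi> z)" for z
    unfolding f_def fibre[symmetric] by (rule someI) simp
  have inj: "inj_on f (range \<pi>)" using fibre by (auto simp: inj_on_def f)
  have "f ` range \<pi> = range \<rho>"
  proof
    show "range \<rho> \<subseteq> f ` range \<pi>"
      using f \<Psi>(4) by (metis (no_types, lifting) image_subsetI rangeI image_eqI)
  qed (auto simp: f)
  then have "bij_betw f (range \<pi>) (range \<rho>)" using inj by (simp add: bij_betw_def)
  moreover have "the_inv_into (range \<pi>) f (\<rho> w) = \<pi> (\<Theta> w)" for w
    using the_inv_into_f_f[OF inj, of "\<pi> (\<Theta> w)"] by (simp add: f \<Psi>(4))
  then have "smooth_map (cover_atlas \<rho>) (cover_atlas \<pi>) (the_inv_into (range \<pi>) f)"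
    by (intro smooth_map_cover[OF \<pi>(2,1) \<Psi>(2)])
  ultimately show ?thesis
    unfolding diffeomorphic_def atlas_carrier_cover[OF \<pi>(1)] atlas_carrier_cover[OF \<pi>(2)]
    using smooth_map_cover[OF \<pi> \<Psi>(1), of f] f by blast
qed

section \<open>The quotient of 3-space by the deck transformations\<close>

lemma deck_eq: "deck n (x, y, t) = (if even n then (x, y, t + of_int n * pi) else (- x, - y, t + of_int n * pi))"
  by (auto simp: deck_def)

lemma deck_add: "deck m (deck n z) = deck (m + n) z"
  by (cases z) (auto simp: deck_eq algebra_simps)

lemma proj_eq_iff: "proj z = proj z' \<longleftrightarrow> (\<exists>n. z' = deck n z)"
proof
  assume "proj z = proj z'"
  moreover have "z' \<in> proj z'"
    unfolding proj_def by (rule range_eqI[of _ _ 0]) (cases z', simp add: deck_eq)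
  ultimately have "z' \<in> proj z" by simp
  then show "\<exists>n. z' = deck n z" by (auto simp: proj_def)
next
  assume "\<exists>n. z' = deck n z"
  then obtain n where n: "z' = deck n z" by blast
  have "deck m z = deck (m - n) z'" for m by (simp add: n deck_add)
  moreover have "deck m z' = deck (m + n) z" for m by (simp add: n deck_add)
  ultimately show "proj z = proj z'" unfolding proj_def by (metis (no_types, lifting) image_cong rangeE rangeI subsetI subset_antisym)
qed

lemma locally_injective_proj: "locally_injective proj"
  unfolding locally_injective_def
proof
  fix z :: "real \<times> real \<times> real"
  obtain x y t where z: "z = (x, y, t)" by (cases z)
  define W where "W = (UNIV :: real set) \<times> (UNIV :: real set) \<times> {t - pi / 2<..<t + pi / 2}"
  have "inj_on proj W"
  proof
    fix v w assume "v \<in> W" "w \<in> W" "proj v = proj w"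
    then obtain n where n: "w = deck n v" by (auto simp: proj_eq_iff)
    obtain a b s where v: "v = (a, b, s)" by (cases v)
    have "\<bar>of_int n * pi\<bar> < pi"
      using \<open>v \<in> W\<close> \<open>w \<in> W\<close> unfolding n v deck_eq W_def by (auto split: if_splits)
    then have "\<bar>real_of_int n\<bar> < 1" by (simp add: abs_mult)
    then have "n = 0" by linarith
    then show "v = w" by (simp add: n v deck_eq)
  qed
  moreover have "open W" unfolding W_def by (intro open_Times) auto
  ultimately show "\<exists>W. open W \<and> z \<in> W \<and> inj_on proj W" by (intro exI[of _ W]) (simp add: W_def z)
qed

lemma cis_eq_iff_int: "cis s = cis s' \<longleftrightarrow> (\<exists>n::int. s' = s + 2 * pi * of_int n)"
  using sin_cos_eq_iff[of s' s] by (auto simp: complex_eq_iff)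

lemma locally_injective_circle: "locally_injective (\<lambda>(s::real, u::real, v::real). (cis s, u, v))"
  unfolding locally_injective_def
proof
  fix z :: "real \<times> real \<times> real"
  obtain s u v where z: "z = (s, u, v)" by (cases z)
  define W where "W = {s - pi<..<s + pi} \<times> (UNIV :: real set) \<times> (UNIV :: real set)"
  have "inj_on (\<lambda>(s, u, v). (cis s, u, v)) W"
  proof
    fix v w assume vw: "v \<in> W" "w \<in> W" "(\<lambda>(s, u, v). (cis s, u, v)) v = (\<lambda>(s, u, v). (cis s, u, v)) w"
    obtain a b c where v: "v = (a, b, c)" by (cases v)
    obtain a' b' c' where w: "w = (a', b', c')" by (cases w)
    from vw obtain n :: int where n: "a' = a + 2 * pi * of_int n" by (auto simp: v w cis_eq_iff_int)
    have "\<bar>2 * pi * of_int n\<bar> < 2 * pi"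
      using vw(1,2) unfolding v w W_def n by auto
    then have "\<bar>real_of_int n\<bar> < 1" by (simp add: abs_mult)
    then have "n = 0" by linarith
    then show "v = w" using n vw(3) by (simp add: v w)
  qed
  moreover have "open W" unfolding W_def by (intro open_Times) auto
  ultimately show "\<exists>W. open W \<and> z \<in> W \<and> inj_on (\<lambda>(s, u, v). (cis s, u, v)) W"
    by (intro exI[of _ W]) (simp add: W_def z)
qed

lemma bounded_linear_coordinates:
  "bounded_linear (\<lambda>z::real \<times> real \<times> real. fst z)" "bounded_linear (\<lambda>z::real \<times> real \<times> real. fst (snd z))"
  "bounded_linear (\<lambda>z::real \<times> real \<times> real. snd (snd z))"
  by (auto intro: bounded_linear_fst bounded_linear_compose[OF bounded_linear_fst bounded_linear_snd]
      bounded_linear_compose[OF bounded_linear_snd bounded_linear_snd])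

lemma smooth_on_triple:
  fixes f g h :: "real \<times> real \<times> real \<Rightarrow> complex"
  assumes "trig_poly {L. bounded_linear L} f" "trig_poly {L. bounded_linear L} g" "trig_poly {L. bounded_linear L} h"
  shows "smooth_on U (\<lambda>z. (Re (f z), Re (g z), Re (h z)))"
  unfolding smooth_on_def
  by (intro allI Ck_on_Pair Ck_on_bounded_linear[OF bounded_linear_Re] trig_poly_Ck_on assms)

text \<open>
  The deck transformations rotate the plane by half a turn as \<open>t\<close> grows by \<open>pi\<close>. In the frame that
  rotates at this rate they are translations of the angle \<open>2 t\<close> by multiples of \<open>2 pi\<close>.
\<close>

lemma diffeomorphic_circle_times_plane: "diffeomorphic quotient_atlas circle_times_plane"
  unfolding quotient_atlas_def circle_times_plane_def
proof (rule diffeomorphic_cover[OF locally_injective_proj locally_injective_circle])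
  let ?x = "\<lambda>z :: real \<times> real \<times> real. complex_of_real (fst z)"
  let ?y = "\<lambda>z :: real \<times> real \<times> real. complex_of_real (fst (snd z))"
  let ?t = "\<lambda>z :: real \<times> real \<times> real. complex_of_real (snd (snd z))"
  \<comment> \<open>The maps are written through the complex number \<open>x + i y\<close>, which \<open>exp (i t)\<close> rotates. The angle on the
    circle is \<open>2 t\<close> since a full period of the quotient is \<open>pi\<close>.\<close>
  let ?\<Psi> = "\<lambda>z :: real \<times> real \<times> real. (Re (2 * ?t z), Re ((?x z + \<i> * ?y z) * cis (1 * snd (snd z))),
    Re (- \<i> * ((?x z + \<i> * ?y z) * cis (1 * snd (snd z)))))"
  let ?\<Theta> = "\<lambda>z :: real \<times> real \<times> real. (Re ((?y z + \<i> * ?t z) * cis (- 1 / 2 * fst z)),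
    Re (- \<i> * ((?y z + \<i> * ?t z) * cis (- 1 / 2 * fst z))), Re (1 / 2 * ?x z))"
  show "smooth_on UNIV ?\<Psi>" "smooth_on UNIV ?\<Theta>"
    by (intro smooth_on_triple trig_poly.mult trig_poly.add trig_poly.const trig_poly.coord trig_poly.cis CollectI
        bounded_linear_coordinates)+
  have rot: "(Re a + \<i> * of_real (Re (- \<i> * a))) = a" for a :: complex
    by (simp add: complex_eq_iff)
  show "?\<Theta> (?\<Psi> z) = z" for z
  proof -
    obtain x y t where z: "z = (x, y, t)" by (cases z)
    show ?thesis unfolding z fst_conv snd_conv rot by (simp add: mult.assoc cis_mult)
  qed
  show "?\<Psi> (?\<Theta> z) = z" for z
  proof -
    obtain x y t where z: "z = (x, y, t)" by (cases z)
    show ?thesis unfolding z fst_conv snd_conv rot by (simp add: mult.assoc cis_mult)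
  qed
  show "proj z = proj z' \<longleftrightarrow>
    (\<lambda>(s, u, v). (cis s, u, v)) (?\<Psi> z) = (\<lambda>(s, u, v). (cis s, u, v)) (?\<Psi> z')" for z z'
  proof -
    obtain x y t where z: "z = (x, y, t)" by (cases z)
    obtain x' y' t' where z': "z' = (x', y', t')" by (cases z')
    have "(\<lambda>(s, u, v). (cis s, u, v)) (?\<Psi> z) = (\<lambda>(s, u, v). (cis s, u, v)) (?\<Psi> z') \<longleftrightarrow>
      cis (2 * t) = cis (2 * t') \<and> (x + \<i> * y) * cis t = (x' + \<i> * y') * cis t'"
      by (auto simp: z z' complex_eq_iff)
    also have "\<dots> \<longleftrightarrow> (\<exists>n::int. t' = t + of_int n * pi \<and> (x + \<i> * y) * cis t = (x' + \<i> * y') * cis t')"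
    proof -
      have "2 * t' = 2 * t + 2 * pi * of_int n \<longleftrightarrow> t' = t + of_int n * pi" for n :: int
        by (auto simp: algebra_simps)
      then show ?thesis unfolding cis_eq_iff_int by simp
    qed
    also have "\<dots> \<longleftrightarrow> (\<exists>n. z' = deck n z)"
    proof (intro ex_cong1)
      fix n
      have "(x + \<i> * y) * cis t = (x' + \<i> * y') * cis t' \<longleftrightarrow> (x', y') = (if even n then (x, y) else (- x, - y))"
        if "t' = t + of_int n * pi"
      proof -
        have "(x + \<i> * y) * cis t = (x' + \<i> * y') * cis t' \<longleftrightarrow>
            (x + \<i> * y) * cis t = ((if even n then 1 else - 1) * (x' + \<i> * y')) * cis t"
          unfolding that cis_add_of_int_pi by (simp add: mult_ac)
        also have "\<dots> \<longleftrightarrow> x + \<i> * y = (if even n then 1 else - 1) * (x' + \<i> * y')"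
          by (simp only: mult_right_cancel[OF cis_neq_zero])
        also have "\<dots> \<longleftrightarrow> (x', y') = (if even n then (x, y) else (- x, - y))"
          by (auto simp: complex_eq_iff)
        finally show ?thesis .
      qed
      then show "(t' = t + of_int n * pi \<and> (x + \<i> * y) * cis t = (x' + \<i> * y') * cis t') \<longleftrightarrow> z' = deck n z"
        by (auto simp: z z' deck_eq)
    qed
    finally show ?thesis unfolding proj_eq_iff by blast
  qed
qed

section \<open>Special Lagrangian 3-folds\<close>

lemma Phi_components:
  shows "Phi_x k p (x, y, t) $ 1 = (\<Sum>j\<le>k. of_real (real j * x ^ (j - 1)) * p j t $ 1)"
    and "Phi_x k p (x, y, t) $ 2 = (\<Sum>j\<le>k. of_real (real j * x ^ (j - 1)) * p j t $ 2)"
    and "Phi_x k p (x, y, t) $ 3 = (\<Sum>j\<le>k. of_real (real j * x ^ (j - 1)) * p j t $ 3) + of_real y"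
    and "Phi_y (x, y, t) $ 1 = cis t" "Phi_y (x, y, t) $ 2 = \<i> * cis (- t)" "Phi_y (x, y, t) $ 3 = of_real x"
  unfolding Phi_x_def Phi_y_def by (simp_all add: q1_def q2_def scaleR_complex)

definition sum_part :: "(nat \<Rightarrow> real \<Rightarrow> complex ^ 3) \<Rightarrow> nat \<Rightarrow> real \<Rightarrow> complex" where
  "sum_part p j t = cis (- t) * p j t $ 1 + \<i> * cis t * p j t $ 2"

definition diff_part :: "(nat \<Rightarrow> real \<Rightarrow> complex ^ 3) \<Rightarrow> nat \<Rightarrow> real \<Rightarrow> complex" where
  "diff_part p j t = cis (- t) * p j t $ 1 - \<i> * cis t * p j t $ 2"

lemma isotropic_diff_part:
  "isotropic k p \<Longrightarrow> 1 \<le> j \<Longrightarrow> j \<le> k \<Longrightarrow> real j * Im (diff_part p j t) + (real j - 1) * Im (p (j - 1) t $ 3) = 0"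
  unfolding isotropic_def diff_part_def by simp

text \<open>
  As a polynomial in \<open>x\<close>, the imaginary part has the coefficient \<open>j Im d + (j - 1) Im c\<close> at \<open>x\<close> to the power
  \<open>j - 1\<close>, with \<open>d\<close> of index \<open>j\<close> and \<open>c\<close> of index \<open>j - 1\<close>; the term \<open>x * y\<close> is real.
\<close>

lemma Phi_isotropic:
  assumes "k \<ge> 1" "isotropic k p"
  shows "Im (hermitian (Phi_x k p z) (Phi_y z)) = 0"
proof -
  obtain x y t where z: "z = (x, y, t)" by (cases z)
  define f where "f = (\<lambda>j. x ^ (j - 1) * (real j * Im (diff_part p j t)))"
  define g where "g = (\<lambda>j. x ^ j * (real j * Im (p j t $ 3)))"
  have "hermitian (Phi_x k p z) (Phi_y z) =
      (\<Sum>j\<le>k. of_real (real j * x ^ (j - 1)) * diff_part p j t) +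
      of_real x * (\<Sum>j\<le>k. of_real (real j * x ^ (j - 1)) * p j t $ 3) + of_real (x * y)"
    unfolding hermitian_def z Phi_components diff_part_def
    by (simp add: cis_cnj algebra_simps sum_distrib_left sum_subtractf sum_negf)
  moreover have Im_scale: "Im (of_real a * v) = a * Im v" for a v by simp
  ultimately have "Im (hermitian (Phi_x k p z) (Phi_y z)) =
      (\<Sum>j\<le>k. Im (of_real (real j * x ^ (j - 1)) * diff_part p j t)) +
      (\<Sum>j\<le>k. Im (of_real x * (of_real (real j * x ^ (j - 1)) * p j t $ 3)))"
    by (simp only: plus_complex.sel Im_sum sum_distrib_left Im_complex_of_real add_0_right)
  also have "\<dots> = (\<Sum>j\<le>k. f j) + (\<Sum>j\<le>k. g j)"
  proof (intro arg_cong2[where f = "(+)"] sum.cong refl)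
    show "Im (of_real (real j * x ^ (j - 1)) * diff_part p j t) = f j" for j
      unfolding f_def Im_scale by (simp only: mult_ac)
    show "Im (of_real x * (of_real (real j * x ^ (j - 1)) * p j t $ 3)) = g j" for j
      unfolding g_def Im_scale by (cases j) (simp_all add: mult_ac)
  qed
  also have "(\<Sum>j\<le>k. g j) = (\<Sum>j\<le>k. if j = 0 then 0 else g (j - 1))"
  proof -
    obtain m where m: "k = Suc m" using assms(1) by (cases k) auto
    have "g k = 0" using assms(2) by (simp add: g_def isotropic_def)
    then have "(\<Sum>j\<le>k. g j) = (\<Sum>j\<le>m. g j)" by (simp add: m)
    also have "\<dots> = (\<Sum>j\<le>Suc m. if j = 0 then 0 else g (j - 1))"
      by (subst sum.atMost_Suc_shift) simp
    finally show ?thesis by (simp add: m)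
  qed
  also have "(\<Sum>j\<le>k. f j) + (\<Sum>j\<le>k. if j = 0 then 0 else g (j - 1)) = 0"
  proof (unfold sum.distrib[symmetric], intro sum.neutral ballI)
    fix j assume j: "j \<in> {..k}"
    show "f j + (if j = 0 then 0 else g (j - 1)) = 0"
    proof (cases "j = 0")
      case False
      then have "f j + g (j - 1) = x ^ (j - 1) * (real j * Im (diff_part p j t) + (real j - 1) * Im (p (j - 1) t $ 3))"
        by (simp add: f_def g_def algebra_simps)
      also have "\<dots> = 0" using isotropic_diff_part[OF assms(2), of j t] j False by simp
      finally show ?thesis using False by simp
    qed (simp add: f_def)
  qed
  finally show ?thesis .
qed

text \<open>
  Only the third component of \<open>Phi_x\<close> depends on \<open>y\<close>, and this dependence is seen in the cross product
  because the first two components of \<open>Phi_y\<close> do not vanish. So \<open>Phi\<close> is immersed on a dense set, whatever the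
  parameters are.
\<close>

lemma conj_cross_Phi_eq_0_unique:
  assumes "conj_cross (Phi_x k p (x, y, t)) (Phi_y (x, y, t)) = 0"
    and "conj_cross (Phi_x k p (x, y', t)) (Phi_y (x, y', t)) = 0"
  shows "y = y'"
proof -
  have "conj_cross (Phi_x k p (x, y, t)) (Phi_y (x, y, t)) $ 2 = conj_cross (Phi_x k p (x, y', t)) (Phi_y (x, y', t)) $ 2"
    using assms by simp
  then have "cnj (of_real y * cis t) = cnj (of_real y' * cis t)"
    unfolding conj_cross_def vector_3 Phi_components by (simp add: algebra_simps)
  then show ?thesis by simp
qed

text \<open>
  The vectors \<open>Phi_x\<close> and \<open>Phi_y\<close> are then complex proportional, \<open>Phi_x = \<mu> Phi_y\<close>. As their Hermitian product is
  real, so is \<open>\<mu>\<close>. The two sums are the combinations of the first two components that are \<open>0\<close> and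
  \<open>2\<close> on \<open>Phi_y\<close>.
\<close>

lemma conj_cross_Phi_eq_0_conditions:
  assumes "k \<ge> 1" "isotropic k p" and 0: "conj_cross (Phi_x k p (x, y, t)) (Phi_y (x, y, t)) = 0"
  shows "(\<Sum>j\<le>k. of_real (real j * x ^ (j - 1)) * sum_part p j t) = 0"
    and "Im (\<Sum>j\<le>k. of_real (real j * x ^ (j - 1)) * diff_part p j t) = 0"
proof -
  define X where "X = Phi_x k p (x, y, t)"
  define \<mu> where "\<mu> = cis (- t) * X $ 1"
  have c: "X $ 2 * of_real x = X $ 3 * (\<i> * cis (- t))" "X $ 3 * cis t = X $ 1 * of_real x" "X $ 1 * (\<i> * cis (- t)) = X $ 2 * cis t"
    using arg_cong[OF 0, of "\<lambda>v. v $ 1"] arg_cong[OF 0, of "\<lambda>v. v $ 2"] arg_cong[OF 0, of "\<lambda>v. v $ 3"]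
    unfolding X_def[symmetric] conj_cross_def Phi_components vector_3 zero_index complex_cnj_zero_iff right_minus_eq .
  have "X $ 3 = of_real x * \<mu>"
    using arg_cong[OF c(2), of "\<lambda>z. z * cis (- t)"] by (simp add: \<mu>_def mult.assoc cis_mult)
  moreover have X2: "cis t * X $ 2 = \<i> * \<mu>" using c(3) by (simp add: \<mu>_def mult_ac)
  moreover have "hermitian X (Phi_y (x, y, t)) = cis (- t) * X $ 1 - \<i> * (cis t * X $ 2) + X $ 3 * of_real x"
    unfolding hermitian_def Phi_components by (simp add: cis_cnj mult_ac)
  ultimately have "hermitian X (Phi_y (x, y, t)) = of_real (2 + x\<^sup>2) * \<mu>"
    by (simp add: \<mu>_def[symmetric] algebra_simps power2_eq_square)
  then have "Im (of_real (2 + x\<^sup>2) * \<mu>) = 0"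
    using Phi_isotropic[OF assms(1,2), of "(x, y, t)"] by (simp add: X_def)
  then have "(2 + x\<^sup>2) * Im \<mu> = 0" by (simp only: Im_complex_of_real Re_complex_of_real times_complex.sel mult_zero_left add_0_right)
  moreover have "2 + x\<^sup>2 \<noteq> 0" by (metis add_nonneg_eq_0_iff zero_le_numeral zero_le_power2 zero_neq_numeral)
  ultimately have \<mu>: "Im \<mu> = 0" by simp
  have "(\<Sum>j\<le>k. of_real (real j * x ^ (j - 1)) * sum_part p j t) = cis (- t) * X $ 1 + \<i> * (cis t * X $ 2)"
    unfolding X_def Phi_components sum_part_def by (simp add: algebra_simps sum_distrib_left sum.distrib)
  then show "(\<Sum>j\<le>k. of_real (real j * x ^ (j - 1)) * sum_part p j t) = 0"
    by (simp add: X2 \<mu>_def[symmetric])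
  have "(\<Sum>j\<le>k. of_real (real j * x ^ (j - 1)) * diff_part p j t) = cis (- t) * X $ 1 - \<i> * (cis t * X $ 2)"
    unfolding X_def Phi_components diff_part_def by (simp add: algebra_simps sum_distrib_left sum_subtractf)
  then show "Im (\<Sum>j\<le>k. of_real (real j * x ^ (j - 1)) * diff_part p j t) = 0"
    using \<mu> by (simp add: X2 \<mu>_def[symmetric])
qed

lemma solution_shift: "solution k A B j (t + pi) = (- 1) ^ j *\<^sub>R solution k A B j t"
  by (simp add: solution_def mode_shift scaleR_right.sum)

lemma q_shift: "q1 (t + pi) = - q1 t" "q2 (t + pi) = q2 t"
  using cis_add_of_int_pi[of t 1] cis_add_of_int_pi[of "- t" "-1"]
  by (simp_all add: q1_def q2_def vec_eq_iff forall_3)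

lemma Phi_deck: "Phi k (solution k A B) (deck n z) = Phi k (solution k A B) z"
proof -
  have 1: "Phi k (solution k A B) (deck 1 z) = Phi k (solution k A B) z" for z
  proof -
    obtain x y t where z: "z = (x, y, t)" by (cases z)
    have "(- x) ^ j *\<^sub>R solution k A B j (t + pi) = x ^ j *\<^sub>R solution k A B j t" for j
      unfolding solution_shift by (simp flip: power_mult_distrib)
    then show ?thesis by (simp add: z deck_eq Phi_def q_shift)
  qed
  show ?thesis
  proof (induction n rule: int_induct[of _ 0])
    case base
    show ?case by (cases z) (simp add: deck_eq)
  next
    case (step1 i)
    then show ?case using 1[of "deck i z"] by (simp add: deck_add add.commute)
  next
    case (step2 i)
    then show ?case using 1[of "deck (i - 1) z"] by (simp add: deck_add)
  qed
qed

lemma Phi_descends: "\<exists>F. \<forall>z. F (proj z) = Phi k (solution k A B) z"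
proof
  show "\<forall>z. (\<lambda>c. Phi k (solution k A B) (SOME z. proj z = c)) (proj z) = Phi k (solution k A B) z"
  proof
    fix z
    have "proj (SOME z'. proj z' = proj z) = proj z" by (rule someI) simp
    then obtain n where "z = deck n (SOME z'. proj z' = proj z)" by (auto simp: proj_eq_iff)
    then show "(\<lambda>c. Phi k (solution k A B) (SOME z. proj z = c)) (proj z) = Phi k (solution k A B) z"
      by (metis Phi_deck)
  qed
qed

lemma trig_poly_solution: "\<xi> \<in> X \<Longrightarrow> trig_poly X (\<lambda>v. solution k A B j (\<xi> v) $ i)"
  unfolding solution_def sum_component by (intro trig_poly_sum trig_poly_mode)

lemma smooth_on_Phi: "smooth_on U (Phi k (solution k A B))"
  unfolding smooth_on_def
proof (intro allI Ck_on_vec3)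
  fix n and i :: 3
  let ?L = "{L. bounded_linear L} :: (real \<times> real \<times> real \<Rightarrow> real) set"
  have lin: "(\<lambda>z. fst z) \<in> ?L" "(\<lambda>z. fst (snd z)) \<in> ?L" "(\<lambda>z. snd (snd z)) \<in> ?L"
    by (intro CollectI bounded_linear_coordinates)+
  have q: "trig_poly ?L (\<lambda>z. q1 (snd (snd z)) $ i)" "trig_poly ?L (\<lambda>z. q2 (snd (snd z)) $ i)"
    using exhaust_3[of i] trig_poly.cis[OF lin(3), of 1] trig_poly.cis[OF lin(3), of "-1"]
    by (auto simp: q1_def q2_def intro: trig_poly.const trig_poly.mult[OF trig_poly.const])
  have "trig_poly ?L (\<lambda>z. (\<Sum>j\<le>k. of_real (fst z) ^ j * solution k A B j (snd (snd z)) $ i) +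
      of_real (fst (snd z)) * q1 (snd (snd z)) $ i + of_real (fst z) * of_real (fst (snd z)) * q2 (snd (snd z)) $ i)"
    by (intro trig_poly.add trig_poly.mult trig_poly_sum trig_poly_power trig_poly.coord[OF lin(1)] trig_poly.coord[OF lin(2)]
        trig_poly_solution lin(3) q)
  then show "Ck_on n U (\<lambda>z. Phi k (solution k A B) z $ i)"
    by (intro trig_poly_Ck_on) (simp add: Phi_def case_prod_beta scaleR_complex)
qed

lemma solution_properties:
  assumes "k \<ge> 1" "(A, B) \<in> parameters k"
  shows "evolves (solution k A B)" "isotropic k (solution k A B)" "solution k A B (k + 1) t = 0"
  using solution_is_solution[OF assms] unfolding is_solution_iff[OF assms(1)] by auto

lemma special_lagrangian_Phi:
  assumes k: "k \<ge> 1" and par: "(A, B) \<in> parameters k" and F: "\<And>z. F (proj z) = Phi k (solution k A B) z"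
  shows "special_lagrangian_3fold quotient_atlas F"
proof -
  define p where "p = solution k A B"
  define X where "X = Phi_x k p"
  define D where "D = (\<lambda>z. \<lambda>(u, v, w). u *\<^sub>R X z + v *\<^sub>R Phi_y z + w *\<^sub>R conj_cross (X z) (Phi_y z))"
  have F': "F (proj z) = Phi k p z" for z by (simp add: F p_def)
  have D: "(Phi k p has_derivative D z) (at z)" for z
    unfolding D_def X_def p_def
    by (intro Phi_has_derivative solution_properties[OF k par])
  have "smooth_into quotient_atlas F"
    unfolding quotient_atlas_def by (rule smooth_into_cover[where \<Phi> = "Phi k (solution k A B)", OF smooth_on_Phi]) (rule F)
  moreover have "\<exists>q\<in>U. immersed_at quotient_atlas F q" if U: "(U, \<phi>) \<in> quotient_atlas" "U \<noteq> {}" for U \<phi>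
  proof -
    obtain W where W: "U = proj ` W" "open W" "inj_on proj W"
      using U(1) unfolding quotient_atlas_def cover_atlas_def by auto
    then obtain x y t where "(x, y, t) \<in> W" using U(2) by auto
    have "open ((\<lambda>s. (x, s, t)) -` W)"
      using W(2) by (intro open_vimage) (auto intro!: continuous_intros)
    then obtain e where e: "e > 0" "ball y e \<subseteq> (\<lambda>s. (x, s, t)) -` W"
      using \<open>(x, y, t) \<in> W\<close> openE by (metis vimageI)
    then have "y + e / 2 \<in> ball y e" by (simp add: dist_real_def)
    then have "(x, y + e / 2, t) \<in> W" using e(2) by blast
    moreover have "y \<noteq> y + e / 2" using e(1) by simp
    ultimately obtain z where z: "z \<in> W" "conj_cross (X z) (Phi_y z) \<noteq> 0"
      using conj_cross_Phi_eq_0_unique[of k p x y t "y + e / 2"] \<open>(x, y, t) \<in> W\<close> unfolding X_def by blast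
    have "inj (D z)" unfolding D_def by (rule inj_span_conj_cross[OF z(2)])
    then have "immersed_at quotient_atlas F (proj z)"
      unfolding immersed_at_def quotient_atlas_def differential_at_cover[where F = F and \<pi> = proj and \<Phi> = "Phi k p", OF F'] using D z(1) W(2,3) by blast
    then show ?thesis using z(1) W(1) by blast
  qed
  moreover have "special_lagrangian_plane (range E)" if E: "differential_at quotient_atlas F q E" "inj E" for q E
  proof -
    obtain z where "(Phi k p has_derivative E) (at z)"
      using E(1) unfolding quotient_atlas_def differential_at_cover[where F = F and \<pi> = proj and \<Phi> = "Phi k p", OF F'] by blast
    then have ED: "E = D z" using D has_derivative_unique by blast
    show ?thesis unfolding ED
      by (rule special_lagrangian_plane_span[where X = "X z" and Y = "Phi_y z" and T = "conj_cross (X z) (Phi_y z)"])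
         (use E(2) in \<open>auto simp: D_def X_def ED p_def intro: Phi_isotropic[OF k solution_properties(2)[OF k par]]\<close>)
  qed
  ultimately show ?thesis unfolding special_lagrangian_3fold_def by blast
qed

lemma immersion_Phi:
  assumes k: "k \<ge> 1" and par: "(A, B) \<in> parameters k" and F: "\<And>z. F (proj z) = Phi k (solution k A B) z"
    and reg: "\<And>z. conj_cross (Phi_x k (solution k A B) z) (Phi_y z) \<noteq> 0"
  shows "immersion quotient_atlas F"
  unfolding immersion_def
proof (intro conjI ballI)
  show "smooth_into quotient_atlas F"
    unfolding quotient_atlas_def by (rule smooth_into_cover[where \<Phi> = "Phi k (solution k A B)", OF smooth_on_Phi]) (rule F)
  fix q assume "q \<in> atlas_carrier quotient_atlas"
  then obtain z where q: "q = proj z"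
    unfolding quotient_atlas_def atlas_carrier_cover[OF locally_injective_proj] by blast
  obtain W where "open W" "z \<in> W" "inj_on proj W" using locally_injective_proj unfolding locally_injective_def by blast
  then show "immersed_at quotient_atlas F q"
    unfolding immersed_at_def quotient_atlas_def differential_at_cover[where F = F and \<pi> = proj and \<Phi> = "Phi k (solution k A B)", OF F] q
    using Phi_has_derivative[OF solution_properties(1)[OF k par] solution_properties(3)[OF k par], of z] inj_span_conj_cross[OF reg[of z]]
    by blast
qed

lemma sum_part_mode: "sum_part (mode A B l) j t = mode_s A B l j t"
  by (simp add: sum_part_def mode_def field_simps cis_cancel)

lemma diff_part_mode: "diff_part (mode A B l) j t = mode_d A B l j t"
  by (simp add: diff_part_def mode_def field_simps cis_cancel)

lemma sum_part_solution: "sum_part (solution k A B) j t = (\<Sum>l = 1..k. mode_s (A l) (reduced A B l) l j t)"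
  unfolding sum_part_mode[symmetric] sum_part_def solution_def sum_component
  by (simp add: sum_distrib_left sum.distrib)

lemma diff_part_solution: "diff_part (solution k A B) j t = (\<Sum>l = 1..k. mode_d (A l) (reduced A B l) l j t)"
  unfolding diff_part_mode[symmetric] diff_part_def solution_def sum_component
  by (simp add: sum_distrib_left sum_subtractf)

section \<open>Closedness of the image\<close>

lemma Phi_sum_part:
  "cis (- t) * Phi k p (x, y, t) $ 1 + \<i> * cis t * Phi k p (x, y, t) $ 2 = (\<Sum>j\<le>k. of_real (x ^ j) * sum_part p j t)"
  unfolding Phi_def sum_part_def
  by (simp add: q1_def q2_def scaleR_complex algebra_simps sum_distrib_left sum.distrib cis_cancel)

lemma Phi_diff_part:
  "cis (- t) * Phi k p (x, y, t) $ 1 - \<i> * cis t * Phi k p (x, y, t) $ 2 =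
     (\<Sum>j\<le>k. of_real (x ^ j) * diff_part p j t) + 2 * of_real y"
  unfolding Phi_def diff_part_def
  by (simp add: q1_def q2_def scaleR_complex algebra_simps sum_distrib_left sum_subtractf cis_cancel)

lemma leading_term_bound:
  fixes f :: "nat \<Rightarrow> complex" and x :: real
  assumes "k \<ge> 1" and e: "e > 0" "e \<le> cmod (f k)" and C: "\<And>j. j \<le> k \<Longrightarrow> cmod (f j) \<le> C"
    and M: "cmod (\<Sum>j\<le>k. of_real (x ^ j) * f j) \<le> M"
  shows "\<bar>x\<bar> \<le> 1 + (M + real k * C) / e"
proof (cases "\<bar>x\<bar> \<le> 1")
  case True
  have "C \<ge> 0" using C[of 0] norm_ge_zero[of "f 0"] by linarith
  moreover have "M \<ge> 0" using M norm_ge_zero order_trans by blast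
  ultimately show ?thesis using True e(1) by (smt (verit) divide_nonneg_pos mult_nonneg_nonneg of_nat_0_le_iff)
next
  case False
  have C0: "C \<ge> 0" using C[of 0] norm_ge_zero[of "f 0"] by linarith
  have M0: "M \<ge> 0" using M norm_ge_zero order_trans by blast
  obtain m where m: "k = Suc m" using assms(1) by (cases k) auto
  have x1: "\<bar>x\<bar> ^ j \<le> \<bar>x\<bar> ^ m" if "j \<le> m" for j using False that by (intro power_increasing) auto
  have "(\<Sum>j\<le>k. of_real (x ^ j) * f j) = (\<Sum>j\<le>m. of_real (x ^ j) * f j) + of_real (x ^ k) * f k"
    by (simp add: m)
  then have "cmod (of_real (x ^ k) * f k) \<le> M + cmod (\<Sum>j\<le>m. of_real (x ^ j) * f j)"
    using M norm_triangle_ineq4[of "\<Sum>j\<le>k. of_real (x ^ j) * f j" "\<Sum>j\<le>m. of_real (x ^ j) * f j"] by simp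
  also have "cmod (\<Sum>j\<le>m. of_real (x ^ j) * f j) \<le> (\<Sum>j\<le>m. \<bar>x\<bar> ^ m * C)"
    using x1 C by (intro sum_norm_le) (auto simp: norm_mult norm_power m intro!: mult_mono)
  also have "\<dots> = real k * C * \<bar>x\<bar> ^ m" by (simp add: m algebra_simps)
  also have "M \<le> M * \<bar>x\<bar> ^ m"
    using M0 x1[of 0] by (simp add: mult_le_cancel_left1)
  finally have "\<bar>x\<bar> ^ k * cmod (f k) \<le> (M + real k * C) * \<bar>x\<bar> ^ m"
    by (simp add: norm_mult norm_power algebra_simps)
  then have "\<bar>x\<bar> ^ m * (\<bar>x\<bar> * cmod (f k)) \<le> \<bar>x\<bar> ^ m * (M + real k * C)" by (simp add: m mult_ac)
  then have "\<bar>x\<bar> * cmod (f k) \<le> M + real k * C"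
    by (rule mult_left_le_imp_le) (use False in auto)
  moreover have "\<bar>x\<bar> * e \<le> \<bar>x\<bar> * cmod (f k)" using e by (intro mult_left_mono) auto
  ultimately have "\<bar>x\<bar> * e \<le> M + real k * C" by linarith
  then have "\<bar>x\<bar> \<le> (M + real k * C) / e" using e(1) by (simp add: pos_le_divide_eq)
  then show ?thesis by simp
qed

text \<open>
  The combination \<open>sum_part\<close> of the first two components does not contain \<open>y\<close>. As its leading
  coefficient in \<open>x\<close> has no zero, a bound on the image bounds \<open>x\<close>; the combination \<open>diff_part\<close>
  then bounds \<open>y\<close>, and \<open>t\<close> can be taken in a period. So a bounded part of the image is the image of a compact box.
\<close>

lemma closed_range_Phi:
  assumes k: "k \<ge> 1" and ev: "evolves p" and per: "\<And>n z. Phi k p (deck n z) = Phi k p z"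
    and cont: "continuous_on UNIV (Phi k p)" and nz: "\<And>t. sum_part p k t \<noteq> 0"
  shows "closed (range (Phi k p))"
proof -
  have "continuous_on UNIV (p j)" for j
    using ev unfolding evolves_iff by (auto intro!: continuous_at_imp_continuous_on has_vector_derivative_continuous)
  then have pc: "continuous_on {0..pi} (\<lambda>t. p j t $ i)" for j i
    by (intro continuous_on_component) (auto intro: continuous_on_subset)
  have cont_s: "continuous_on {0..pi} (sum_part p j)" "continuous_on {0..pi} (diff_part p j)" for j
    unfolding sum_part_def diff_part_def by (intro continuous_intros pc)+
  have "\<exists>C. \<forall>t\<in>{0..pi}. cmod (f t) \<le> C" if "continuous_on {0..pi} f" for f
    using compact_imp_bounded[OF compact_continuous_image[OF that]] by (auto simp: bounded_iff)
  then have "\<forall>j. \<exists>C. \<forall>t\<in>{0..pi}. cmod (sum_part p j t) \<le> C" "\<forall>j. \<exists>C. \<forall>t\<in>{0..pi}. cmod (diff_part p j t) \<le> C"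
    using cont_s by blast+
  then obtain C1 C2 where C: "\<And>j t. t \<in> {0..pi} \<Longrightarrow> cmod (sum_part p j t) \<le> C1 j"
    "\<And>j t. t \<in> {0..pi} \<Longrightarrow> cmod (diff_part p j t) \<le> C2 j" by metis
  define C where "C = Max (C1 ` {..k})"
  have C1: "cmod (sum_part p j t) \<le> C" if "j \<le> k" "t \<in> {0..pi}" for j t
    using C(1)[OF that(2), of j] that(1) unfolding C_def by (intro order_trans[OF _ Max_ge]) auto
  have "\<exists>s\<in>{0..pi}. \<forall>t\<in>{0..pi}. cmod (sum_part p k s) \<le> cmod (sum_part p k t)"
    by (rule continuous_attains_inf) (auto intro: continuous_on_norm cont_s)
  then obtain s where s: "s \<in> {0..pi}" "\<And>t. t \<in> {0..pi} \<Longrightarrow> cmod (sum_part p k s) \<le> cmod (sum_part p k t)"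
    by blast
  define e where "e = cmod (sum_part p k s)"
  have e: "e > 0" "\<And>t. t \<in> {0..pi} \<Longrightarrow> e \<le> cmod (sum_part p k t)" using nz s by (auto simp: e_def)
  have bound: "\<exists>R R'. \<forall>x y t. t \<in> {0..pi} \<longrightarrow> norm (Phi k p (x, y, t)) \<le> M \<longrightarrow> \<bar>x\<bar> \<le> R \<and> \<bar>y\<bar> \<le> R'" for M
  proof -
    define R where "R = 1 + (2 * M + real k * C) / e"
    define R' where "R' = 2 * M + (\<Sum>j\<le>k. \<bar>R\<bar> ^ j * C2 j)"
    have "\<bar>x\<bar> \<le> R \<and> \<bar>y\<bar> \<le> R'" if t: "t \<in> {0..pi}" and M: "norm (Phi k p (x, y, t)) \<le> M" for x y t
    proof -
      have c: "cmod (Phi k p (x, y, t) $ i) \<le> M" for i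
        using M Finite_Cartesian_Product.norm_nth_le[of "Phi k p (x, y, t)" i] by linarith
      have "cmod (\<Sum>j\<le>k. of_real (x ^ j) * sum_part p j t) \<le> 2 * M"
        unfolding Phi_sum_part[of t k p x y, symmetric] using c[of 1] c[of 2]
          norm_triangle_ineq[of "cis (- t) * Phi k p (x, y, t) $ 1" "\<i> * cis t * Phi k p (x, y, t) $ 2"]
        by (simp add: norm_mult)
      then have x: "\<bar>x\<bar> \<le> R" unfolding R_def
        using k e t C1 by (intro leading_term_bound[of k e "\<lambda>j. sum_part p j t"]) auto
      have "cmod ((\<Sum>j\<le>k. of_real (x ^ j) * diff_part p j t) + 2 * of_real y) \<le> 2 * M"
        unfolding Phi_diff_part[of t k p x y, symmetric] using c[of 1] c[of 2]
          norm_triangle_ineq4[of "cis (- t) * Phi k p (x, y, t) $ 1" "\<i> * cis t * Phi k p (x, y, t) $ 2"]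
        by (simp add: norm_mult)
      moreover have "cmod (\<Sum>j\<le>k. of_real (x ^ j) * diff_part p j t) \<le> (\<Sum>j\<le>k. \<bar>R\<bar> ^ j * C2 j)"
        using x C(2)[OF t] by (intro sum_norm_le) (auto simp: norm_mult norm_power intro!: mult_mono power_mono)
      moreover have "cmod (2 * of_real y) \<le> cmod ((\<Sum>j\<le>k. of_real (x ^ j) * diff_part p j t) + 2 * of_real y) +
          cmod (\<Sum>j\<le>k. of_real (x ^ j) * diff_part p j t)"
        using norm_triangle_ineq4[of "(\<Sum>j\<le>k. of_real (x ^ j) * diff_part p j t) + 2 * of_real y" "\<Sum>j\<le>k. of_real (x ^ j) * diff_part p j t"] by simp
      moreover have "cmod (2 * of_real y) = 2 * \<bar>y\<bar>" by (simp add: norm_mult)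
      ultimately have "\<bar>y\<bar> \<le> R'" unfolding R'_def by linarith
      with x show ?thesis ..
    qed
    then show ?thesis by blast
  qed
  have period: "\<exists>x y t. t \<in> {0..pi} \<and> Phi k p z = Phi k p (x, y, t)" for z
  proof -
    obtain x y t where z: "z = (x, y, t)" by (cases z)
    define n where "n = - \<lfloor>t / pi\<rfloor>"
    have "t + of_int n * pi \<in> {0..pi}"
      using floor_divide_lower[of pi t] floor_divide_upper[of pi t] by (simp add: n_def algebra_simps)
    moreover obtain x' y' where "deck n z = (x', y', t + of_int n * pi)"
      by (cases "even n") (auto simp: z deck_eq)
    ultimately show ?thesis using per[of n z] by metis
  qed
  show ?thesis
    unfolding closed_sequential_limits
  proof (intro allI impI, elim conjE)
    fix f l assume f: "\<forall>n. f n \<in> range (Phi k p)" "f \<longlonglongrightarrow> l"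
    obtain M where M: "\<And>n. norm (f n) \<le> M"
      using convergent_imp_bounded[OF f(2)] by (auto simp: bounded_iff)
    obtain R R' where R: "\<And>x y t. t \<in> {0..pi} \<Longrightarrow> norm (Phi k p (x, y, t)) \<le> M \<Longrightarrow> \<bar>x\<bar> \<le> R \<and> \<bar>y\<bar> \<le> R'"
      using bound[of M] by blast
    define Q where "Q = {- R..R} \<times> {- R'..R'} \<times> {0..pi}"
    have "compact Q" unfolding Q_def by (intro compact_Times compact_Icc)
    then have "closed (Phi k p ` Q)"
      using cont by (intro compact_imp_closed compact_continuous_image) (auto intro: continuous_on_subset)
    moreover have "f n \<in> Phi k p ` Q" for n
    proof -
      obtain x y t where xyt: "t \<in> {0..pi}" "f n = Phi k p (x, y, t)" using f(1) period by (metis rangeE)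
      then have "(x, y, t) \<in> Q" using R[of t x y] M[of n] by (auto simp: Q_def abs_le_iff)
      then show ?thesis using xyt(2) by blast
    qed
    ultimately have "l \<in> Phi k p ` Q" using f(2) closed_sequentially by blast
    then show "l \<in> range (Phi k p)" by blast
  qed
qed

section \<open>Non-generic parameters\<close>

text \<open>
  The coefficients of the waves in the equations of a singular point. A factor \<open>x\<close> is divided out of
  \<open>Im_weight\<close>, as the equation for \<open>Im d\<close> is void for \<open>x = 0\<close>.
\<close>

definition Re_weight :: "nat \<Rightarrow> real \<Rightarrow> nat \<Rightarrow> real" where
  "Re_weight k x l = (\<Sum>j\<le>k. real j * x ^ (j - 1) * coef (- 1) j l)"

definition Im_weight :: "nat \<Rightarrow> real \<Rightarrow> nat \<Rightarrow> real" where
  "Im_weight k x l = (\<Sum>j\<le>k. real j * (real j - 1) * x ^ (j - 2) * coef (- 1) j l / (real l - 1))"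

definition reduced_weight :: "nat \<Rightarrow> real \<Rightarrow> nat \<Rightarrow> real" where
  "reduced_weight k x l = (\<Sum>j\<le>k. real j * x ^ (j - 1) * coef 1 j l)"

lemma sum_coef_atMost:
  "l \<le> k \<Longrightarrow> (\<Sum>j\<le>k. f j * coef e j l) = (\<Sum>j\<le>l. f j * coef e j l)"
  by (intro sum.mono_neutral_right) (auto simp: coef_less)

lemma coef_3: "coef (- 1) (Suc 0) 3 = 6" "coef (- 1) 2 3 = 0" "coef (- 1) 3 3 = 2"
proof -
  show "coef (- 1) (Suc 0) 3 = 6" using coef_rec[of 3 1 "-1"] coef_diag[of "-1" 3] by (simp add: numeral_3_eq_3)
  show "coef (- 1) 2 3 = 0" by (rule coef_parity) simp
  show "coef (- 1) 3 3 = 2" by (rule coef_diag)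
qed

lemma Re_weight_3: "k \<ge> 3 \<Longrightarrow> Re_weight k x 3 = 6 * (1 + x\<^sup>2)"
  unfolding Re_weight_def
  by (subst sum_coef_atMost) (simp_all add: numeral_3_eq_3 coef_3[unfolded numeral_3_eq_3 numeral_2_eq_2] power2_eq_square)

lemma Im_weight_3: "k \<ge> 3 \<Longrightarrow> Im_weight k x 3 = 6 * x"
proof -
  assume "k \<ge> 3"
  then have "(\<Sum>j\<le>k. real j * (real j - 1) * x ^ (j - 2) * coef (- 1) j 3) = 12 * x"
    by (subst sum_coef_atMost) (simp_all add: numeral_3_eq_3 coef_3[unfolded numeral_3_eq_3 numeral_2_eq_2])
  then show ?thesis unfolding Im_weight_def by (simp flip: sum_divide_distrib)
qed

lemma reduced_weight_1: "k \<ge> 1 \<Longrightarrow> reduced_weight k x 1 = 2"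
  unfolding reduced_weight_def by (subst sum_coef_atMost) (simp_all add: coef_diag)

text \<open>
  The conditions on \<open>sum_part\<close> and \<open>diff_part\<close>, with the modes inserted. The first and the last equation
  only involve \<open>A\<close> and the second only the reduced parameters, because the two kinds of
  amplitudes enter different real components.
\<close>

lemma singular_equations:
  assumes k: "k \<ge> 1" and par: "(A, B) \<in> parameters k"
    and 0: "conj_cross (Phi_x k (solution k A B) (x, y, t)) (Phi_y (x, y, t)) = 0"
  shows "(\<Sum>l = 1..k. Re_weight k x l * Re (wave (- 1) (A l) l t)) = 0"
    and "(\<Sum>l = 1..k. reduced_weight k x l * Im (wave 1 (reduced A B l) l t)) = 0"
    and "x * (\<Sum>l = 1..k. Im_weight k x l * Im (wave (- 1) (A l) l t)) = 0"
proof -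
  note c = conj_cross_Phi_eq_0_conditions[OF k solution_properties(2)[OF k par] 0]
  have swap: "(\<Sum>j\<le>k. f j * (\<Sum>l = 1..k. g j l * h l)) = (\<Sum>l = 1..k. (\<Sum>j\<le>k. f j * g j l) * h l)"
    for f :: "nat \<Rightarrow> real" and g h
    unfolding sum_distrib_left sum_distrib_right by (subst sum.swap) (simp add: mult_ac)
  have "(\<Sum>j\<le>k. real j * x ^ (j - 1) * (\<Sum>l = 1..k. coef (- 1) j l * Re (wave (- 1) (A l) l t))) = 0"
    using arg_cong[OF c(1), of Re] by (simp add: sum_part_solution Re_sum mode_s_def flip: of_real_power of_real_mult)
  then show "(\<Sum>l = 1..k. Re_weight k x l * Re (wave (- 1) (A l) l t)) = 0"
    unfolding swap Re_weight_def .
  have "(\<Sum>j\<le>k. real j * x ^ (j - 1) * (\<Sum>l = 1..k. coef 1 j l * Im (wave 1 (reduced A B l) l t))) = 0"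
    using arg_cong[OF c(1), of Im] by (simp add: sum_part_solution Im_sum mode_s_def flip: of_real_power of_real_mult)
  then show "(\<Sum>l = 1..k. reduced_weight k x l * Im (wave 1 (reduced A B l) l t)) = 0"
    unfolding swap reduced_weight_def .
  have "(\<Sum>j\<le>k. real j * x ^ (j - 1) * (\<Sum>l = 1..k. (coef (- 1) j l * (real j - 1) / (real l - 1)) * Im (wave (- 1) (A l) l t))) = 0"
    using c(2) by (simp add: diff_part_solution Im_sum mode_d_def flip: of_real_power of_real_mult)
  then have "(\<Sum>l = 1..k. (\<Sum>j\<le>k. real j * x ^ (j - 1) * (coef (- 1) j l * (real j - 1) / (real l - 1))) * Im (wave (- 1) (A l) l t)) = 0"
    unfolding swap .
  moreover have "(\<Sum>j\<le>k. real j * x ^ (j - 1) * (coef (- 1) j l * (real j - 1) / (real l - 1))) = x * Im_weight k x l" for l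
    unfolding Im_weight_def sum_distrib_left
  proof (intro sum.cong refl)
    fix j
    show "real j * x ^ (j - 1) * (coef (- 1) j l * (real j - 1) / (real l - 1)) =
        x * (real j * (real j - 1) * x ^ (j - 2) * coef (- 1) j l / (real l - 1))"
    proof (cases "j \<le> 1")
      case True
      then have "j = 0 \<or> j = 1" by auto
      then show ?thesis by auto
    next
      case False
      then obtain m where "j = Suc (Suc m)" by (metis One_nat_def not_less_eq_eq Suc_le_D le_SucE nat_le_linear)
      then show ?thesis by (simp add: mult_ac)
    qed
  qed
  ultimately have "(\<Sum>l = 1..k. x * Im_weight k x l * Im (wave (- 1) (A l) l t)) = 0"
    by (simp only:)
  then show "x * (\<Sum>l = 1..k. Im_weight k x l * Im (wave (- 1) (A l) l t)) = 0"
    by (simp only: sum_distrib_left mult.assoc)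
qed

definition nongeneric_parameters :: "nat \<Rightarrow> ((nat \<Rightarrow> complex) \<times> (nat \<Rightarrow> complex)) set" where
  "nongeneric_parameters k = {(A, B) \<in> parameters k.
     (\<exists>z. conj_cross (Phi_x k (solution k A B) z) (Phi_y z) = 0) \<or> (\<exists>t. sum_part (solution k A B) k t = 0)}"

text \<open>
  The families below have three distinguished real coordinates and \<open>2 k - 4\<close> unrestricted complex ones,
  altogether \<open>4 k - 5\<close> real coordinates.
\<close>

definition free :: "(nat \<Rightarrow> real) \<Rightarrow> nat \<Rightarrow> complex" where
  "free v i = Complex (v (3 + 2 * i)) (v (4 + 2 * i))"

lemma free_coordinates:
  assumes "k \<ge> 3"
  shows "\<exists>v\<in>topspace (Euclidean_space ((4 * k - 4) - 1)).
    v 0 = a \<and> v 1 = b \<and> v 2 = c \<and> (\<forall>i<2 * k - 4. free v i = z i)"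
proof -
  define v where "v = (\<lambda>i. if i = 0 then a else if i = 1 then b else if i = 2 then c else if i < (4 * k - 4) - 1
     then (if odd i then Re (z ((i - 3) div 2)) else Im (z ((i - 4) div 2))) else 0)"
  have "v \<in> topspace (Euclidean_space ((4 * k - 4) - 1))"
    using assms by (auto simp: topspace_Euclidean_space v_def)
  moreover have "free v i = z i" if "i < 2 * k - 4" for i
  proof -
    have "3 + 2 * i < (4 * k - 4) - 1" "4 + 2 * i < (4 * k - 4) - 1" using that assms by auto
    then show ?thesis by (simp add: free_def v_def)
  qed
  moreover have "v 0 = a" "v 1 = b" "v 2 = c" by (simp_all add: v_def)
  ultimately show ?thesis by blast
qed

text \<open>
  The inverse of the passage from \<open>B\<close> to the reduced parameters \<open>b\<close>.
\<close>

definition restored :: "nat \<Rightarrow> (nat \<Rightarrow> complex) \<Rightarrow> (nat \<Rightarrow> complex) \<Rightarrow> (nat \<Rightarrow> complex) \<times> (nat \<Rightarrow> complex)" where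
  "restored k A b = (A, \<lambda>l. if l \<in> {1..k} then b l + of_real ((real l + 2) / (2 * real l)) * cnj (A (l + 2)) else 0)"

lemma restored_reduced:
  assumes "(A, B) \<in> parameters k" "\<And>l. A l = A' l" "\<And>l. l \<in> {1..k} \<Longrightarrow> reduced A B l = b l"
  shows "restored k A' b = (A, B)"
proof -
  have "A' = A" using assms(2) by auto
  moreover have "(if l \<in> {1..k} then b l + of_real ((real l + 2) / (2 * real l)) * cnj (A (l + 2)) else 0) = B l" for l
    using assms(3)[of l] parameters_cases(3)[OF assms(1), of l] by (auto simp: reduced_def algebra_simps)
  ultimately show ?thesis by (simp add: restored_def)
qed

text \<open>
  The leading coefficient of \<open>sum_part\<close> vanishes at \<open>t = v 0\<close> if the wave of \<open>A k\<close> is imaginary and that of \<open>B k\<close>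
  real at this \<open>t\<close>; \<open>v 1\<close> and \<open>v 2\<close> are their values.
\<close>

definition leading_zero_family :: "nat \<Rightarrow> (nat \<Rightarrow> real) \<Rightarrow> (nat \<Rightarrow> complex) \<times> (nat \<Rightarrow> complex)" where
  "leading_zero_family k v = restored k
     (\<lambda>l. if 3 \<le> l \<and> l < k then free v (l - 3) else if l = k then \<i> * of_real (v 1) * cis (- (real k - 1) * v 0) else 0)
     (\<lambda>l. if l = k then of_real (v 2) * cis ((real k + 1) * v 0) else free v (k + l - 4))"

text \<open>
  Parameters with a singular point at \<open>x\<close> and \<open>t = v 0\<close>. The wave of \<open>A 3\<close> has real part solved from the equation
  with \<open>Re_weight\<close> and imaginary part \<open>\<sigma>\<close>; the wave of the first reduced parameter has real
  part \<open>v 2\<close> and imaginary part solved from the equation with \<open>reduced_weight\<close>. As the weight of \<open>A 3\<close> is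
  \<open>6 * (1 + x\<^sup>2)\<close>, respectively \<open>6 * x\<close>, the other \<open>A l\<close> are written as multiples of \<open>\<mu> * (1 + x\<^sup>2)\<close>, which makes
  the solutions polynomial in \<open>x\<close>: for \<open>x \<noteq> 0\<close> the choice \<open>\<mu> = x\<close> serves both equations, and for \<open>x = 0\<close>,
  where \<open>\<sigma>\<close> is a coordinate, \<open>\<mu> = 1\<close>.
\<close>

definition singular_family ::
    "nat \<Rightarrow> (nat \<Rightarrow> real) \<Rightarrow> real \<Rightarrow> real \<Rightarrow> real \<Rightarrow> (nat \<Rightarrow> complex) \<times> (nat \<Rightarrow> complex)" where
  "singular_family k v x \<mu> \<sigma> = restored k
     (\<lambda>l. if l = 3 then Complex (- \<mu> / 6 * (\<Sum>l = 4..k. Re_weight k x l * Re (wave (- 1) (free v (l - 4)) l (v 0)))) \<sigma>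
            * cis (- 2 * v 0)
          else if 4 \<le> l \<and> l \<le> k then of_real (\<mu> * (1 + x\<^sup>2)) * free v (l - 4) else 0)
     (\<lambda>l. if l = 1 then Complex (v 2) (- 1 / 2 * (\<Sum>l = 2..k. reduced_weight k x l * Im (wave 1 (free v (k + l - 5)) l (v 0))))
            * cis (2 * v 0)
          else free v (k + l - 5))"

lemma coords_memI: "i < d \<Longrightarrow> (\<lambda>v. v i) \<in> coords d"
  by (auto simp: coords_def)

lemma trig_poly_if:
  "(P \<Longrightarrow> trig_poly X f) \<Longrightarrow> (\<not> P \<Longrightarrow> trig_poly X g) \<Longrightarrow> trig_poly X (\<lambda>v. if P then f v else g v)"
  by (cases P) simp_all

lemma trig_poly_free:
  assumes "k \<ge> 3" "i < 2 * k - 4"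
  shows "trig_poly (coords ((4 * k - 4) - 1)) (\<lambda>v. free v i)"
  unfolding free_def by (intro trig_poly_Complex trig_poly.coord coords_memI) (use assms in auto)

lemma trig_poly_weight:
  assumes "trig_poly X (\<lambda>v. of_real (x v))"
  shows "trig_poly X (\<lambda>v. of_real (Re_weight k (x v) l))" "trig_poly X (\<lambda>v. of_real (Im_weight k (x v) l))"
    "trig_poly X (\<lambda>v. of_real (reduced_weight k (x v) l))"
  unfolding Re_weight_def Im_weight_def reduced_weight_def of_real_sum of_real_mult of_real_power of_real_divide divide_complex_def
  by (intro trig_poly_sum trig_poly.mult trig_poly.const trig_poly_power assms)+

lemma trig_poly_restored:
  assumes "\<And>l. trig_poly X (\<lambda>v. A v l)" "\<And>l. l \<in> {1..k} \<Longrightarrow> trig_poly X (\<lambda>v. b v l)"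
  shows "trig_poly X (\<lambda>v. fst (restored k (A v) (b v)) l)" "trig_poly X (\<lambda>v. snd (restored k (A v) (b v)) l)"
proof -
  show "trig_poly X (\<lambda>v. fst (restored k (A v) (b v)) l)" unfolding restored_def by (simp add: assms)
  show "trig_poly X (\<lambda>v. snd (restored k (A v) (b v)) l)"
    unfolding restored_def snd_conv
    by (cases "l \<in> {1..k}") (simp_all only: if_True if_False trig_poly.add trig_poly.mult trig_poly.const trig_poly.cnj assms)
qed

lemma trig_poly_leading_zero_family:
  assumes k: "k \<ge> 3"
  shows "trig_poly (coords ((4 * k - 4) - 1)) (\<lambda>v. fst (leading_zero_family k v) l)"
    "trig_poly (coords ((4 * k - 4) - 1)) (\<lambda>v. snd (leading_zero_family k v) l)"
proof -
  let ?X = "coords ((4 * k - 4) - 1)"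
  have c: "(\<lambda>v. v 0) \<in> ?X" "(\<lambda>v. v 1) \<in> ?X" "(\<lambda>v. v 2) \<in> ?X"
    using k by (auto intro!: coords_memI)
  have A: "trig_poly ?X (\<lambda>v. if 3 \<le> l \<and> l < k then free v (l - 3)
      else if l = k then \<i> * of_real (v 1) * cis (- (real k - 1) * v 0) else 0)" for l
  proof -
    have "trig_poly ?X (\<lambda>v. \<i> * of_real (v 1) * cis (- (real k - 1) * v 0))"
      by (intro trig_poly.mult trig_poly.const trig_poly.coord trig_poly.cis c)
    moreover have "trig_poly ?X (\<lambda>v. free v (l - 3))" if "3 \<le> l" "l < k"
      using that by (intro trig_poly_free k) auto
    ultimately show ?thesis by (intro trig_poly_if trig_poly.const) auto
  qed
  have b: "trig_poly ?X (\<lambda>v. if l = k then of_real (v 2) * cis ((real k + 1) * v 0) else free v (k + l - 4))"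
    if "l \<in> {1..k}" for l
  proof -
    have "trig_poly ?X (\<lambda>v. of_real (v 2) * cis ((real k + 1) * v 0))"
      by (intro trig_poly.mult trig_poly.const trig_poly.coord trig_poly.cis c)
    moreover have "trig_poly ?X (\<lambda>v. free v (k + l - 4))" if "l \<noteq> k"
      using that \<open>l \<in> {1..k}\<close> k by (intro trig_poly_free k) auto
    ultimately show ?thesis by (intro trig_poly_if) auto
  qed
  show "trig_poly ?X (\<lambda>v. fst (leading_zero_family k v) l)" "trig_poly ?X (\<lambda>v. snd (leading_zero_family k v) l)"
    unfolding leading_zero_family_def
    by (rule trig_poly_restored(1), rule A, erule b) (rule trig_poly_restored(2), rule A, erule b)
qed

lemma trig_poly_singular_family:
  fixes x \<mu> \<sigma> :: "(nat \<Rightarrow> real) \<Rightarrow> real"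
  assumes k: "k \<ge> 3" and x: "trig_poly (coords ((4 * k - 4) - 1)) (\<lambda>v. of_real (x v))"
    and \<mu>: "trig_poly (coords ((4 * k - 4) - 1)) (\<lambda>v. of_real (\<mu> v))"
    and \<sigma>: "trig_poly (coords ((4 * k - 4) - 1)) (\<lambda>v. of_real (\<sigma> v))"
  shows "trig_poly (coords ((4 * k - 4) - 1)) (\<lambda>v. fst (singular_family k v (x v) (\<mu> v) (\<sigma> v)) l)"
    "trig_poly (coords ((4 * k - 4) - 1)) (\<lambda>v. snd (singular_family k v (x v) (\<mu> v) (\<sigma> v)) l)"
proof -
  let ?X = "coords ((4 * k - 4) - 1)"
  have c: "(\<lambda>v. v 0) \<in> ?X" "(\<lambda>v. v 2) \<in> ?X"
    using k by (auto intro!: coords_memI)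
  have A3: "trig_poly ?X (\<lambda>v. Complex (- \<mu> v / 6 * (\<Sum>l = 4..k. Re_weight k (x v) l * Re (wave (- 1) (free v (l - 4)) l (v 0)))) (\<sigma> v)
            * cis (- 2 * v 0))"
    unfolding divide_inverse of_real_mult of_real_sum of_real_minus
    by (intro trig_poly.mult trig_poly_Complex trig_poly.cis c \<sigma>)
      (unfold of_real_mult of_real_sum of_real_minus,
        intro trig_poly.mult trig_poly_uminus \<mu> trig_poly.const trig_poly_sum trig_poly_weight x trig_poly_Re trig_poly_wave c trig_poly_free k, auto)
  have A4: "trig_poly ?X (\<lambda>v. of_real (\<mu> v * (1 + (x v)\<^sup>2)) * free v (l - 4))" if "4 \<le> l" "l \<le> k" for l
    unfolding of_real_mult of_real_add of_real_power
    by (intro trig_poly.mult \<mu> trig_poly.add trig_poly.const trig_poly_power x trig_poly_free k) (use that in auto)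
  have A: "trig_poly ?X (\<lambda>v. if l = 3 then Complex (- \<mu> v / 6 * (\<Sum>l = 4..k. Re_weight k (x v) l * Re (wave (- 1) (free v (l - 4)) l (v 0)))) (\<sigma> v)
            * cis (- 2 * v 0)
          else if 4 \<le> l \<and> l \<le> k then of_real (\<mu> v * (1 + (x v)\<^sup>2)) * free v (l - 4) else 0)" for l
    by (intro trig_poly_if trig_poly.const A3 A4) auto
  have b1: "trig_poly ?X (\<lambda>v. Complex (v 2) (- 1 / 2 * (\<Sum>l = 2..k. reduced_weight k (x v) l * Im (wave 1 (free v (k + l - 5)) l (v 0))))
            * cis (2 * v 0))"
    by (intro trig_poly.mult trig_poly_Complex[OF trig_poly.coord[OF c(2)]] trig_poly.cis c)
      (unfold of_real_mult of_real_sum of_real_minus,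
        intro trig_poly.mult trig_poly.const trig_poly_sum trig_poly_weight x trig_poly_Im trig_poly_wave c trig_poly_free k, insert k, auto)
  have b: "trig_poly ?X (\<lambda>v. if l = 1 then Complex (v 2) (- 1 / 2 * (\<Sum>l = 2..k. reduced_weight k (x v) l * Im (wave 1 (free v (k + l - 5)) l (v 0))))
            * cis (2 * v 0) else free v (k + l - 5))" if "l \<in> {1..k}" for l
  proof (cases "l = 1")
    case False
    then have "trig_poly ?X (\<lambda>v. free v (k + l - 5))" using that k by (intro trig_poly_free k) auto
    then show ?thesis using False by simp
  qed (use b1 in simp)
  show "trig_poly ?X (\<lambda>v. fst (singular_family k v (x v) (\<mu> v) (\<sigma> v)) l)"
    "trig_poly ?X (\<lambda>v. snd (singular_family k v (x v) (\<mu> v) (\<sigma> v)) l)"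
    unfolding singular_family_def
    by (rule trig_poly_restored(1), rule A, erule b) (rule trig_poly_restored(2), rule A, erule b)
qed

lemma wave_inverse: "z = wave e z l t * cis (e * (real l + e) * t)"
  by (simp add: wave_def mult.assoc cis_mult algebra_simps)

lemma wave_of_real: "wave e (of_real r * z) l t = of_real r * wave e z l t"
  by (simp add: wave_def mult_ac)

lemma leading_zero_family_covers:
  assumes k: "k \<ge> 3" and par: "(A, B) \<in> parameters k" and 0: "sum_part (solution k A B) k t = 0"
  shows "\<exists>v\<in>topspace (Euclidean_space ((4 * k - 4) - 1)). leading_zero_family k v = (A, B)"
proof -
  have red: "reduced A B k = B k" using parameters_cases(2)[OF par, of "k + 2"] by (simp add: reduced_def)
  have "sum_part (solution k A B) k t = (\<Sum>l = 1..k. if l = k then mode_s (A k) (B k) k k t else 0)"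
    unfolding sum_part_solution
    by (intro sum.cong refl) (auto simp: red mode_s_def coef_less Complex_eq)
  then have "mode_s (A k) (B k) k k t = 0" using 0 k by simp
  then have w: "Re (wave (- 1) (A k) k t) = 0" "Im (wave 1 (B k) k t) = 0"
    by (simp_all add: mode_s_def coef_diag complex_eq_iff)
  \<comment> \<open>The free coordinates are \<open>A 3\<close> to \<open>A (k - 1)\<close>, followed by the first \<open>k - 1\<close> reduced parameters.\<close>
  define z where "z = (\<lambda>i. if i + 3 < k then A (i + 3) else reduced A B (i + 4 - k))"
  obtain v where v: "v \<in> topspace (Euclidean_space ((4 * k - 4) - 1))"
    "v 0 = t" "v 1 = Im (wave (- 1) (A k) k t)" "v 2 = Re (wave 1 (B k) k t)" "\<And>i. i < 2 * k - 4 \<Longrightarrow> free v i = z i"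
    using free_coordinates[OF k] by metis
  have Ak: "\<i> * of_real (v 1) * cis (- (real k - 1) * v 0) = A k"
  proof -
    have "wave (- 1) (A k) k t = \<i> * of_real (v 1)" using w(1) v(3) by (simp add: complex_eq_iff)
    then show ?thesis using wave_inverse[of "A k" "-1" k t] by (simp add: v(2) algebra_simps)
  qed
  have Bk: "of_real (v 2) * cis ((real k + 1) * v 0) = reduced A B k"
  proof -
    have "wave 1 (B k) k t = of_real (v 2)" using w(2) v(4) by (simp add: complex_eq_iff)
    then show ?thesis using wave_inverse[of "B k" 1 k t] by (simp add: v(2) red)
  qed
  have "leading_zero_family k v = (A, B)"
    unfolding leading_zero_family_def
  proof (rule restored_reduced[OF par])
    show "A l = (if 3 \<le> l \<and> l < k then free v (l - 3)
        else if l = k then \<i> * of_real (v 1) * cis (- (real k - 1) * v 0) else 0)" for l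
    proof -
      consider "3 \<le> l" "l < k" | "l = k" | "l \<le> 2" | "l > k" by linarith
      then show ?thesis
      proof cases
        case 1
        then show ?thesis using k by (simp add: v(5) z_def)
      next
        case 2
        then show ?thesis by (simp only: Ak) simp
      qed (use k parameters_cases[OF par, of l] in auto)
    qed
    show "reduced A B l = (if l = k then of_real (v 2) * cis ((real k + 1) * v 0) else free v (k + l - 4))"
      if "l \<in> {1..k}" for l
    proof (cases "l = k")
      case False
      then have "free v (k + l - 4) = z (k + l - 4)" using that k by (intro v(5)) auto
      moreover have "\<not> k + l - 4 + 3 < k" "k + l - 4 + 4 - k = l" using that k by auto
      ultimately show ?thesis using False by (simp add: z_def)
    qed (simp only: Bk if_True simp_thms)
  qed
  then show ?thesis using v(1) by blast
qed

lemma singular_family_covers: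
  assumes k: "k \<ge> 3" and par: "(A, B) \<in> parameters k" and "\<mu> \<noteq> 0"
    and Re: "(\<Sum>l = 1..k. Re_weight k x l * Re (wave (- 1) (A l) l t)) = 0"
    and Im: "(\<Sum>l = 1..k. reduced_weight k x l * Im (wave 1 (reduced A B l) l t)) = 0"
  shows "\<exists>v\<in>topspace (Euclidean_space ((4 * k - 4) - 1)). v 0 = t \<and> v 1 = s \<and>
    (\<forall>l\<in>{4..k}. A l = of_real (\<mu> * (1 + x\<^sup>2)) * free v (l - 4)) \<and>
    singular_family k v x \<mu> (Im (wave (- 1) (A 3) 3 t)) = (A, B)"
proof -
  define \<kappa> where "\<kappa> = \<mu> * (1 + x\<^sup>2)"
  have x2: "1 + x\<^sup>2 \<noteq> 0" by (metis add_nonneg_eq_0_iff zero_le_one zero_le_power2 zero_neq_one)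
  then have "\<kappa> \<noteq> 0" using \<open>\<mu> \<noteq> 0\<close> by (simp add: \<kappa>_def)
  \<comment> \<open>The free coordinates are the rescaled \<open>A 4\<close> to \<open>A k\<close>, followed by the reduced parameters from the second on.\<close>
  define z where "z = (\<lambda>i. if i + 4 \<le> k then A (i + 4) / of_real \<kappa> else reduced A B (i + 5 - k))"
  obtain v where v: "v \<in> topspace (Euclidean_space ((4 * k - 4) - 1))"
    "v 0 = t" "v 1 = s" "v 2 = Re (wave 1 (reduced A B 1) 1 t)" "\<And>i. i < 2 * k - 4 \<Longrightarrow> free v i = z i"
    using free_coordinates[OF k] by metis
  have A4: "A l = of_real \<kappa> * free v (l - 4)" if "l \<in> {4..k}" for l
  proof -
    have "free v (l - 4) = z (l - 4)" using that k by (intro v(5)) auto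
    then show ?thesis using that \<open>\<kappa> \<noteq> 0\<close> by (simp add: z_def)
  qed
  have b2: "reduced A B l = free v (k + l - 5)" if "l \<in> {2..k}" for l
  proof -
    have "free v (k + l - 5) = z (k + l - 5)" using that k by (intro v(5)) auto
    moreover have "\<not> k + l - 5 + 4 \<le> k" "k + l - 5 + 5 - k = l" using that k by auto
    ultimately show ?thesis by (simp add: z_def)
  qed
  have "(\<Sum>l = 1..k. Re_weight k x l * Re (wave (- 1) (A l) l t)) =
      (\<Sum>l = 3..k. Re_weight k x l * Re (wave (- 1) (A l) l t))"
    by (intro sum.mono_neutral_right) (auto simp: parameters_cases(1)[OF par] wave_def)
  also have "\<dots> = Re_weight k x 3 * Re (wave (- 1) (A 3) 3 t) + (\<Sum>l = 4..k. Re_weight k x l * Re (wave (- 1) (A l) l t))"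
    using k by (subst sum.atLeast_Suc_atMost) simp_all
  also have "(\<Sum>l = 4..k. Re_weight k x l * Re (wave (- 1) (A l) l t)) =
      \<kappa> * (\<Sum>l = 4..k. Re_weight k x l * Re (wave (- 1) (free v (l - 4)) l t))"
    unfolding sum_distrib_left by (intro sum.cong refl) (simp add: A4 wave_of_real)
  finally have "6 * (1 + x\<^sup>2) * Re (wave (- 1) (A 3) 3 t) = (1 + x\<^sup>2) * (- \<mu> * (\<Sum>l = 4..k. Re_weight k x l * Re (wave (- 1) (free v (l - 4)) l t)))"
    using Re by (simp add: Re_weight_3[OF k] \<kappa>_def algebra_simps)
  then have "(1 + x\<^sup>2) * (6 * Re (wave (- 1) (A 3) 3 t)) = (1 + x\<^sup>2) * (- \<mu> * (\<Sum>l = 4..k. Re_weight k x l * Re (wave (- 1) (free v (l - 4)) l t)))"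
    by (simp only: mult_ac)
  then have "6 * Re (wave (- 1) (A 3) 3 t) = - \<mu> * (\<Sum>l = 4..k. Re_weight k x l * Re (wave (- 1) (free v (l - 4)) l t))"
    using x2 by (simp only: mult_cancel_left simp_thms)
  then have "wave (- 1) (A 3) 3 t = Complex (- \<mu> / 6 * (\<Sum>l = 4..k. Re_weight k x l * Re (wave (- 1) (free v (l - 4)) l t))) (Im (wave (- 1) (A 3) 3 t))"
    by (simp add: complex_eq_iff)
  then have A3: "A 3 = Complex (- \<mu> / 6 * (\<Sum>l = 4..k. Re_weight k x l * Re (wave (- 1) (free v (l - 4)) l (v 0)))) (Im (wave (- 1) (A 3) 3 t)) * cis (- 2 * v 0)"
    using wave_inverse[of "A 3" "-1" 3 t] by (simp add: v(2))
  have "(\<Sum>l = 1..k. reduced_weight k x l * Im (wave 1 (reduced A B l) l t)) =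
      2 * Im (wave 1 (reduced A B 1) 1 t) + (\<Sum>l = 2..k. reduced_weight k x l * Im (wave 1 (reduced A B l) l t))"
    using k by (subst sum.atLeast_Suc_atMost) (simp_all add: reduced_weight_1[unfolded One_nat_def] numeral_2_eq_2)
  also have "(\<Sum>l = 2..k. reduced_weight k x l * Im (wave 1 (reduced A B l) l t)) =
      (\<Sum>l = 2..k. reduced_weight k x l * Im (wave 1 (free v (k + l - 5)) l t))"
    by (intro sum.cong refl) (simp add: b2)
  finally have "wave 1 (reduced A B 1) 1 t = Complex (v 2) (- 1 / 2 * (\<Sum>l = 2..k. reduced_weight k x l * Im (wave 1 (free v (k + l - 5)) l t)))"
    using Im v(4) by (simp add: complex_eq_iff)
  then have b1: "reduced A B 1 = Complex (v 2) (- 1 / 2 * (\<Sum>l = 2..k. reduced_weight k x l * Im (wave 1 (free v (k + l - 5)) l (v 0)))) * cis (2 * v 0)"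
    using wave_inverse[of "reduced A B 1" 1 1 t] by (simp add: v(2))
  have "singular_family k v x \<mu> (Im (wave (- 1) (A 3) 3 t)) = (A, B)"
    unfolding singular_family_def \<kappa>_def[symmetric]
  proof (rule restored_reduced[OF par], goal_cases)
    case (1 l)
    consider "l = 3" | "l \<in> {4..k}" | "l \<le> 2" | "l > k" by fastforce
    then show ?case
    proof cases
      case 1
      then show ?thesis by (simp only: A3[symmetric] if_True simp_thms)
    next
      case 2
      then show ?thesis using A4[of l] by simp
    qed (use k parameters_cases[OF par, of l] in auto)
  next
    case (2 l)
    then show ?case
      by (cases "l = 1") (simp_all only: b1[symmetric] if_True if_False simp_thms, use b2[of l] 2 in simp_all)
  qed
  then show ?thesis using v A4 unfolding \<kappa>_def by blast
qed

text \<open>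
  Three families cover the nongeneric parameters: the leading coefficient has a zero, there is a
  singular point with \<open>x \<noteq> 0\<close> (then \<open>x = v 1\<close> and \<open>\<sigma>\<close> is solved from the equation with \<open>Im_weight\<close>), or there is one
  with \<open>x = 0\<close> (then \<open>\<sigma> = v 1\<close>).
\<close>

lemma positive_codimension_nongeneric_parameters:
  assumes k: "k \<ge> 3"
  shows "positive_codimension k (nongeneric_parameters k)"
proof -
  let ?d = "(4 * k - 4) - 1"
  define \<sigma> where "\<sigma> = (\<lambda>v :: nat \<Rightarrow> real. - (1 + (v 1)\<^sup>2) / 6 *
    (\<Sum>l = 4..k. Im_weight k (v 1) l * Im (wave (- 1) (free v (l - 4)) l (v 0))))"
  define g where "g = (\<lambda>n :: nat. if n = 0 then leading_zero_family k
    else if n = 1 then (\<lambda>v. singular_family k v (v 1) (v 1) (\<sigma> v))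
    else (\<lambda>v. singular_family k v 0 1 (v 1)))"
  have c: "(\<lambda>v. v 0) \<in> coords ?d" "(\<lambda>v. v 1) \<in> coords ?d" using k by (auto intro!: coords_memI)
  have \<sigma>: "trig_poly (coords ?d) (\<lambda>v. of_real (\<sigma> v))"
    unfolding \<sigma>_def divide_inverse of_real_mult of_real_sum of_real_minus of_real_add of_real_power
    by (intro trig_poly.mult trig_poly_uminus trig_poly.add trig_poly_power trig_poly.const trig_poly_sum
        trig_poly_weight trig_poly_Im trig_poly_wave trig_poly.coord c trig_poly_free k) auto
  have smooth: "smooth_coords ?d U (\<lambda>v. fst (g n v) j) \<and> smooth_coords ?d U (\<lambda>v. snd (g n v) j)" for U n j
  proof -
    note x = trig_poly.coord[OF c(2)] and r = trig_poly.const[of "coords ?d" "of_real _"]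
    consider "n = 0" | "n = 1" | "n \<ge> 2" by linarith
    then show ?thesis
    proof cases
      case 1
      then show ?thesis using trig_poly_leading_zero_family[OF k] by (simp add: g_def trig_poly_smooth_coords)
    next
      case 2
      then show ?thesis using trig_poly_singular_family[OF k x x \<sigma>] by (simp add: g_def trig_poly_smooth_coords)
    next
      case 3
      then show ?thesis using trig_poly_singular_family[OF k r r x] by (simp add: g_def trig_poly_smooth_coords)
    qed
  qed
  have cover: "\<exists>n. \<exists>v\<in>topspace (Euclidean_space ?d). g n v = (A, B)" if bad: "(A, B) \<in> nongeneric_parameters k" for A B
  proof -
    have par: "(A, B) \<in> parameters k" using bad by (simp add: nongeneric_parameters_def)
    consider t where "sum_part (solution k A B) k t = 0"
      | x y t where "conj_cross (Phi_x k (solution k A B) (x, y, t)) (Phi_y (x, y, t)) = 0"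
      using bad by (auto simp: nongeneric_parameters_def)
    then show ?thesis
    proof cases
      case 1
      from leading_zero_family_covers[OF k par this] show ?thesis by (intro exI[of _ 0]) (simp add: g_def)
    next
      case 2
      have "k \<ge> 1" using k by simp
      note e = singular_equations[OF this par 2]
      define s where "s = Im (wave (- 1) (A 3) 3 t)"
      show ?thesis
      proof (cases "x = 0")
        case True
        obtain v where "v \<in> topspace (Euclidean_space ?d)" "v 1 = s" "singular_family k v x 1 s = (A, B)"
          using singular_family_covers[OF k par one_neq_zero e(1,2), of s] unfolding s_def by blast
        then show ?thesis using True by (intro exI[of _ 2] bexI[of _ v]) (simp_all add: g_def)
      next
        case False
        obtain v where v: "v \<in> topspace (Euclidean_space ?d)" "v 0 = t" "v 1 = x"
          "\<forall>l\<in>{4..k}. A l = of_real (x * (1 + x\<^sup>2)) * free v (l - 4)" "singular_family k v x x s = (A, B)"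
          using singular_family_covers[OF k par False e(1,2), of x] unfolding s_def by blast
        have sum0: "(\<Sum>l = 1..k. Im_weight k x l * Im (wave (- 1) (A l) l t)) = 0"
          using e(3) False by (simp only: mult_eq_0_iff simp_thms)
        have "(\<Sum>l = 1..k. Im_weight k x l * Im (wave (- 1) (A l) l t)) =
            (\<Sum>l = 3..k. Im_weight k x l * Im (wave (- 1) (A l) l t))"
          by (intro sum.mono_neutral_right) (auto simp: parameters_cases(1)[OF par] wave_def)
        also have "\<dots> = Im_weight k x 3 * s + (\<Sum>l = 4..k. Im_weight k x l * Im (wave (- 1) (A l) l t))"
          using k by (subst sum.atLeast_Suc_atMost) (simp_all add: s_def)
        also have "(\<Sum>l = 4..k. Im_weight k x l * Im (wave (- 1) (A l) l t)) =
            x * (1 + x\<^sup>2) * (\<Sum>l = 4..k. Im_weight k x l * Im (wave (- 1) (free v (l - 4)) l t))"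
          unfolding sum_distrib_left
        proof (intro sum.cong refl)
          fix l assume "l \<in> {4..k}"
          then show "Im_weight k x l * Im (wave (- 1) (A l) l t) =
              x * (1 + x\<^sup>2) * (Im_weight k x l * Im (wave (- 1) (free v (l - 4)) l t))"
            using v(4) by (simp only: wave_of_real) simp
        qed
        finally have "x * (6 * s + (1 + x\<^sup>2) * (\<Sum>l = 4..k. Im_weight k x l * Im (wave (- 1) (free v (l - 4)) l t))) = 0"
          using sum0 by (simp add: Im_weight_3[OF k] algebra_simps)
        then have "6 * s = - ((1 + x\<^sup>2) * (\<Sum>l = 4..k. Im_weight k x l * Im (wave (- 1) (free v (l - 4)) l t)))"
          using False by (simp only: mult_eq_0_iff simp_thms eq_neg_iff_add_eq_0)
        moreover have "6 * \<sigma> v = - ((1 + x\<^sup>2) * (\<Sum>l = 4..k. Im_weight k x l * Im (wave (- 1) (free v (l - 4)) l t)))"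
          unfolding \<sigma>_def v(2,3) by (simp only: times_divide_eq_left times_divide_eq_right mult_minus_left)
        ultimately have "6 * \<sigma> v = 6 * s" by (simp only:)
        then have "\<sigma> v = s" by simp
        then show ?thesis using v by (intro exI[of _ 1] bexI[of _ v]) (simp_all add: g_def)
      qed
    qed
  qed
  have "nongeneric_parameters k \<subseteq> (\<Union>n. g n ` topspace (Euclidean_space ?d))"
  proof (rule subrelI)
    fix A B assume "(A, B) \<in> nongeneric_parameters k"
    then obtain n v where "v \<in> topspace (Euclidean_space ?d)" "g n v = (A, B)" using cover by blast
    then have "(A, B) \<in> g n ` topspace (Euclidean_space ?d)" by (intro image_eqI[of _ "g n" v]) simp_all
    then show "(A, B) \<in> (\<Union>n. g n ` topspace (Euclidean_space ?d))" by (rule UN_I[OF UNIV_I])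
  qed
  then have "dimension_at_most ?d (nongeneric_parameters k)"
    unfolding dimension_at_most_def
    by (intro exI[of _ "\<lambda>n. topspace (Euclidean_space ?d)"] exI[of _ g] conjI allI openin_topspace
        conjunct1[OF smooth] conjunct2[OF smooth])
  then show ?thesis by (auto simp: positive_codimension_def nongeneric_parameters_def)
qed

theorem theorem12p7:
  fixes k :: nat
  assumes "k \<ge> 3"
  shows
    "(\<forall>(A, B)\<in>parameters k. \<exists>!p. is_solution k A B p) \<and>
     (\<forall>(A, B)\<in>parameters k. \<forall>p. is_solution k A B p \<longrightarrow>
        (\<exists>F. (\<forall>z. F (proj z) = Phi k p z) \<and> special_lagrangian_3fold quotient_atlas F)) \<and>
     (\<exists>S. positive_codimension k S \<and>
        (\<forall>(A, B)\<in>parameters k - S. \<forall>p. is_solution k A B p \<longrightarrow>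
           (\<exists>F. (\<forall>z. F (proj z) = Phi k p z) \<and> immersion quotient_atlas F) \<and>
           closed (range (Phi k p)) \<and>
           diffeomorphic quotient_atlas circle_times_plane))"
proof -
  have k: "k \<ge> 1" using assms by simp
  have eq: "p = solution k A B" if "(A, B) \<in> parameters k" "is_solution k A B p" for A B p
    using is_solution_eq[OF k that] .
  have 1: "\<exists>!p. is_solution k A B p" if "(A, B) \<in> parameters k" for A B
    using solution_is_solution[OF k that] eq[OF that] by blast
  have 2: "\<exists>F. (\<forall>z. F (proj z) = Phi k p z) \<and> special_lagrangian_3fold quotient_atlas F"
    if "(A, B) \<in> parameters k" "is_solution k A B p" for A B p
    unfolding eq[OF that] using Phi_descends[of k A B] special_lagrangian_Phi[OF k that(1)] by metis
  have 3: "(\<exists>F. (\<forall>z. F (proj z) = Phi k p z) \<and> immersion quotient_atlas F) \<and> closed (range (Phi k p))"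
    if par: "(A, B) \<in> parameters k" and good: "(A, B) \<notin> nongeneric_parameters k" and sol: "is_solution k A B p" for A B p
    unfolding eq[OF par sol]
  proof
    have reg: "conj_cross (Phi_x k (solution k A B) z) (Phi_y z) \<noteq> 0" and nz: "sum_part (solution k A B) k t \<noteq> 0" for z t
      using par good unfolding nongeneric_parameters_def by blast+
    show "\<exists>F. (\<forall>z. F (proj z) = Phi k (solution k A B) z) \<and> immersion quotient_atlas F"
      using Phi_descends[of k A B] immersion_Phi[OF k par _ reg] by metis
    have "continuous_on UNIV (Phi k (solution k A B))"
      using smooth_on_Phi[of UNIV k A B] unfolding smooth_on_def by (metis Ck_on.simps(1))
    then show "closed (range (Phi k (solution k A B)))"
      by (intro closed_range_Phi[OF k solution_properties(1)[OF k par] Phi_deck _ nz])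
  qed
  have "\<forall>(A, B)\<in>parameters k - nongeneric_parameters k. \<forall>p. is_solution k A B p \<longrightarrow>
      (\<exists>F. (\<forall>z. F (proj z) = Phi k p z) \<and> immersion quotient_atlas F) \<and>
      closed (range (Phi k p)) \<and> diffeomorphic quotient_atlas circle_times_plane"
    using 3 diffeomorphic_circle_times_plane by blast
  moreover note positive_codimension_nongeneric_parameters[OF assms]
  moreover have "\<forall>(A, B)\<in>parameters k. \<exists>!p. is_solution k A B p" by (intro ballI) (simp add: case_prod_beta 1)
  moreover have "\<forall>(A, B)\<in>parameters k. \<forall>p. is_solution k A B p \<longrightarrow>
      (\<exists>F. (\<forall>z. F (proj z) = Phi k p z) \<and> special_lagrangian_3fold quotient_atlas F)"
    using 2 by blast
  ultimately show ?thesis by (intro conjI exI[of _ "nongeneric_parameters k"])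
qed

end
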